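(* Let $q$ be a prime power, $n\ge 1$ and $r\ge 2$ integers, and let $U$ be a nonzero $m$-dimensional $\mathbb{F}_q$-subspace of $\mathrm{AG}(r-1,q^n)=\mathbb{F}_{q^n}^{\,r-1}$. Let $w$ be the largest integer such that for each line $\ell$ of $\mathrm{AG}(r-1,q^n)$ through the origin either $U\cap \ell=\{(0,\ldots,0)\}$ or $|U\cap \ell|\ge q^w$. (a) If $n\mid m$, then $w\mid n$ and $\mathbb{F}_{q^w}$ is the largest subfield of $\mathbb{F}_{q^n}$ such that $U$ is $\mathbb{F}_{q^w}$-linear (i.e. the largest subfield $K$ of $\mathbb{F}_{q^n}$ such that $U$ is a $K$-subspace). (b) If $n\nmid m$ and $q\ge n$, then there exists an integer $d\ge w$ with $d\mid n$ such that $\mathrm{dir}(U)=\mathrm{dir}(\langle U\rangle_{\mathbb{F}_{q^d}})$.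
   Context: View $\mathrm{PG}(r-1,q^n)$ as $\mathrm{AG}(r-1,q^n)\cup H_\infty$, with $H_\infty$ the hyperplane at infinity. For a point set $S\subseteq \mathrm{AG}(r-1,q^n)$, the set of directions determined by $S$ is $\mathrm{dir}(S)=\{\langle P,Q\rangle\cap H_\infty : P,Q\in S,\ P\ne Q\}$. $\langle U\rangle_{\mathbb{F}_{q^d}}$ denotes the $\mathbb{F}_{q^d}$-span of $U$ in the vector space $\mathbb{F}_{q^n}^{\,r-1}$. *)

theory Defs
  imports "HOL-Analysis.Analysis" "HOL-Number_Theory.Prime_Powers"
begin

definition is_subfield :: "'a::field set \<Rightarrow> bool" where
  "is_subfield K \<longleftrightarrow> 0 \<in> K \<and> 1 \<in> K \<and>
     (\<forall>x\<in>K. \<forall>y\<in>K. x + y \<in> K \<and> x * y \<in> K) \<and>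
     (\<forall>x\<in>K. - x \<in> K \<and> inverse x \<in> K)"

text \<open>The library's subspaces, spans and dimensions of \<open>'a ^ 'k\<close> (prefix \<open>vec\<close>) have the full
  type \<open>'a\<close> as field of scalars. The next four definitions restrict the scalars to a subfield \<open>K\<close>.\<close>

definition subspace_over :: "'a::field set \<Rightarrow> ('a ^ 'k) set \<Rightarrow> bool" where
  "subspace_over K V \<longleftrightarrow> 0 \<in> V \<and> (\<forall>u\<in>V. \<forall>v\<in>V. u + v \<in> V) \<and> (\<forall>c\<in>K. \<forall>v\<in>V. c *s v \<in> V)"

definition span_over :: "'a::field set \<Rightarrow> ('a ^ 'k) set \<Rightarrow> ('a ^ 'k) set" where
  "span_over K S = subspace_over K hull S"

definition independent_over :: "'a::field set \<Rightarrow> ('a ^ 'k) set \<Rightarrow> bool" where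
  "independent_over K B \<longleftrightarrow>
     (\<forall>A c. finite A \<and> A \<subseteq> B \<and> (\<forall>b\<in>A. c b \<in> K) \<and> (\<Sum>b\<in>A. c b *s b) = 0 \<longrightarrow> (\<forall>b\<in>A. c b = 0))"

definition has_dim_over :: "'a::field set \<Rightarrow> ('a ^ 'k) set \<Rightarrow> nat \<Rightarrow> bool" where
  "has_dim_over K V m \<longleftrightarrow>
     (\<exists>B. finite B \<and> card B = m \<and> independent_over K B \<and> span_over K B = V)"

definition origin_lines :: "('a::field ^ 'k) set set" where
  "origin_lines = {vec.span {v} | v. v \<noteq> 0}"

text \<open>Projective subspaces are represented by linear subspaces of the space \<open>'a ^ 'k option\<close> of
  homogeneous coordinates; in particular a point is a one-dimensional linear subspace.
  The coordinate \<open>None\<close> is the homogenizing one: \<open>v\<close> in \<open>'a ^ 'k\<close> is the point \<open>\<langle>(1, v)\<rangle>\<close>,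
  and the hyperplane at infinity has the equation \<open>x $ None = 0\<close>.\<close>

definition homogeneous :: "'a::field \<Rightarrow> 'a ^ 'k \<Rightarrow> 'a ^ ('k::finite) option" where
  "homogeneous t v = (\<chi> i. case i of None \<Rightarrow> t | Some j \<Rightarrow> v $ j)"

definition affine_point :: "'a::field ^ 'k \<Rightarrow> ('a ^ ('k::finite) option) set" where
  "affine_point v = vec.span {homogeneous 1 v}"

definition hyperplane_at_infinity :: "('a::field ^ ('k::finite) option) set" where
  "hyperplane_at_infinity = {x. x $ None = 0}"

definition projective_line ::
    "('a::field ^ 'k) set \<Rightarrow> ('a ^ 'k) set \<Rightarrow> ('a ^ 'k::finite) set" where
  "projective_line P Q = vec.span (P \<union> Q)"

definition dir :: "('a::field ^ 'k) set \<Rightarrow> ('a ^ ('k::finite) option) set set" where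
  "dir S = {projective_line (affine_point P) (affine_point Q) \<inter> hyperplane_at_infinity | P Q.
              P \<in> S \<and> Q \<in> S \<and> P \<noteq> Q}"

lemma projective_line_Int_infinity:
  fixes P Q :: "'a::field ^ 'k::finite"
  shows "projective_line (affine_point P) (affine_point Q) \<inter> hyperplane_at_infinity
           = vec.span {homogeneous 0 (Q - P)}"
proof -
  let ?p = "homogeneous 1 P" and ?q = "homogeneous 1 Q" and ?d = "homogeneous 0 (Q - P)"
  have d: "?d = ?q - ?p"
    by (auto simp: homogeneous_def vec_eq_iff split: option.split)
  have line: "projective_line (affine_point P) (affine_point Q) = vec.span {?p, ?q}"
    unfolding projective_line_def affine_point_def
    using vec.span_Un[of "{?p}" "{?q}"]
    by (simp add: vec.span_Un vec.span_span insert_commute)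
  show ?thesis
  proof (intro equalityI subsetI)
    fix x assume "x \<in> projective_line (affine_point P) (affine_point Q) \<inter> hyperplane_at_infinity"
    then have x: "x \<in> vec.span {?p, ?q}" and inf: "x $ None = 0"
      by (auto simp: line hyperplane_at_infinity_def)
    from x obtain a b where x': "x = a *s ?p + b *s ?q"
      by (auto simp: vec.span_insert vec.span_singleton algebra_simps)
    with inf have "a = - b"
      by (simp add: homogeneous_def eq_neg_iff_add_eq_0)
    with x' have "x = b *s ?d"
      by (simp add: d vector_ssub_ldistrib)
    then show "x \<in> vec.span {?d}"
      by (auto simp: vec.span_singleton)
  next
    fix x assume "x \<in> vec.span {?d}"
    then obtain b where x: "x = b *s ?d"
      by (auto simp: vec.span_singleton)
    have "x \<in> vec.span {?p, ?q}"
      unfolding x d by (intro vec.span_scale vec.span_diff vec.span_base) auto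
    moreover have "x $ None = 0"
      by (simp add: x homogeneous_def)
    ultimately show "x \<in> projective_line (affine_point P) (affine_point Q) \<inter> hyperplane_at_infinity"
      by (simp add: line hyperplane_at_infinity_def)
  qed
qed

end

theory Submission
  imports Defs "HOL-Computational_Algebra.Formal_Laurent_Series" "HOL-Number_Theory.Cong"
    "HOL-Library.Function_Algebras"
begin

(* the dollar sign is reserved for the entries of vectors *)
unbundle no Formal_Power_Series.fps_syntax

text \<open>
  Write \<open>Q = q ^ n\<close>. The \<^emph>\<open>weight\<close> of a nonzero \<open>u \<in> U\<close> is the \<open>F\<close>-dimension of \<open>U \<inter> \<langle>u\<rangle>\<close>, and
  \<open>w\<close> is the smallest weight. Both parts follow from a statement about weights at least two: if
  \<open>U \<noteq> {0}\<close> and every nonzero \<open>u \<in> U\<close> has a multiplier \<open>c \<notin> F\<close> with \<open>c u \<in> U\<close>, then there is a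
  strictly larger subfield \<open>L\<close> such that

  \<^item> \<open>U\<close> is an \<open>L\<close>-subspace, provided that \<open>card U\<close> is a power of \<open>Q\<close>
    (\<open>subspace_over_larger_subfield\<close>);

  \<^item> every vector of \<open>\<langle>U\<rangle>\<^sub>L\<close> is carried into \<open>U\<close> by some nonzero scalar, provided that \<open>n \<le> q\<close>
    (\<open>span_over_larger_subfield\<close>); this property of \<open>L\<close> says that \<open>U\<close> and \<open>\<langle>U\<rangle>\<^sub>L\<close> determine
    the same directions.

  A subfield over which \<open>U\<close> is linear has at most \<open>q ^ w\<close> elements, since it acts on every
  \<open>U \<inter> \<langle>u\<rangle>\<close>. In either part one takes the largest subfield
  \<open>K\<close> with the respective property. If \<open>K\<close> had fewer than \<open>q ^ w\<close> elements, then over \<open>K\<close> all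
  weights would still exceed one, and the statement, applied to \<open>K\<close> in place of \<open>F\<close>, would
  enlarge \<open>K\<close>.

  \<^bold>\<open>When \<open>card U\<close> is a power of \<open>Q\<close>.\<close> Counting gives a complement \<open>W\<close>
  of \<open>U\<close> which is a subspace over the whole field. Let \<open>\<rho>\<close> be the projection to \<open>U\<close>
  along \<open>W\<close>. It is \<open>F\<close>-linear, so each coordinate of \<open>\<rho> (t y)\<close> is a \<open>q\<close>-polynomial
  \<open>\<Sum>b<n. C b * t ^ (q ^ b)\<close> in \<open>t\<close>, and \<open>U\<close> is linear over \<open>{c. c ^ (q ^ d) = c}\<close> as soon as \<open>d\<close>
  divides \<open>n\<close> and every exponent \<open>b\<close> that occurs. A generic scalar-valued combination \<open>g\<close> of
  coordinates has all these exponents at once. If they had no common divisor with \<open>n\<close>, one could walk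
  from \<open>1\<close> to \<open>0\<close> in the integers modulo \<open>n\<close> by steps \<open>b\<close>; a shortest such walk \<open>f\<close> produces the
  power sum \<open>\<Sum>x\<noteq>0. x ^ (q - 1) * (\<Prod>i. (g x / x) ^ (q ^ f i))\<close>. It is zero, because \<open>x ^ (q - 1)\<close>
  sums to zero over an \<open>F\<close>-subspace of dimension at least two, and it is nonzero, because
  only one term of its expansion, the one that follows the walk, contributes
  (\<open>q_poly_exponents_common_divisor\<close>).

  \<^bold>\<open>When \<open>n \<le> q\<close>.\<close> Put the \<open>n\<close> conjugates of \<open>u\<close> side by side and extend scalars to an infinite
  field; \<open>U\<close> becomes a space \<open>V\<close> of \<open>n\<close>-tuples, and multiplication by a field element becomes an
  independent rescaling of the \<open>n\<close> entries. If all weights are at least two, then the elements of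
  \<open>V\<close> which come from \<open>U\<close> stay in \<open>V\<close> under a rescaling by factors, not all zero, that kills entry
  \<open>0\<close>. This is a determinantal condition of degree at most \<open>n - 1 < q\<close>, so it extends to all of \<open>V\<close>.
  Let \<open>S\<close> be a smallest set of entries such that every \<open>a \<in> V\<close> is moved into \<open>V\<close> by factors, not all
  zero, that vanish off \<open>S\<close>.
  A generic \<open>a\<close> and an arbitrary \<open>b\<close> can then be merged along \<open>S\<close>: up to rescaling, the tuple which is
  \<open>a\<close> on \<open>S\<close> and \<open>b\<close> off \<open>S\<close> lies in \<open>V\<close> (\<open>merge_irredundant\<close>). The cyclic shifts of \<open>S\<close> have the same
  property, and merging along all of them shows that a tuple glued from elements of \<open>V\<close> along the
  partition generated by the shifts is moved into \<open>V\<close> by factors, not all zero; the blocks of this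
  partition lie in residue classes modulo the period \<open>d\<close> of \<open>S\<close> (\<open>degenerate_common_refinement\<close>).
  The conjugates of a vector of the span of \<open>U\<close> over \<open>{c. c ^ (q ^ d) = c}\<close> are such a gluing, and a
  rescaling of them into \<open>V\<close> descends to a field element (\<open>rational_multiple_if_degenerate\<close>).
\<close>

section \<open>Linear algebra over a subfield\<close>

lemma subfield_closed:
  assumes "is_subfield F"
  shows "0 \<in> F" "1 \<in> F" "x \<in> F \<Longrightarrow> y \<in> F \<Longrightarrow> x + y \<in> F" "x \<in> F \<Longrightarrow> y \<in> F \<Longrightarrow> x * y \<in> F"
    "x \<in> F \<Longrightarrow> - x \<in> F" "x \<in> F \<Longrightarrow> inverse x \<in> F" "x \<in> F \<Longrightarrow> y \<in> F \<Longrightarrow> x - y \<in> F"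
    "x \<in> F \<Longrightarrow> y \<in> F \<Longrightarrow> x / y \<in> F" "x \<in> F \<Longrightarrow> x ^ j \<in> F"
proof -
  show *: "0 \<in> F" "1 \<in> F" "x \<in> F \<Longrightarrow> y \<in> F \<Longrightarrow> x + y \<in> F" "x \<in> F \<Longrightarrow> y \<in> F \<Longrightarrow> x * y \<in> F"
    "x \<in> F \<Longrightarrow> - x \<in> F" "x \<in> F \<Longrightarrow> inverse x \<in> F" for x y
    using assms by (auto simp: is_subfield_def)
  show "x - y \<in> F" if "x \<in> F" "y \<in> F"
    using *(3)[OF that(1) *(5)[OF that(2)]] by simp
  show "x / y \<in> F" if "x \<in> F" "y \<in> F"
    using *(4)[OF that(1) *(6)[OF that(2)]] by (simp add: divide_inverse)
  show "x ^ j \<in> F" if "x \<in> F"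
    by (induction j) (use * that in auto)
qed

lemma is_subfield_UNIV: "is_subfield UNIV"
  by (simp add: is_subfield_def)

lemma card_subfield_ge_2:
  fixes F :: "'a::{field,finite} set"
  assumes "is_subfield F"
  shows "card F \<ge> 2"
proof -
  have "{0, 1} \<subseteq> F" using subfield_closed(1,2)[OF assms] by auto
  then have "card {0, 1::'a} \<le> card F" by (intro card_mono) auto
  then show ?thesis by simp
qed

text \<open>Translation by \<open>1\<close> permutes \<open>F\<close>, so the sum of all elements of \<open>F\<close> equals itself plus \<open>card F\<close>.\<close>

lemma of_nat_card_subfield:
  fixes F :: "'a::{field,finite} set"
  assumes F: "is_subfield F"
  shows "of_nat (card F) = (0::'a)"
proof -
  have "(\<Sum>x\<in>F. x) = (\<Sum>x\<in>F. x + 1)"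
    by (rule sum.reindex_bij_witness[where i="\<lambda>x. x + 1" and j="\<lambda>x. x - 1"])
      (auto intro: subfield_closed[OF F])
  then show ?thesis by (simp add: sum.distrib)
qed

text \<open>Multiplication by \<open>x \<noteq> 0\<close> permutes the nonzero elements of \<open>F\<close>; compare the products.\<close>

lemma subfield_power_card:
  fixes F :: "'a::{field,finite} set"
  assumes F: "is_subfield F" and x: "x \<in> F"
  shows "x ^ card F = x"
proof (cases "x = 0")
  case True
  then show ?thesis using card_subfield_ge_2[OF F] by simp
next
  case False
  have "(\<Prod>y\<in>F-{0}. y) = (\<Prod>y\<in>F-{0}. x * y)"
    by (rule prod.reindex_bij_witness[where i="\<lambda>y. x * y" and j="\<lambda>y. y / x"])
      (use False x in \<open>auto intro: subfield_closed[OF F]\<close>)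
  also have "\<dots> = x ^ card (F - {0}) * (\<Prod>y\<in>F-{0}. y)"
    by (simp add: prod.distrib)
  finally have "x ^ card (F - {0}) = 1" by simp
  moreover have "card F = Suc (card (F - {0}))"
    using subfield_closed(1)[OF F] by (metis card.remove finite)
  ultimately show ?thesis by simp
qed

text \<open>The elements of \<open>F\<close> already exhaust the possible roots of \<open>X ^ card F - X\<close>.\<close>

lemma mem_subfield_iff_power_card:
  fixes F :: "'a::{field,finite} set"
  assumes F: "is_subfield F"
  shows "x \<in> F \<longleftrightarrow> x ^ card F = x"
proof -
  define p :: "'a poly" where "p = monom 1 (card F) - monom 1 1"
  have 2: "card F \<ge> 2" by (rule card_subfield_ge_2[OF F])
  have "coeff p (card F) = 1" using 2 by (simp add: p_def)
  then have p0: "p \<noteq> 0" by auto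
  have "degree p \<le> card F" unfolding p_def
    by (rule degree_diff_le) (use 2 in \<open>auto intro: order.trans[OF degree_monom_le]\<close>)
  with card_poly_roots_bound[OF p0] have "card {x. poly p x = 0} \<le> card F" by simp
  moreover have "F \<subseteq> {x. poly p x = 0}"
    using subfield_power_card[OF F] by (auto simp: p_def poly_monom)
  ultimately have "F = {x. poly p x = 0}" by (intro card_seteq) auto
  then show ?thesis by (auto simp: p_def poly_monom)
qed

lemma subspace_overD:
  assumes "subspace_over F U"
  shows "0 \<in> U" "u \<in> U \<Longrightarrow> v \<in> U \<Longrightarrow> u + v \<in> U" "c \<in> F \<Longrightarrow> u \<in> U \<Longrightarrow> c *s u \<in> U"
  using assms by (auto simp: subspace_over_def)

lemma subspace_over_diff:
  assumes "is_subfield F" "subspace_over F U" "u \<in> U" "v \<in> U"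
  shows "u - v \<in> U"
proof -
  have "u + (-1) *s v \<in> U"
    by (intro subspace_overD[OF assms(2)] assms subfield_closed[OF assms(1)])
  then show ?thesis by (simp add: vec_eq_iff subspace_overD)
qed

lemma subspace_over_sum:
  assumes "subspace_over F U" "\<And>i. i \<in> A \<Longrightarrow> f i \<in> U"
  shows "sum f A \<in> U"
  using assms(2) by (induction A rule: infinite_finite_induct) (auto intro: subspace_overD[OF assms(1)])

lemma span_over_base: "S \<subseteq> span_over F S"
  unfolding span_over_def by (rule hull_subset)

lemma subspace_span_over: "subspace_over F (span_over F S)"
proof -
  have *: "subspace_over F (\<Inter>T)" if "\<forall>t\<in>T. subspace_over F t" for T :: "('a ^ 'b) set set"
    using that by (auto simp: subspace_over_def)
  show ?thesis unfolding span_over_def by (rule hull_in) (rule *)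
qed

lemma span_over_minimal: "S \<subseteq> V \<Longrightarrow> subspace_over F V \<Longrightarrow> span_over F S \<subseteq> V"
  unfolding span_over_def by (rule hull_minimal)

lemma span_over_finite:
  fixes B :: "('a::field ^ 'k) set"
  assumes F: "is_subfield F" and B: "finite B"
  shows "span_over F B = {\<Sum>b\<in>B. c b *s b | c. \<forall>b\<in>B. c b \<in> F}"
proof (rule antisym)
  show "span_over F B \<subseteq> {\<Sum>b\<in>B. c b *s b | c. \<forall>b\<in>B. c b \<in> F}" (is "_ \<subseteq> ?R")
  proof (rule span_over_minimal)
    show "B \<subseteq> ?R"
    proof
      fix b assume "b \<in> B"
      then have "b = (\<Sum>x\<in>B. (if x = b then 1 else 0) *s x)"
        using B by (simp add: if_distrib[where f="\<lambda>c. c *s _"] sum.delta cong: if_cong)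
      then show "b \<in> ?R"
        by (intro CollectI exI[where x="\<lambda>x. if x = b then 1 else 0"])
          (auto intro: subfield_closed[OF F])
    qed
    show "subspace_over F ?R"
      unfolding subspace_over_def
    proof (intro conjI ballI)
      show "0 \<in> ?R"
        by (intro CollectI exI[where x="\<lambda>_. 0"]) (auto intro: subfield_closed[OF F])
    next
      fix u v assume "u \<in> ?R" "v \<in> ?R"
      then obtain c d where "u = (\<Sum>b\<in>B. c b *s b)" "v = (\<Sum>b\<in>B. d b *s b)"
        "\<forall>b\<in>B. c b \<in> F" "\<forall>b\<in>B. d b \<in> F" by auto
      then show "u + v \<in> ?R"
        by (intro CollectI exI[where x="\<lambda>b. c b + d b"])
          (auto intro: subfield_closed[OF F] simp: vector_sadd_rdistrib sum.distrib)
    next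
      fix a v assume "a \<in> F" "v \<in> ?R"
      then obtain c where "v = (\<Sum>b\<in>B. c b *s b)" "\<forall>b\<in>B. c b \<in> F" by auto
      with \<open>a \<in> F\<close> show "a *s v \<in> ?R"
        by (intro CollectI exI[where x="\<lambda>b. a * c b"])
          (auto intro: subfield_closed[OF F] simp: vec.scale_sum_right)
    qed
  qed
  have "(\<Sum>b\<in>B. c b *s b) \<in> span_over F B" if "\<forall>b\<in>B. c b \<in> F" for c
    using that span_over_base[of B F]
    by (intro subspace_over_sum[OF subspace_span_over] subspace_overD(3)[OF subspace_span_over]) auto
  then show "{\<Sum>b\<in>B. c b *s b | c. \<forall>b\<in>B. c b \<in> F} \<subseteq> span_over F B" by auto
qed

lemma independent_overD:
  assumes "independent_over F B" "finite B" "\<forall>b\<in>B. c b \<in> F" "(\<Sum>b\<in>B. c b *s b) = 0" "b \<in> B"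
  shows "c b = 0"
proof -
  have "\<forall>b\<in>B. c b = 0"
    by (rule mp[OF spec[OF spec[OF assms(1)[unfolded independent_over_def], of B], of c]])
      (intro conjI assms subset_refl)
  with assms(5) show ?thesis by (rule bspec[rotated])
qed

lemma zero_notin_independent_over:
  fixes B :: "('a::field ^ 'k) set"
  assumes "is_subfield F" "independent_over F B"
  shows "0 \<notin> B"
proof
  assume "0 \<in> B"
  have "\<forall>b\<in>{0 :: 'a ^ 'k}. (1::'a) = 0"
    by (rule mp[OF spec[OF spec[OF assms(2)[unfolded independent_over_def], of "{0}"], of "\<lambda>_. 1"]])
      (use \<open>0 \<in> B\<close> subfield_closed(2)[OF assms(1)] in simp)
  then show False by simp
qed

lemma card_span_over:
  fixes B :: "('a::field ^ 'k) set"
  assumes F: "is_subfield F" and B: "finite B" "independent_over F B"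
  shows "card (span_over F B) = card F ^ card B"
proof -
  let ?s = "\<lambda>c. \<Sum>b\<in>B. c b *s b"
  have "bij_betw ?s (PiE B (\<lambda>_. F)) (span_over F B)"
    unfolding bij_betw_def
  proof
    show "inj_on ?s (PiE B (\<lambda>_. F))"
    proof (rule inj_onI)
      fix c d assume cd: "c \<in> PiE B (\<lambda>_. F)" "d \<in> PiE B (\<lambda>_. F)" and eq: "?s c = ?s d"
      have "(\<Sum>b\<in>B. (c b - d b) *s b) = 0"
        using eq by (simp add: vec.scale_left_diff_distrib sum_subtractf)
      moreover have "\<forall>b\<in>B. c b - d b \<in> F"
        using cd by (blast intro: subfield_closed(7)[OF F] PiE_mem)
      ultimately have "\<forall>b\<in>B. c b - d b = 0"
        using independent_overD[OF B(2,1), of "\<lambda>b. c b - d b"] by auto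
      with cd show "c = d" by (intro PiE_ext[OF cd]) auto
    qed
    show "?s ` PiE B (\<lambda>_. F) = span_over F B"
    proof (intro equalityI subsetI)
      fix v assume "v \<in> span_over F B"
      then obtain c where c: "v = ?s c" "\<forall>b\<in>B. c b \<in> F" by (auto simp: span_over_finite[OF F B(1)])
      then have "v = ?s (restrict c B)" "restrict c B \<in> PiE B (\<lambda>_. F)" by auto
      then show "v \<in> ?s ` PiE B (\<lambda>_. F)" by blast
    qed (auto simp: span_over_finite[OF F B(1)])
  qed
  from bij_betw_same_card[OF this] B show ?thesis by (simp add: card_PiE)
qed

lemma has_dim_over_card:
  "is_subfield F \<Longrightarrow> has_dim_over F V m \<Longrightarrow> card V = card F ^ m"
  by (auto simp: has_dim_over_def card_span_over)

text \<open>For a finite set it suffices to test relations that involve all of its elements: extend the others by zero.\<close>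

lemma independent_overI:
  fixes B :: "('a::field ^ 'k) set"
  assumes "is_subfield F" "finite B"
    and "\<And>c. \<forall>b\<in>B. c b \<in> F \<Longrightarrow> (\<Sum>b\<in>B. c b *s b) = 0 \<Longrightarrow> \<forall>b\<in>B. c b = 0"
  shows "independent_over F B"
  unfolding independent_over_def
proof (intro allI impI, elim conjE)
  fix A and c :: "'a ^ 'k \<Rightarrow> 'a"
  assume A: "finite A" "A \<subseteq> B" "\<forall>b\<in>A. c b \<in> F" "(\<Sum>b\<in>A. c b *s b) = 0"
  let ?c = "\<lambda>b. if b \<in> A then c b else 0"
  have "(\<Sum>b\<in>B. ?c b *s b) = (\<Sum>b\<in>A. c b *s b)"
    by (rule sum.mono_neutral_cong_right) (use A assms(2) in auto)
  then have "(\<Sum>b\<in>B. ?c b *s b) = 0" using A(4) by (rule trans)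
  moreover have "\<forall>b\<in>B. ?c b \<in> F" using A(3) subfield_closed(1)[OF assms(1)] by simp
  ultimately have c0: "\<forall>b\<in>B. ?c b = 0" by (rule assms(3)[rotated])
  show "\<forall>b\<in>A. c b = 0"
  proof
    fix b assume "b \<in> A"
    with A(2) c0 have "?c b = 0" by blast
    with \<open>b \<in> A\<close> show "c b = 0" by simp
  qed
qed

text \<open>A maximal independent subset spans.\<close>

lemma ex_basis_over:
  fixes U :: "('a::{field,finite} ^ 'k::finite) set"
  assumes F: "is_subfield F" and U: "subspace_over F U"
  obtains B where "B \<subseteq> U" "independent_over F B" "span_over F B = U"
proof -
  let ?P = "\<lambda>B. B \<subseteq> U \<and> independent_over F B"
  have "\<exists>B. ?P B \<and> (\<forall>C. ?P C \<longrightarrow> card C \<le> card B)"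
  proof (rule Lattices_Big.ex_has_greatest_nat[where b="Suc (card U)"])
    show "?P {}" by (simp add: independent_over_def)
    show "\<forall>C. ?P C \<longrightarrow> card C < Suc (card U)"
      by (auto simp: less_Suc_eq_le intro: card_mono)
  qed
  then obtain B where B: "?P B" and max: "\<And>C. ?P C \<Longrightarrow> card C \<le> card B"
    by blast
  have "span_over F B = U"
  proof (rule ccontr)
    assume "span_over F B \<noteq> U"
    moreover have "span_over F B \<subseteq> U" using B U by (intro span_over_minimal) auto
    ultimately obtain v where v: "v \<in> U" "v \<notin> span_over F B" by auto
    then have vB: "v \<notin> B" using span_over_base by blast
    have "independent_over F (insert v B)"
    proof (rule independent_overI[OF F])
      fix c assume c: "\<forall>b\<in>insert v B. c b \<in> F" and "(\<Sum>b\<in>insert v B. c b *s b) = 0"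
      then have 0: "c v *s v + (\<Sum>b\<in>B. c b *s b) = 0" using vB by simp
      have "c v = 0"
      proof (rule ccontr)
        assume cv: "c v \<noteq> 0"
        have "v = inverse (c v) *s (c v *s v)" using cv by simp
        also have "c v *s v = - (\<Sum>b\<in>B. c b *s b)" using 0 by (simp add: eq_neg_iff_add_eq_0)
        finally have "v = (\<Sum>b\<in>B. (- inverse (c v) * c b) *s b)"
          by (simp add: vec.scale_sum_right sum_negf)
        moreover have "\<forall>b\<in>B. - inverse (c v) * c b \<in> F"
          using c by (intro ballI subfield_closed(4,5,6)[OF F]) auto
        ultimately have "v \<in> span_over F B"
          unfolding span_over_finite[OF F finite] by (intro CollectI exI[where x="\<lambda>b. - inverse (c v) * c b"]) auto
        with v show False by simp
      qed
      with 0 c independent_overD[of F B c] B show "\<forall>b\<in>insert v B. c b = 0"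
        by auto
    qed simp
    with v B have "card (insert v B) \<le> card B" by (intro max) auto
    with vB show False by simp
  qed
  with B that show ?thesis by auto
qed

lemma card_subspace_over:
  fixes U :: "('a::{field,finite} ^ 'k::finite) set"
  assumes F: "is_subfield F" and U: "subspace_over F U"
  obtains d where "card U = card F ^ d"
proof -
  obtain B where B: "B \<subseteq> U" "independent_over F B" "span_over F B = U" by (rule ex_basis_over[OF F U])
  from card_span_over[OF F finite B(2)] B(3) have "card U = card F ^ card B" by simp
  then show ?thesis by (rule that)
qed

section \<open>Frobenius powers and q-polynomials\<close>

lemma frobenius_power_sum:
  fixes f :: "'b \<Rightarrow> 'c::field"
  assumes "primepow q" "of_nat q = (0::'c)"
  shows "(sum f A) ^ (q ^ j) = (\<Sum>i\<in>A. f i ^ (q ^ j))"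
proof -
  obtain p e where pe: "prime p" "q = p ^ e" using assms(1) by (auto simp: primepow_def)
  have "of_nat p = (0::'c)" using assms(2) pe by simp
  then have "CHAR('c) dvd p" by (simp add: of_nat_eq_0_iff_char_dvd)
  with pe(1) have "CHAR('c) = p"
    using CHAR_not_1 by (auto simp: prime_nat_iff)
  with pe show ?thesis
    by (intro freshmans_dream_sum'[where n="e * j"]) (auto simp: power_mult)
qed

lemma frobenius_power_add:
  fixes x y :: "'c::field"
  assumes "primepow q" "of_nat q = (0::'c)"
  shows "(x + y) ^ (q ^ j) = x ^ (q ^ j) + y ^ (q ^ j)"
  using frobenius_power_sum[OF assms, of "\<lambda>b. if b then x else y" UNIV j]
  by (simp add: UNIV_bool add.commute)

lemma frobenius_power_diff:
  fixes x y :: "'c::field"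
  assumes "primepow q" "of_nat q = (0::'c)"
  shows "(x - y) ^ (q ^ j) = x ^ (q ^ j) - y ^ (q ^ j)"
  using frobenius_power_add[OF assms, of "x - y" y j] by simp

lemma power_q_power:
  fixes x :: "'a::monoid_mult"
  shows "(x ^ (q ^ i)) ^ (q ^ j) = x ^ (q ^ (i + j))"
  by (simp add: power_mult power_add flip: power_mult)

lemma power_q_power_mod:
  fixes x :: "'a::{field,finite}"
  assumes "CARD('a) = q ^ n"
  shows "x ^ (q ^ (i mod n)) = x ^ (q ^ i)"
proof -
  have *: "x ^ (q ^ (n * j)) = x" for j
  proof (induction j)
    case (Suc j)
    have "x ^ (q ^ (n * Suc j)) = (x ^ (q ^ (n * j))) ^ (q ^ n)" by (simp add: power_q_power ac_simps)
    then show ?case using Suc subfield_power_card[OF is_subfield_UNIV, of x] assms by simp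
  qed simp
  have "x ^ (q ^ i) = (x ^ (q ^ (n * (i div n)))) ^ (q ^ (i mod n))"
    by (simp add: power_q_power)
  then show ?thesis by (simp add: *)
qed

text \<open>The field \<open>'a\<close> has degree \<open>n\<close> over \<open>F\<close>, and \<open>x \<mapsto> x ^ (q ^ b)\<close> for \<open>b < n\<close> are its automorphisms
  over \<open>F\<close>. The locale is used for \<open>F\<close> itself and for intermediate fields.\<close>

locale finite_field_extension =
  fixes F :: "'a::{field,finite} set" and q n :: nat
  assumes F: "is_subfield F" and q: "card F = q" "primepow q" and Q: "CARD('a) = q ^ n"
begin

lemma q_ge_2: "q \<ge> 2"
  using card_subfield_ge_2[OF F] q by simp

lemma n_pos: "n > 0"
proof (rule ccontr)
  assume "\<not> n > 0"
  with Q card_subfield_ge_2[OF is_subfield_UNIV, where 'a='a] show False by simp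
qed

lemma of_nat_q: "of_nat q = (0::'a)"
  using of_nat_card_subfield[OF F] q by simp

lemmas frob_add = frobenius_power_add[OF q(2) of_nat_q]
lemmas frob_diff = frobenius_power_diff[OF q(2) of_nat_q]
lemmas frob_sum = frobenius_power_sum[OF q(2) of_nat_q]
lemmas frob_mod = power_q_power_mod[OF Q]

lemma mem_F_iff: "x \<in> F \<longleftrightarrow> x ^ q = x"
  using mem_subfield_iff_power_card[OF F] q by simp

lemma F_frob: "x \<in> F \<Longrightarrow> x ^ (q ^ j) = x"
  by (induction j) (auto simp: mem_F_iff power_mult)

text \<open>The degree is at most \<open>q ^ (n - 1)\<close>, which is less than the number of roots.\<close>

lemma q_poly_eq_0:
  assumes "\<And>x::'a. (\<Sum>b<n. c b * x ^ (q ^ b)) = 0" and "b < n"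
  shows "c b = (0::'a)"
proof -
  define p where "p = (\<Sum>b<n. monom (c b) (q ^ b))"
  have "p = 0"
  proof (rule ccontr)
    assume "p \<noteq> 0"
    have "degree p \<le> q ^ (n - 1)" unfolding p_def
      by (rule degree_sum_le)
        (use q_ge_2 in \<open>auto intro!: order.trans[OF degree_monom_le] power_increasing\<close>)
    also have "q ^ (n - 1) < q ^ n"
      using q_ge_2 n_pos by (intro power_strict_increasing) auto
    finally have "card {x. poly p x = 0} < CARD('a)"
      using card_poly_roots_bound[OF \<open>p \<noteq> 0\<close>] Q by simp
    moreover have "{x. poly p x = 0} = UNIV"
      using assms(1) by (simp add: p_def poly_sum poly_monom)
    ultimately show False by simp
  qed
  have "inj ((^) q)" using q_ge_2 by (auto intro!: injI)
  then have *: "(\<Sum>i<n. if q ^ i = q ^ b then c i else 0) = (\<Sum>i<n. if i = b then c i else 0)"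
    by (intro sum.cong) (auto dest: injD)
  have "0 = coeff p (q ^ b)" using \<open>p = 0\<close> by simp
  also have "\<dots> = c b" using \<open>b < n\<close> * by (simp add: p_def coeff_sum)
  finally show ?thesis by simp
qed

text \<open>Both the \<open>q\<close>-polynomials and the \<open>F\<close>-linear maps correspond to \<open>n\<close>-tuples of field elements, the
  latter through the values on an \<open>F\<close>-basis. Hence the injective map from the former to the latter
  is onto.\<close>

lemma ex_q_poly:
  fixes g :: "'a \<Rightarrow> 'a"
  assumes add: "\<And>x y. g (x + y) = g x + g y" and hom: "\<And>a x. a \<in> F \<Longrightarrow> g (a * x) = a * g x"
  obtains c where "\<And>x. g x = (\<Sum>b<n. c b * x ^ (q ^ b))"
proof -
  obtain B :: "('a ^ 1) set" where B: "independent_over F B" "span_over F B = UNIV"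
    using ex_basis_over[OF F, of "UNIV :: ('a ^ 1) set"] by (auto simp: subspace_over_def)
  have vanish: "h x = 0" if "\<And>x y. h (x + y) = h x + h y" "\<And>a x. a \<in> F \<Longrightarrow> h (a * x) = a * h x"
      "\<And>\<beta>. \<beta> \<in> B \<Longrightarrow> h (\<beta> $ 1) = 0" for h :: "'a \<Rightarrow> 'a" and x
  proof -
    have "vec x \<in> span_over F B" using B by simp
    then obtain k where k: "vec x = (\<Sum>\<beta>\<in>B. k \<beta> *s \<beta>)" "\<forall>\<beta>\<in>B. k \<beta> \<in> F"
      by (auto simp: span_over_finite[OF F])
    have "h 0 = h 0 + h 0" using that(1)[of 0 0] unfolding add_0_left .
    then have h0: "h 0 = 0" by (rule add_cancel_right_right[THEN iffD1])
    have hsum: "h (sum f A) = (\<Sum>i\<in>A. h (f i))" for f :: "'a ^ 1 \<Rightarrow> 'a" and A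
      by (induction A rule: infinite_finite_induct) (auto simp: h0 that(1))
    have "x = (vec x :: 'a ^ 1) $ 1" by simp
    also have "\<dots> = (\<Sum>\<beta>\<in>B. k \<beta> * \<beta> $ 1)" by (simp add: k(1))
    finally have "h x = (\<Sum>\<beta>\<in>B. h (k \<beta> * \<beta> $ 1))" by (simp only: hsum)
    also have "\<dots> = 0" using k(2) that(2,3) by (intro sum.neutral) auto
    finally show ?thesis .
  qed
  have "q ^ n = q ^ card B"
    using card_span_over[OF F _ B(1)] B(2) Q q by simp
  then have n: "card B = n" using q_ge_2 by simp
  define P where "P c x = (\<Sum>b<n. c b * x ^ (q ^ b))" for c and x :: 'a
  have P_add: "P c (x + y) = P c x + P c y" for c x y
    by (simp add: P_def frob_add sum.distrib algebra_simps)
  have P_hom: "P c (a * x) = a * P c x" if "a \<in> F" for a c x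
    using that by (simp add: P_def F_frob sum_distrib_left algebra_simps)
  let ?T = "\<lambda>c. restrict (\<lambda>\<beta>. P c (\<beta> $ 1)) B"
  have inj: "inj_on ?T (PiE {..<n} (\<lambda>_. UNIV))"
  proof (rule inj_onI)
    fix c d assume cd: "c \<in> PiE {..<n} (\<lambda>_. UNIV)" "d \<in> PiE {..<n} (\<lambda>_. UNIV)" and "?T c = ?T d"
    then have *: "P c (\<beta> $ 1) = P d (\<beta> $ 1)" if "\<beta> \<in> B" for \<beta>
      using that by (auto simp: fun_eq_iff restrict_def split: if_splits)
    have "P c x - P d x = 0" for x
      by (rule vanish[where h="\<lambda>x. P c x - P d x"]) (use * P_add P_hom in \<open>auto simp: algebra_simps\<close>)
    then have "(\<Sum>b<n. (c b - d b) * x ^ (q ^ b)) = 0" for x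
      by (simp add: P_def sum_subtractf algebra_simps)
    from q_poly_eq_0[OF this] show "c = d" by (intro PiE_ext[OF cd]) auto
  qed
  have "?T ` (PiE {..<n} (\<lambda>_. UNIV)) = PiE B (\<lambda>_. UNIV)"
  proof (rule card_subset_eq)
    show "card (?T ` (PiE {..<n} (\<lambda>_. UNIV))) = card (PiE B (\<lambda>_. UNIV :: 'a set))"
      by (simp add: card_image[OF inj] card_PiE n)
  qed (auto intro: finite_PiE)
  moreover have "restrict (\<lambda>\<beta>. g (\<beta> $ 1)) B \<in> PiE B (\<lambda>_. UNIV)" by auto
  ultimately obtain c where c: "restrict (\<lambda>\<beta>. g (\<beta> $ 1)) B = ?T c" by blast
  have "g x - P c x = 0" for x
  proof (rule vanish[where h="\<lambda>x. g x - P c x"])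
    show "g (\<beta> $ 1) - P c (\<beta> $ 1) = 0" if "\<beta> \<in> B" for \<beta>
      using fun_cong[OF c, of \<beta>] that by simp
  qed (use add hom P_add P_hom in \<open>auto simp: algebra_simps\<close>)
  then show ?thesis using that[of c] by (simp add: P_def)
qed

lemma frob_fixed_multiple:
  fixes c :: 'a
  assumes c: "c ^ (q ^ d) = c" and "d dvd b"
  shows "c ^ (q ^ b) = c"
proof -
  obtain j where b: "b = d * j" using \<open>d dvd b\<close> by auto
  have "c ^ (q ^ (d * j)) = c"
  proof (induction j)
    case (Suc j)
    have "c ^ (q ^ (d * Suc j)) = (c ^ (q ^ (d * j))) ^ (q ^ d)" by (simp add: power_q_power add.commute)
    then show ?case using Suc c by simp
  qed simp
  then show ?thesis by (simp add: b)
qed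

text \<open>The point is that the fixed field of \<open>x \<mapsto> x ^ (q ^ d)\<close> is larger than \<open>F\<close>. The trace
  \<open>T x\<close>, the sum of \<open>x ^ (q ^ b)\<close> over the multiples \<open>b < n\<close> of \<open>d\<close>, takes its values there. If these
  values were in \<open>F\<close>, then \<open>T x ^ q - T x\<close> would vanish for all \<open>x\<close>; but the exponents in \<open>T x ^ q\<close>
  are not divisible by \<open>d\<close>, so nothing cancels.\<close>

lemma fixed_field:
  assumes d: "d dvd n" "d > 1"
  shows "is_subfield {x::'a. x ^ (q ^ d) = x}" (is "is_subfield ?K")
    and "F \<subset> {x::'a. x ^ (q ^ d) = x}"
proof -
  show "is_subfield ?K"
    using q_ge_2 unfolding is_subfield_def
    by (auto simp: frob_add power_mult_distrib power_inverse frob_diff[of 0, simplified])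
  have "F \<noteq> ?K"
  proof
    assume eq: "F = ?K"
    obtain e where e: "n = d * e" using d by auto
    then have dn: "d \<le> n" using n_pos by (cases e) auto
    define D where "D = {b. b < n \<and> d dvd b}"
    have fD: "finite D" by (auto simp: D_def)
    define T where "T x = (\<Sum>b\<in>D. x ^ (q ^ b))" for x :: 'a
    have "T x ^ (q ^ d) = T x" for x
    proof -
      have "T x ^ (q ^ d) = (\<Sum>b\<in>D. x ^ (q ^ ((b + d) mod n)))"
        by (simp add: T_def frob_sum power_q_power frob_mod)
      also have "\<dots> = T x" unfolding T_def
      proof (rule sum.reindex_bij_betw)
        have "inj_on (\<lambda>b. (b + d) mod n) D"
        proof (rule inj_onI)
          fix a b assume ab: "a \<in> D" "b \<in> D" "(a + d) mod n = (b + d) mod n"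
          then have "[a + d = b + d] (mod n)" by (simp add: cong_def)
          then have "[a = b] (mod n)" by (simp add: cong_add_rcancel_nat)
          with ab show "a = b" by (simp add: cong_def D_def)
        qed
        moreover have "(\<lambda>b. (b + d) mod n) ` D \<subseteq> D"
          using d n_pos by (auto simp: D_def dvd_mod)
        ultimately show "bij_betw (\<lambda>b. (b + d) mod n) D D"
          using fD by (simp add: bij_betw_def endo_inj_surj)
      qed
      finally show ?thesis .
    qed
    then have "T x \<in> F" for x using eq by simp
    then have T: "T x ^ (q ^ 1) = T x" for x by (simp add: mem_F_iff)
    let ?c = "\<lambda>b. (if b \<in> Suc ` D then 1 else 0) - (if b \<in> D then 1 else (0::'a))"
    have D_less: "Suc b < n" if bD: "b \<in> D" for b
    proof -
      obtain j where j: "b = d * j" using bD by (auto simp: D_def)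
      with bD e have "j < e" by (simp add: D_def)
      then have "d * Suc j \<le> n" unfolding e by (intro mult_le_mono) auto
      with j d show ?thesis by simp
    qed
    have "(\<Sum>b<n. ?c b * x ^ (q ^ b)) = 0" for x
    proof -
      have "(\<Sum>b<n. ?c b * x ^ (q ^ b)) = (\<Sum>b<n. if b \<in> Suc ` D then x ^ (q ^ b) else 0)
          - (\<Sum>b<n. if b \<in> D then x ^ (q ^ b) else 0)"
        unfolding sum_subtractf[symmetric] by (rule sum.cong) auto
      also have "(\<Sum>b<n. if b \<in> Suc ` D then x ^ (q ^ b) else 0) = (\<Sum>b\<in>Suc ` D. x ^ (q ^ b))"
        by (rule sum.mono_neutral_cong_right) (use D_less in auto)
      also have "\<dots> = (\<Sum>b\<in>D. x ^ (q ^ (b + 1)))"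
        by (simp add: sum.reindex)
      also have "\<dots> = T x ^ (q ^ 1)"
        by (simp only: T_def frob_sum power_q_power)
      also have "(\<Sum>b<n. if b \<in> D then x ^ (q ^ b) else 0) = T x"
        unfolding T_def by (rule sum.mono_neutral_cong_right) (auto simp: D_def)
      finally show ?thesis using T by simp
    qed
    from q_poly_eq_0[OF this n_pos] n_pos show False by (auto simp: D_def split: if_splits)
  qed
  then show "F \<subset> ?K" using F_frob by auto
qed

end

section \<open>Power sums and sums of powers of q\<close>

text \<open>Unless all \<open>a ^ k\<close> are \<open>1\<close>, the substitution \<open>a \<mapsto> c * a\<close> multiplies the sum by some \<open>c ^ k \<noteq> 1\<close>.\<close>

lemma sum_power_units:
  fixes L :: "'a::{field,finite} set"
  assumes L: "is_subfield L"
  shows "(\<Sum>a\<in>L-{0}. a ^ k) = (if (card L - 1) dvd k then -1 else 0)"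
proof -
  have card: "card (L - {0}) = card L - 1" and ge2: "card L \<ge> 2"
    using subfield_closed(1)[OF L] card_subfield_ge_2[OF L] by auto
  have unit: "a ^ (card L - 1) = 1" if "a \<in> L - {0}" for a
  proof -
    have "a * a ^ (card L - 1) = a ^ Suc (card L - 1)" by simp
    also have "\<dots> = a" using subfield_power_card[OF L, of a] that ge2 by (simp del: power_Suc)
    finally show ?thesis using that by simp
  qed
  show ?thesis
  proof (cases "(card L - 1) dvd k")
    case True
    then obtain j where "k = (card L - 1) * j" by auto
    then have "a ^ k = 1" if "a \<in> L - {0}" for a
      using unit[OF that] by (simp only: power_mult power_one)
    then have "(\<Sum>a\<in>L-{0}. a ^ k) = (\<Sum>a\<in>L-{0}. 1)"
      by (rule sum.cong[OF refl])
    also have "\<dots> = of_nat (card L) - 1" using ge2 by (simp add: card of_nat_diff)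
    finally show ?thesis using True of_nat_card_subfield[OF L] by simp
  next
    case False
    define r where "r = k mod (card L - 1)"
    have r: "0 < r" "r < card L - 1" using False ge2 by (auto simp: r_def mod_greater_zero_iff_not_dvd)
    have red: "a ^ k = a ^ r" if "a \<in> L - {0}" for a
    proof -
      have "a ^ k = (a ^ (card L - 1)) ^ (k div (card L - 1)) * a ^ r"
        unfolding r_def by (simp flip: power_mult power_add)
      then show ?thesis using unit[OF that] by simp
    qed
    obtain c where c: "c \<in> L - {0}" "c ^ r \<noteq> 1"
    proof (rule ccontr)
      assume "\<not> thesis"
      then have *: "\<forall>c\<in>L-{0}. c ^ r = 1" using that by blast
      define p :: "'a poly" where "p = monom 1 r - 1"
      have "coeff p r = 1" using r by (simp add: p_def)
      then have "p \<noteq> 0" by auto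
      have "degree p \<le> r" unfolding p_def
        by (rule degree_diff_le) (auto intro: order.trans[OF degree_monom_le])
      then have "card {x. poly p x = 0} \<le> r" using card_poly_roots_bound[OF \<open>p \<noteq> 0\<close>] by simp
      moreover have "L - {0} \<subseteq> {x. poly p x = 0}" using * by (auto simp: p_def poly_monom)
      then have "card (L - {0}) \<le> card {x. poly p x = 0}" by (intro card_mono) auto
      ultimately show False using r card by simp
    qed
    have "(\<Sum>a\<in>L-{0}. a ^ k) = (\<Sum>a\<in>L-{0}. (c * a) ^ k)"
      by (rule sum.reindex_bij_witness[where i="\<lambda>a. c * a" and j="\<lambda>a. a / c"])
        (use c subfield_closed(4,8)[OF L] in auto)
    also have "\<dots> = c ^ r * (\<Sum>a\<in>L-{0}. a ^ k)"
      using red[OF c(1)] by (simp add: power_mult_distrib sum_distrib_left)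
    finally have "(1 - c ^ r) * (\<Sum>a\<in>L-{0}. a ^ k) = 0" by (simp add: algebra_simps)
    with c False show ?thesis by simp
  qed
qed

lemma sum_base_q_less:
  fixes m :: "nat \<Rightarrow> nat"
  assumes "\<And>s. s < n \<Longrightarrow> m s < q"
  shows "(\<Sum>s<n. m s * q ^ s) < q ^ n"
  using assms
proof (induction n)
  case (Suc n)
  have "(\<Sum>s<Suc n. m s * q ^ s) < q ^ n + m n * q ^ n" using Suc by simp
  also have "\<dots> = Suc (m n) * q ^ n" by simp
  also have "\<dots> \<le> q * q ^ n" using Suc.prems[of n] by (intro mult_le_mono) auto
  finally show ?case by simp
qed simp

lemma base_q_unique:
  fixes m m' :: "nat \<Rightarrow> nat"
  assumes "\<And>s. s < n \<Longrightarrow> m s < q" "\<And>s. s < n \<Longrightarrow> m' s < q"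
    and "(\<Sum>s<n. m s * q ^ s) = (\<Sum>s<n. m' s * q ^ s)" "s < n"
  shows "m s = m' s"
  using assms
proof (induction n arbitrary: s)
  case (Suc n)
  have lt: "(\<Sum>s<n. m s * q ^ s) < q ^ n" "(\<Sum>s<n. m' s * q ^ s) < q ^ n"
    using Suc.prems(1,2) by (intro sum_base_q_less; simp)+
  have eq: "(\<Sum>s<n. m s * q ^ s) + m n * q ^ n = (\<Sum>s<n. m' s * q ^ s) + m' n * q ^ n"
    using Suc.prems(3) by simp
  have "q ^ n > 0" using lt by linarith
  then have "((\<Sum>s<n. m s * q ^ s) + m n * q ^ n) div q ^ n = m n"
    "((\<Sum>s<n. m' s * q ^ s) + m' n * q ^ n) div q ^ n = m' n"
    using lt by simp_all
  with eq have n: "m n = m' n" by metis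
  with eq have "(\<Sum>s<n. m s * q ^ s) = (\<Sum>s<n. m' s * q ^ s)" by simp
  with Suc n show ?case by (cases "s = n") auto
qed simp

text \<open>Here \<open>m s\<close> counts the copies of \<open>q ^ s\<close> in a multiset of powers of \<open>q\<close>. A carry replaces \<open>q\<close> copies
  of \<open>q ^ s\<close> by one copy of \<open>q ^ (s + 1)\<close>, cyclically; it preserves the residue of the sum and makes
  the multiset smaller. So by induction a multiset that admits a carry would turn into one with
  exactly \<open>card A\<close> elements, although it had at most that many before. Without carries the
  multiplicities are base-\<open>q\<close> digits.\<close>

lemma q_power_sum_unique:
  fixes m :: "nat \<Rightarrow> nat"
  assumes q: "q \<ge> 2" and A: "A \<subseteq> {..<n}" "A \<noteq> {}"
    and "(\<Sum>s<n. m s) \<le> card A" "\<exists>s<n. m s \<noteq> 0"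
    and "[(\<Sum>s<n. m s * q ^ s) = (\<Sum>a\<in>A. q ^ a)] (mod (q ^ n - 1))" and "s < n"
  shows "m s = (if s \<in> A then 1 else 0)"
  using assms(4-7)
proof (induction "\<Sum>s<n. m s" arbitrary: m s rule: less_induct)
  case less
  have MA: "(\<Sum>a\<in>A. q ^ a) = (\<Sum>s<n. (if s \<in> A then 1 else 0) * q ^ s)"
    by (rule sum.mono_neutral_cong_left) (use A in auto)
  show ?case
  proof (cases "\<exists>s<n. m s \<ge> q")
    case True
    then obtain t where t: "t < n" "m t \<ge> q" by auto
    define t' where "t' = Suc t mod n"
    have t': "t' < n" using t by (simp add: t'_def)
    define m1 where "m1 s = (if s = t then m s - q else m s)" for s
    define m2 where "m2 s = (if s = t' then m1 s + 1 else m1 s)" for s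
    have split: "(\<Sum>s<n. m s * f s) = (\<Sum>s<n. m1 s * f s) + q * f t" for f
    proof -
      have "(\<Sum>s<n. m s * f s) = (\<Sum>s<n. m1 s * f s + (if s = t then q * f t else 0))"
        using t by (intro sum.cong) (auto simp: m1_def simp flip: add_mult_distrib)
      then show ?thesis using t by (simp add: sum.distrib)
    qed
    have split2: "(\<Sum>s<n. m2 s * f s) = (\<Sum>s<n. m1 s * f s) + f t'" for f
    proof -
      have "(\<Sum>s<n. m2 s * f s) = (\<Sum>s<n. m1 s * f s + (if s = t' then f t' else 0))"
        by (intro sum.cong) (auto simp: m2_def)
      then show ?thesis using t' by (simp add: sum.distrib)
    qed
    have tot: "(\<Sum>s<n. m2 s) < (\<Sum>s<n. m s)"
      using split[of "\<lambda>_. 1"] split2[of "\<lambda>_. 1"] q by simp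
    have qt: "[q ^ t' = q * q ^ t] (mod (q ^ n - 1))"
    proof (cases "Suc t = n")
      case True
      then have "t' = 0" by (simp add: t'_def)
      moreover have "q * q ^ t = 1 + (q ^ n - 1)" using q by (simp flip: True)
      ultimately show ?thesis by (simp only: cong_def power_0 mod_add_self2)
    next
      case False
      then have "t' = Suc t" using t by (simp add: t'_def)
      then show ?thesis by simp
    qed
    have "m2 s = (if s \<in> A then 1 else 0)" if "s < n" for s
    proof (rule less.hyps[OF tot])
      show "(\<Sum>s<n. m2 s) \<le> card A" using tot less.prems by simp
      show "\<exists>s<n. m2 s \<noteq> 0" using t' by (auto simp: m2_def)
      have "[(\<Sum>s<n. m2 s * q ^ s) = (\<Sum>s<n. m s * q ^ s)] (mod (q ^ n - 1))"
        unfolding split split2 by (intro cong_add cong_refl qt)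
      then show "[(\<Sum>s<n. m2 s * q ^ s) = (\<Sum>a\<in>A. q ^ a)] (mod (q ^ n - 1))"
        using less.prems(3) by (rule cong_trans)
    qed (rule that)
    then have "(\<Sum>s<n. m2 s) = (\<Sum>s<n. if s \<in> A then 1 else 0)" by (intro sum.cong) auto
    also have "\<dots> = card A" using A by (simp add: sum.If_cases Int_absorb1)
    finally show ?thesis using tot less.prems by simp
  next
    case False
    then have digits: "\<And>s. s < n \<Longrightarrow> m s < q" by (simp add: not_le)
    let ?X = "\<Sum>s<n. m s * q ^ s" and ?M = "\<Sum>a\<in>A. q ^ a"
    have X: "?X < q ^ n" and M: "?M < q ^ n"
      unfolding MA by (intro sum_base_q_less; use digits q in auto)+
    have X0: "?X > 0"
    proof -
      obtain j where j: "j < n" "m j \<noteq> 0" using less.prems by auto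
      then have "0 < m j * q ^ j" using q by simp
      also have "\<dots> \<le> ?X" by (rule member_le_sum) (use j in auto)
      finally show ?thesis .
    qed
    have M0: "?M > 0"
    proof -
      obtain a where a: "a \<in> A" using A by auto
      have fA: "finite A" using A finite_subset by blast
      have "0 < q ^ a" using q by simp
      also have "\<dots> \<le> ?M" by (rule member_le_sum) (use a fA in auto)
      finally show ?thesis .
    qed
    \<comment> \<open>both sums lie between 1 and \<open>q ^ n - 1\<close>; the shift by one makes them least residues\<close>
    have "[?X - 1 + 1 = ?M - 1 + 1] (mod (q ^ n - 1))" using less.prems(3) X0 M0 by simp
    then have "[?X - 1 = ?M - 1] (mod (q ^ n - 1))" by (simp only: cong_add_rcancel_nat)
    then have "?X - 1 = ?M - 1" using X M X0 M0 by (intro cong_less_imp_eq_nat) auto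
    then have "?X = ?M" using X0 M0 by simp
    then have eq: "?X = (\<Sum>s<n. (if s \<in> A then 1 else 0) * q ^ s)" unfolding MA .
    show ?thesis
      by (rule base_q_unique[OF _ _ eq less.prems(4)]) (use digits q in auto)
  qed
qed

section \<open>Walks in the integers modulo n\<close>

lemma nat_subgroup_generator:
  fixes R :: "nat set"
  assumes "n \<in> R" "n > 0" and add: "\<And>a b. a \<in> R \<Longrightarrow> b \<in> R \<Longrightarrow> a + b \<in> R"
    and sub: "\<And>a b. a + b \<in> R \<Longrightarrow> b \<in> R \<Longrightarrow> a \<in> R"
  obtains d where "d \<in> R" "d > 0" "\<And>r. r \<in> R \<Longrightarrow> d dvd r"
proof -
  define d where "d = (LEAST d. d \<in> R \<and> d > 0)"
  have d: "d \<in> R" "d > 0" using LeastI[of "\<lambda>d. d \<in> R \<and> d > 0" n] assms(1,2) by (simp_all add: d_def)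
  have zero: "0 \<in> R" using sub[of 0 n] assms(1) by simp
  have mult: "j * d \<in> R" for j by (induction j) (simp_all add: zero add d)
  have "d dvd r" if "r \<in> R" for r
  proof (rule ccontr)
    assume "\<not> d dvd r"
    then have "r mod d > 0" by (simp add: mod_greater_zero_iff_not_dvd)
    moreover have "r mod d \<in> R" using sub[of "r mod d" "r div d * d"] mult that by simp
    ultimately have "d \<le> r mod d" unfolding d_def by (intro Least_le) auto
    moreover have "r mod d < d" using d by simp
    ultimately show False by simp
  qed
  with d that show ?thesis by blast
qed

text \<open>The differences that can be realised from every starting point form a subgroup, which contains
  the steps and the modulus, hence everything.\<close>

lemma coprime_steps_reach:
  fixes n :: nat
  assumes n: "n \<ge> 2" and I: "I \<subseteq> {..<n}" and Gcd: "Gcd (insert n I) = 1"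
  shows "(1, 0) \<in> {(s, (s + b) mod n) | s b. s < n \<and> b \<in> I}\<^sup>*"
proof -
  define E where "E = {(s, (s + b) mod n) | s b. s < n \<and> b \<in> I}"
  define R where "R = {j. \<forall>s<n. (s, (s + j) mod n) \<in> E\<^sup>*}"
  have add: "a + b \<in> R" if "a \<in> R" "b \<in> R" for a b
  proof -
    have "(s, (s + (a + b)) mod n) \<in> E\<^sup>*" if s: "s < n" for s
    proof -
      have "(s, (s + a) mod n) \<in> E\<^sup>*" using \<open>a \<in> R\<close> s by (simp add: R_def)
      moreover have "((s + a) mod n, ((s + a) mod n + b) mod n) \<in> E\<^sup>*"
        using \<open>b \<in> R\<close> n by (simp add: R_def)
      ultimately have "(s, ((s + a) mod n + b) mod n) \<in> E\<^sup>*" by (rule rtrancl_trans)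
      then show ?thesis by (simp add: mod_add_left_eq add.assoc)
    qed
    then show ?thesis by (simp add: R_def)
  qed
  have nR: "n \<in> R" by (simp add: R_def)
  have zero: "0 \<in> R" by (simp add: R_def)
  have mult: "j * b \<in> R" if "b \<in> R" for j b
    by (induction j) (use zero add that in simp_all)
  have sub: "a \<in> R" if ab: "a + b \<in> R" and b: "b \<in> R" for a b
  proof -
    have "(a + b) + (n - 1) * b \<in> R" by (intro add mult ab b)
    also have "(a + b) + (n - 1) * b = a + n * b" using n by (cases n) auto
    finally have *: "a + n * b \<in> R" .
    have "(s + (a + n * b)) mod n = (s + a) mod n" for s
      by (metis add.assoc mod_mult_self2)
    with * show ?thesis by (simp add: R_def)
  qed
  obtain d where d: "d \<in> R" "\<And>r. r \<in> R \<Longrightarrow> d dvd r"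
  proof (rule nat_subgroup_generator[OF nR])
    show "0 < n" using n by simp
    show "a + b \<in> R" if "a \<in> R" "b \<in> R" for a b using that by (rule add)
    show "a \<in> R" if "a + b \<in> R" "b \<in> R" for a b using that by (rule sub)
    show thesis if "d \<in> R" "\<And>r. r \<in> R \<Longrightarrow> d dvd r" for d
      by (rule \<open>\<And>d. d \<in> R \<Longrightarrow> (\<And>r. r \<in> R \<Longrightarrow> d dvd r) \<Longrightarrow> thesis\<close>) (fact that)+
  qed
  have "I \<subseteq> R" using I by (auto simp: R_def E_def intro!: r_into_rtrancl)
  with d nR have "d dvd Gcd (insert n I)" by (intro Gcd_greatest) auto
  with Gcd have "d = 1" by simp
  with d mult[of 1 "n - 1"] have "n - 1 \<in> R" by simp
  then have "\<forall>s<n. (s, (s + (n - 1)) mod n) \<in> E\<^sup>*" by (simp add: R_def)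
  moreover have "1 < n" using n by simp
  ultimately have "(1, (1 + (n - 1)) mod n) \<in> E\<^sup>*" by blast
  with n show ?thesis by (simp add: E_def)
qed

text \<open>A walk of least length has no shortcuts and no repetitions.\<close>

lemma ex_shortest_path:
  assumes "(s, t) \<in> E\<^sup>*"
  obtains f and k :: nat where "f 0 = s" "f k = t" "\<And>i. i < k \<Longrightarrow> (f i, f (Suc i)) \<in> E"
    and "\<And>i j. i \<le> k \<Longrightarrow> j \<le> k \<Longrightarrow> (f i, f j) \<in> E \<Longrightarrow> j \<le> Suc i" and "inj_on f {..k}"
proof -
  have "\<exists>k. (s, t) \<in> E ^^ k" using assms by (simp add: rtrancl_power)
  define k where "k = (LEAST k. (s, t) \<in> E ^^ k)"
  have "(s, t) \<in> E ^^ k" unfolding k_def using \<open>\<exists>k. (s, t) \<in> E ^^ k\<close> by (rule LeastI_ex)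
  then obtain f where f: "f 0 = s" "f k = t" "\<forall>i<k. (f i, f (Suc i)) \<in> E"
    by (auto simp: relpow_fun_conv)
  have least: "k \<le> j" if "(s, t) \<in> E ^^ j" for j unfolding k_def by (rule Least_le) (rule that)
  have sub: "(f i, f j) \<in> E ^^ (j - i)" if "i \<le> j" "j \<le> k" for i j
    unfolding relpow_fun_conv
    by (rule exI[where x="\<lambda>l. f (i + l)"]) (use that f in auto)
  have short: "k \<le> i + l + (k - j)" if "i \<le> k" "j \<le> k" "(f i, f j) \<in> E ^^ l" for i j l
  proof (rule least)
    have "(f 0, f i) \<in> E ^^ i" "(f j, f k) \<in> E ^^ (k - j)" using sub[of 0 i] sub[of j k] that by auto
    with that show "(s, t) \<in> E ^^ (i + l + (k - j))"
      unfolding relpow_add using f by (metis relcomp.relcompI)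
  qed
  show ?thesis
  proof (rule that[of f k])
    show "j \<le> Suc i" if "i \<le> k" "j \<le> k" "(f i, f j) \<in> E" for i j
      using short[of i j 1] that by simp
    have "i = j" if "i \<le> j" "j \<le> k" "f i = f j" for i j
      using short[of i j 0] that by simp
    then show "inj_on f {..k}"
      by (intro inj_onI) (metis atMost_iff le_cases)
  qed (use f in auto)
qed

context finite_field_extension
begin

section \<open>q-polynomials without points of weight one\<close>

lemma sum_F_power:
  "(\<Sum>a\<in>F. a ^ k) = (if 0 < k \<and> (q - 1) dvd k then - 1 else (0::'a))"
proof (cases "k = 0")
  case True
  then show ?thesis using of_nat_card_subfield[OF F] by simp
next
  case False
  then have "(\<Sum>a\<in>F. a ^ k) = (\<Sum>a\<in>F-{0}. a ^ k)"
    by (intro sum.mono_neutral_right) auto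
  with False show ?thesis by (simp add: sum_power_units[OF F] q)
qed

lemma sum_affine_line_power:
  fixes u y :: 'a
  shows "(\<Sum>a\<in>F. (y + a * u) ^ (q - 1)) = - (u ^ (q - 1))"
proof -
  have "(\<Sum>a\<in>F. (y + a * u) ^ (q - 1))
      = (\<Sum>a\<in>F. \<Sum>k\<le>q-1. of_nat (q - 1 choose k) * u ^ k * y ^ (q - 1 - k) * a ^ k)"
  proof (rule sum.cong[OF refl])
    fix a
    show "(y + a * u) ^ (q - 1)
        = (\<Sum>k\<le>q-1. of_nat (q - 1 choose k) * u ^ k * y ^ (q - 1 - k) * a ^ k)"
      unfolding add.commute[of y "a * u"] binomial_ring power_mult_distrib
      by (simp only: mult_ac)
  qed
  also have "\<dots> = (\<Sum>k\<le>q-1. of_nat (q - 1 choose k) * u ^ k * y ^ (q - 1 - k) * (\<Sum>a\<in>F. a ^ k))"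
    by (subst sum.swap) (simp add: sum_distrib_left)
  also have "\<dots> = (\<Sum>k\<le>q-1. if k = q - 1 then - (u ^ (q - 1)) else 0)"
  proof (rule sum.cong[OF refl])
    fix k assume k: "k \<in> {..q-1}"
    have "0 < k \<and> (q - 1) dvd k \<longleftrightarrow> k = q - 1"
      using k q_ge_2 by (auto dest: dvd_imp_le)
    then show "of_nat (q - 1 choose k) * u ^ k * y ^ (q - 1 - k) * (\<Sum>a\<in>F. a ^ k)
        = (if k = q - 1 then - (u ^ (q - 1)) else 0)"
      by (simp only: sum_F_power) simp
  qed
  finally show ?thesis by simp
qed

text \<open>The cosets of the plane \<open>F u + F c u\<close> partition \<open>W\<close>. Along a coset of the line \<open>F u\<close> the sum is
  \<open>- u ^ (q - 1)\<close>, whatever the coset, and the plane consists of \<open>q\<close> such lines.\<close>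

lemma sum_subspace_power:
  fixes W :: "'a set"
  assumes add: "\<And>x y. x \<in> W \<Longrightarrow> y \<in> W \<Longrightarrow> x + y \<in> W" and hom: "\<And>a x. a \<in> F \<Longrightarrow> x \<in> W \<Longrightarrow> a * x \<in> W"
    and u: "u \<in> W" "u \<noteq> 0" and c: "c \<notin> F" "c * u \<in> W"
  shows "(\<Sum>x\<in>W. x ^ (q - 1)) = 0"
proof -
  define h where "h = (\<lambda>(a, b). a * u + b * (c * u))"
  define P where "P = h ` (F \<times> F)"
  have inj: "inj_on h (F \<times> F)"
  proof (rule inj_onI, clarify)
    fix a b a' b' assume F4: "a \<in> F" "b \<in> F" "a' \<in> F" "b' \<in> F" and "h (a, b) = h (a', b')"
    then have "((a - a') + (b - b') * c) * u = 0" by (simp add: h_def algebra_simps)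
    with u have *: "(a - a') + (b - b') * c = 0" by simp
    have "b = b'"
    proof (rule ccontr)
      assume "b \<noteq> b'"
      with * have "c = (a' - a) / (b - b')" by (simp add: field_simps)
      with F4 c(1) show False using subfield_closed(7,8)[OF F] by metis
    qed
    with * show "a = a' \<and> b = b'" by simp
  qed
  have P_add: "x + y \<in> P" if xy: "x \<in> P" "y \<in> P" for x y
  proof -
    obtain a b a' b' where *: "x = h (a, b)" "y = h (a', b')" "a \<in> F" "b \<in> F" "a' \<in> F" "b' \<in> F"
      using xy by (auto simp: P_def)
    then have "x + y = h (a + a', b + b')" by (simp add: h_def algebra_simps)
    with * show ?thesis unfolding P_def by (intro image_eqI[of _ _ "(a + a', b + b')"]) (auto intro: subfield_closed(3)[OF F])
  qed
  have P_minus: "- x \<in> P" if x: "x \<in> P" for x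
  proof -
    obtain a b where *: "x = h (a, b)" "a \<in> F" "b \<in> F" using x by (auto simp: P_def)
    then have "- x = h (- a, - b)" by (simp add: h_def algebra_simps)
    with * show ?thesis unfolding P_def by (intro image_eqI[of _ _ "(- a, - b)"]) (auto intro: subfield_closed(5)[OF F])
  qed
  have PW: "P \<subseteq> W" using add hom u c by (auto simp: P_def h_def)
  have "0 = h (0, 0)" by (simp add: h_def)
  then have P0: "0 \<in> P" unfolding P_def by (rule image_eqI) (auto intro: subfield_closed[OF F])
  define cl where "cl x = (+) x ` P" for x
  have cl_eq: "cl x = cl y" if "x \<in> cl y" for x y
  proof -
    obtain z where z: "z \<in> P" "x = y + z" using \<open>x \<in> cl y\<close> by (auto simp: cl_def)
    show ?thesis
    proof (intro equalityI subsetI)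
      fix t assume "t \<in> cl x"
      then obtain s where "s \<in> P" "t = y + (z + s)" using z by (auto simp: cl_def ac_simps)
      with z P_add show "t \<in> cl y" by (auto simp: cl_def)
    next
      fix t assume "t \<in> cl y"
      then obtain s where "s \<in> P" "t = y + s" by (auto simp: cl_def)
      then have "t = x + (s + - z)" "s + - z \<in> P" using z P_add[OF _ P_minus] by simp_all
      then show "t \<in> cl x" unfolding cl_def by (rule image_eqI)
    qed
  qed
  have "(\<Sum>x\<in>W. x ^ (q - 1)) = (\<Sum>C\<in>cl ` W. \<Sum>x | x \<in> W \<and> cl x = C. x ^ (q - 1))"
    by (rule sum.image_gen) simp
  also have "\<dots> = 0"
  proof (rule sum.neutral, clarify)
    fix y assume y: "y \<in> W"
    have "{x. x \<in> W \<and> cl x = cl y} = cl y"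
    proof (intro equalityI subsetI)
      fix x assume "x \<in> {x. x \<in> W \<and> cl x = cl y}"
      moreover have "x \<in> cl x" unfolding cl_def using P0 by (intro image_eqI[of _ _ 0]) auto
      ultimately show "x \<in> cl y" by auto
    next
      fix x assume x: "x \<in> cl y"
      then have "x \<in> W" using y PW add by (auto simp: cl_def)
      with cl_eq[OF x] show "x \<in> {x. x \<in> W \<and> cl x = cl y}" by simp
    qed
    then have "(\<Sum>x | x \<in> W \<and> cl x = cl y. x ^ (q - 1)) = (\<Sum>p\<in>P. (y + p) ^ (q - 1))"
      unfolding cl_def by (simp add: sum.reindex)
    also have "\<dots> = (\<Sum>(a, b)\<in>F \<times> F. (y + (a * u + b * (c * u))) ^ (q - 1))"
      unfolding P_def by (subst sum.reindex[OF inj]) (simp add: h_def split_def)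
    also have "\<dots> = (\<Sum>b\<in>F. \<Sum>a\<in>F. ((y + b * (c * u)) + a * u) ^ (q - 1))"
      by (subst sum.swap) (simp add: sum.cartesian_product ac_simps)
    also have "\<dots> = 0"
      unfolding sum_affine_line_power using of_nat_card_subfield[OF F] by simp
    finally show "(\<Sum>x | x \<in> W \<and> cl x = cl y. x ^ (q - 1)) = 0" .
  qed
  finally show ?thesis .
qed

text \<open>Group the terms by the value \<open>t = g x / x\<close>. Together with \<open>0\<close> each group is the \<open>F\<close>-subspace
  \<open>{x. g x = t * x}\<close>, and the hypothesis says that its dimension is at least two.\<close>

lemma sum_slope_eq_0:
  fixes g \<phi> :: "'a \<Rightarrow> 'a"
  assumes add: "\<And>x y. g (x + y) = g x + g y" and hom: "\<And>a x. a \<in> F \<Longrightarrow> g (a * x) = a * g x"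
    and weight: "\<And>x. x \<noteq> 0 \<Longrightarrow> \<exists>c. c \<notin> F \<and> g (c * x) = c * g x"
  shows "(\<Sum>x\<in>UNIV-{0}. x ^ (q - 1) * \<phi> (g x / x)) = 0"
proof -
  have "(\<Sum>x\<in>UNIV-{0}. x ^ (q - 1) * \<phi> (g x / x))
      = (\<Sum>t\<in>(\<lambda>x. g x / x) ` (UNIV-{0}). \<Sum>x | x \<in> UNIV-{0} \<and> g x / x = t. x ^ (q - 1) * \<phi> (g x / x))"
    by (rule sum.image_gen) simp
  also have "\<dots> = 0"
  proof (rule sum.neutral, rule ballI)
    fix t assume "t \<in> (\<lambda>x. g x / x) ` (UNIV-{0})"
    then obtain y where y: "y \<noteq> 0" and t: "t = g y / y" by auto
    define W where "W = {x. g x = t * x}"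
    obtain c where c: "c \<notin> F" "g (c * y) = c * g y" using weight[OF y] by auto
    have "(\<Sum>x | x \<in> UNIV-{0} \<and> g x / x = t. x ^ (q - 1) * \<phi> (g x / x))
        = (\<Sum>x\<in>W-{0}. x ^ (q - 1) * \<phi> t)"
      by (rule sum.cong) (auto simp: W_def divide_simps)
    also have "\<dots> = (\<Sum>x\<in>W. x ^ (q - 1) * \<phi> t)"
      by (rule sum.mono_neutral_left) (use q_ge_2 in auto)
    also have "\<dots> = (\<Sum>x\<in>W. x ^ (q - 1)) * \<phi> t" by (simp add: sum_distrib_right)
    also have "(\<Sum>x\<in>W. x ^ (q - 1)) = 0"
      by (rule sum_subspace_power[of _ y c])
        (use y c in \<open>auto simp: W_def add hom t algebra_simps add_divide_distrib\<close>)
    finally show "(\<Sum>x | x \<in> UNIV-{0} \<and> g x / x = t. x ^ (q - 1) * \<phi> (g x / x)) = 0" by simp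
  qed
  finally show ?thesis .
qed


text \<open>Suppose that \<open>n\<close> and the exponents of \<open>g\<close> have no common divisor, and let \<open>f\<close> be a shortest walk
  from \<open>1\<close> to \<open>0\<close> in the integers modulo \<open>n\<close> with exponents of \<open>g\<close> as steps. The sum over \<open>x \<noteq> 0\<close>
  of \<open>x ^ (q - 1) * (\<Prod>i<k. (g x / x - c 0) ^ (q ^ f i))\<close> vanishes. Expanding the product, one
  chooses for each \<open>i\<close> a step from \<open>f i\<close>, leading to some \<open>\<tau> i\<close>, and gets the monomial
  \<open>x ^ (\<Sum>i<k. q ^ \<tau> i) / x ^ (\<Sum>i<k. q ^ f (i + 1))\<close>. It has a nonzero sum only if the exponents are
  congruent modulo \<open>q ^ n - 1\<close>, that is, if \<open>\<tau>\<close> runs through the vertices \<open>f 1, \<dots>, f k\<close> in some order.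
  As there are no shortcuts, \<open>\<tau> i = f (i + 1)\<close> for all \<open>i\<close>; so a single term is left, and it is
  nonzero. Subtracting \<open>c 0\<close> removes the steps of length zero, which say nothing about \<open>d\<close>.\<close>

lemma q_poly_exponents_common_divisor:
  fixes c :: "nat \<Rightarrow> 'a" and g :: "'a \<Rightarrow> 'a"
  assumes g: "\<And>x. g x = (\<Sum>b<n. c b * x ^ (q ^ b))"
    and weight: "\<And>x. x \<noteq> 0 \<Longrightarrow> \<exists>a. a \<notin> F \<and> g (a * x) = a * g x"
  obtains d where "d > 1" "d dvd n" "\<And>b. b < n \<Longrightarrow> c b \<noteq> 0 \<Longrightarrow> d dvd b"
proof -
  define I where "I = {b. 0 < b \<and> b < n \<and> c b \<noteq> 0}"
  define d where "d = Gcd (insert n I)"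
  have "d \<noteq> 1"
  proof
    assume "d = 1"
    have n2: "n \<ge> 2"
    proof (rule ccontr)
      assume "\<not> n \<ge> 2"
      with n_pos have "n = 1" by simp
      with Q q have "F = UNIV" by (intro card_subset_eq) auto
      with weight[of 1] show False by simp
    qed
    define E where "E = {(s, (s + b) mod n) | s b. s < n \<and> b \<in> I}"
    have reach: "(1, 0) \<in> E\<^sup>*" unfolding E_def
      by (rule coprime_steps_reach) (use n2 \<open>d = 1\<close> in \<open>auto simp: I_def d_def\<close>)
    obtain f k where f: "f 0 = 1" "f k = 0" "\<And>i. i < k \<Longrightarrow> (f i, f (Suc i)) \<in> E"
      and short: "\<And>i j. i \<le> k \<Longrightarrow> j \<le> k \<Longrightarrow> (f i, f j) \<in> E \<Longrightarrow> j \<le> Suc i"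
      and inj: "inj_on f {..k}"
      by (rule ex_shortest_path[OF reach]) blast
    have k0: "k > 0" using f by (cases k) auto
    have f_less: "f i < n" if "i \<le> k" for i
      using f(1) f(3)[of "i - 1"] that n2 by (cases i) (auto simp: E_def)
    define h where "h x = g x - c 0 * x" for x
    have h_eq: "h x = (\<Sum>b\<in>I. c b * x ^ (q ^ b))" for x
    proof -
      have "(\<Sum>b<n. c b * x ^ (q ^ b)) = c 0 * x ^ (q ^ 0) + (\<Sum>b\<in>{..<n}-{0}. c b * x ^ (q ^ b))"
        using n_pos by (intro sum.remove) auto
      also have "(\<Sum>b\<in>{..<n}-{0}. c b * x ^ (q ^ b)) = (\<Sum>b\<in>I. c b * x ^ (q ^ b))"
        by (rule sum.mono_neutral_right) (auto simp: I_def)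
      finally show ?thesis by (simp add: h_def g)
    qed
    \<comment> \<open>the factor \<open>x ^ (q - 1)\<close> turns the denominator, which has the exponents \<open>f 0, \<dots>, f (k - 1)\<close>, into one with \<open>f 1, \<dots>, f k\<close>\<close>
    define M where "M = (\<Sum>i<k. q ^ f (Suc i))"
    have M_shift: "(\<Sum>i<k. q ^ f i) = M + (q - 1)"
    proof -
      have "(\<Sum>i<Suc k. q ^ f i) = q ^ f 0 + M" unfolding M_def by (rule sum.lessThan_Suc_shift)
      then show ?thesis using f q_ge_2 by simp
    qed
    define C where "C \<beta> = (\<Prod>i<k. c (\<beta> i) ^ (q ^ f i))" for \<beta>
    define N where "N \<beta> = (\<Sum>i<k. q ^ ((\<beta> i + f i) mod n))" for \<beta>
    let ?B = "PiE {..<k} (\<lambda>_. I)"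
    have fI: "finite I" by (auto simp: I_def)
    have expand: "(\<Prod>i<k. h x ^ (q ^ f i)) = (\<Sum>\<beta>\<in>?B. C \<beta> * x ^ N \<beta>)" for x
    proof -
      have "(\<Prod>i<k. h x ^ (q ^ f i)) = (\<Prod>i<k. \<Sum>b\<in>I. c b ^ (q ^ f i) * x ^ (q ^ ((b + f i) mod n)))"
        by (simp add: h_eq frob_sum power_mult_distrib power_q_power frob_mod)
      also have "\<dots> = (\<Sum>\<beta>\<in>?B. \<Prod>i<k. c (\<beta> i) ^ (q ^ f i) * x ^ (q ^ ((\<beta> i + f i) mod n)))"
        by (rule prod_sum_PiE) (auto simp: fI)
      finally show ?thesis by (simp add: C_def N_def prod.distrib power_sum)
    qed
    have "0 = (\<Sum>x\<in>UNIV-{0}. x ^ (q - 1) * (\<Prod>i<k. (g x / x - c 0) ^ (q ^ f i)))"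
      by (rule sum_slope_eq_0[symmetric, of g "\<lambda>t. \<Prod>i<k. (t - c 0) ^ (q ^ f i)"])
        (use weight in \<open>auto simp: g frob_add sum.distrib algebra_simps sum_distrib_left power_mult_distrib F_frob\<close>)
    also have "\<dots> = (\<Sum>x\<in>UNIV-{0}. \<Sum>\<beta>\<in>?B. C \<beta> * (x ^ N \<beta> / x ^ M))"
    proof (rule sum.cong[OF refl])
      fix x :: 'a assume "x \<in> UNIV - {0}"
      then have x: "x \<noteq> 0" by simp
      have "g x / x - c 0 = h x / x" using x by (simp add: h_def field_simps)
      moreover have "(\<Prod>i<k. (h x / x) ^ (q ^ f i)) = (\<Prod>i<k. h x ^ (q ^ f i)) / x ^ (M + (q - 1))"
        by (simp only: power_divide prod_dividef M_shift[symmetric] power_sum)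
      ultimately have "x ^ (q - 1) * (\<Prod>i<k. (g x / x - c 0) ^ (q ^ f i))
          = x ^ (q - 1) * (\<Prod>i<k. h x ^ (q ^ f i)) / x ^ (M + (q - 1))" by simp
      also have "\<dots> = (\<Prod>i<k. h x ^ (q ^ f i)) / x ^ M" using x by (simp add: power_add)
      finally show "x ^ (q - 1) * (\<Prod>i<k. (g x / x - c 0) ^ (q ^ f i)) = (\<Sum>\<beta>\<in>?B. C \<beta> * (x ^ N \<beta> / x ^ M))"
        by (simp add: expand sum_divide_distrib)
    qed
    also have "\<dots> = (\<Sum>\<beta>\<in>?B. C \<beta> * (\<Sum>x\<in>UNIV-{0}. x ^ N \<beta> / x ^ M))"
      by (subst sum.swap) (simp add: sum_distrib_left)
    finally have zero: "(\<Sum>\<beta>\<in>?B. C \<beta> * (\<Sum>x\<in>UNIV-{0}. x ^ N \<beta> / x ^ M)) = 0" by simp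
    have "\<exists>b\<in>I. f (Suc i) = (b + f i) mod n" if "i < k" for i
      using f(3)[OF that] by (auto simp: E_def add.commute)
    then obtain \<beta>0 where \<beta>0: "\<And>i. i < k \<Longrightarrow> \<beta>0 i \<in> I \<and> f (Suc i) = (\<beta>0 i + f i) mod n"
      by metis
    define \<beta>' where "\<beta>' = restrict \<beta>0 {..<k}"
    have \<beta>'B: "\<beta>' \<in> ?B" using \<beta>0 by (auto simp: \<beta>'_def)
    have N': "N \<beta>' = M" unfolding N_def M_def
      by (rule sum.cong) (use \<beta>0 in \<open>auto simp: \<beta>'_def\<close>)
    have inner: "(\<Sum>x\<in>UNIV-{0::'a}. x ^ N \<beta> / x ^ M) = (if [N \<beta> = M] (mod (q ^ n - 1)) then - 1 else 0)" for \<beta>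
    proof -
      have Q2: "q ^ n \<ge> 2" using card_subfield_ge_2[OF is_subfield_UNIV, where 'a='a] Q by simp
      have inv: "x ^ N \<beta> / x ^ M = x ^ (N \<beta> + (q ^ n - 2) * M)" if x: "x \<noteq> 0" for x :: 'a
      proof -
        have "x * x ^ (q ^ n - 1) = x ^ Suc (q ^ n - 1)" by simp
        also have "Suc (q ^ n - 1) = q ^ n" using Q2 by simp
        also have "x ^ (q ^ n) = x" using subfield_power_card[OF is_subfield_UNIV, of x] by (simp only: Q UNIV_I)
        finally have one: "x ^ (q ^ n - 1) = 1" using x by simp
        have "x ^ (N \<beta> + (q ^ n - 2) * M) * x ^ M = x ^ (N \<beta> + (Suc (q ^ n - 2)) * M)"
          by (simp add: power_add algebra_simps)
        also have "Suc (q ^ n - 2) = q ^ n - 1" using Q2 by simp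
        also have "x ^ (N \<beta> + (q ^ n - 1) * M) = x ^ N \<beta>" by (simp only: power_add power_mult one power_one mult_1_right)
        finally show ?thesis using x by (simp add: field_simps)
      qed
      have "(\<Sum>x\<in>UNIV-{0::'a}. x ^ N \<beta> / x ^ M) = (\<Sum>x\<in>UNIV-{0}. x ^ (N \<beta> + (q ^ n - 2) * M))"
        by (rule sum.cong) (auto simp: inv)
      also have "\<dots> = (if (q ^ n - 1) dvd (N \<beta> + (q ^ n - 2) * M) then - 1 else 0)"
        by (simp only: sum_power_units[OF is_subfield_UNIV] Q)
      also have "(q ^ n - 1) dvd (N \<beta> + (q ^ n - 2) * M) \<longleftrightarrow> [N \<beta> = M] (mod (q ^ n - 1))"
      proof -
        have "(q ^ n - 1) dvd (N \<beta> + (q ^ n - 2) * M) \<longleftrightarrow> [N \<beta> + (q ^ n - 2) * M = 0] (mod (q ^ n - 1))"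
          by (simp add: cong_0_iff)
        also have "\<dots> \<longleftrightarrow> [N \<beta> + (q ^ n - 2) * M = M + (q ^ n - 2) * M] (mod (q ^ n - 1))"
        proof -
          have "M + (q ^ n - 2) * M = Suc (q ^ n - 2) * M" by simp
          also have "Suc (q ^ n - 2) = q ^ n - 1" using Q2 by simp
          finally have "M + (q ^ n - 2) * M = (q ^ n - 1) * M" .
          then have "[M + (q ^ n - 2) * M = 0] (mod (q ^ n - 1))" by (simp add: cong_0_iff)
          then show ?thesis by (meson cong_sym cong_trans)
        qed
        also have "\<dots> \<longleftrightarrow> [N \<beta> = M] (mod (q ^ n - 1))" by (rule cong_add_rcancel_nat)
        finally show ?thesis .
      qed
      finally show ?thesis .
    qed
    have uniq: "\<beta> = \<beta>'" if \<beta>: "\<beta> \<in> ?B" and cong: "[N \<beta> = M] (mod (q ^ n - 1))" for \<beta>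
    proof -
      define \<tau> where "\<tau> i = (\<beta> i + f i) mod n" for i
      have \<tau>_less: "\<tau> i < n" for i using n_pos by (simp add: \<tau>_def)
      define m where "m s = card {i. i < k \<and> \<tau> i = s}" for s
      define A where "A = (\<lambda>i. f (Suc i)) ` {..<k}"
      have injS: "inj_on (\<lambda>i. f (Suc i)) {..<k}"
      proof (rule inj_onI)
        fix i j assume "i \<in> {..<k}" "j \<in> {..<k}" "f (Suc i) = f (Suc j)"
        then have "Suc i = Suc j" using inj_onD[OF inj, of "Suc i" "Suc j"] by simp
        then show "i = j" by simp
      qed
      have cardA: "card A = k" by (simp add: A_def card_image injS)
      have An: "A \<subseteq> {..<n}" "A \<noteq> {}" using f_less k0 by (auto simp: A_def)
      have count: "(\<Sum>s<n. m s * F s) = (\<Sum>i<k. F (\<tau> i))" for F :: "nat \<Rightarrow> nat"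
      proof -
        have "(\<Sum>i<k. F (\<tau> i)) = (\<Sum>s<n. \<Sum>i\<in>{i\<in>{..<k}. \<tau> i = s}. F (\<tau> i))"
          by (rule sum.group[symmetric]) (use \<tau>_less in auto)
        also have "\<dots> = (\<Sum>s<n. m s * F s)" by (intro sum.cong) (auto simp: m_def)
        finally show ?thesis by simp
      qed
      have m: "m s = (if s \<in> A then 1 else 0)" if "s < n" for s
      proof (rule q_power_sum_unique[OF q_ge_2 An _ _ _ that])
        show "(\<Sum>s<n. m s) \<le> card A" using count[of "\<lambda>_. 1"] by (simp add: cardA)
        have "(\<Sum>s<n. m s) \<noteq> 0" using count[of "\<lambda>_. 1"] k0 by simp
        then show "\<exists>s<n. m s \<noteq> 0" by (metis lessThan_iff sum.neutral)
        have "(\<Sum>a\<in>A. q ^ a) = M" unfolding A_def M_def by (simp add: sum.reindex[OF injS])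
        moreover have "(\<Sum>s<n. m s * q ^ s) = N \<beta>" unfolding count N_def \<tau>_def ..
        ultimately show "[(\<Sum>s<n. m s * q ^ s) = (\<Sum>a\<in>A. q ^ a)] (mod (q ^ n - 1))" using cong by simp
      qed
      have \<tau>A: "\<tau> i \<in> A" if "i < k" for i
      proof (rule ccontr)
        assume "\<tau> i \<notin> A"
        then have "card {j. j < k \<and> \<tau> j = \<tau> i} = 0" using m[OF \<tau>_less, of i] by (simp add: m_def)
        then show False using that by auto
      qed
      have \<tau>_inj: "i = j" if "i < k" "j < k" "\<tau> i = \<tau> j" for i j
      proof -
        let ?L = "{l. l < k \<and> \<tau> l = \<tau> i}"
        have "card ?L \<le> Suc 0" using m[OF \<tau>_less, of i] by (simp add: m_def split: if_splits)
        moreover have "finite ?L" by simp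
        ultimately have "\<forall>x\<in>?L. \<forall>y\<in>?L. x = y" by (simp only: card_le_Suc0_iff_eq)
        from bspec[OF bspec[OF this, of i], of j] that show ?thesis by simp
      qed
      \<comment> \<open>\<open>\<tau> i\<close> is one of \<open>f 1, \<dots>, f (i + 1)\<close>, and all but the last are taken by smaller indices\<close>
      have step: "\<tau> i = f (Suc i)" if "i < k" for i
        using that
      proof (induction i rule: less_induct)
        case (less i)
        obtain j where j: "j < k" "\<tau> i = f (Suc j)" using \<tau>A[OF less.prems] by (auto simp: A_def)
        have "(f i, \<tau> i) \<in> E"
          unfolding E_def \<tau>_def using less.prems f_less[of i] PiE_mem[OF \<beta>, of i]
          by (intro CollectI exI[of _ "f i"] exI[of _ "\<beta> i"]) (simp add: add.commute)
        then have "Suc j \<le> Suc i" using short[of i "Suc j"] j less.prems by simp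
        moreover have "\<not> j < i" using less.IH[of j] j less.prems \<tau>_inj[of i j] by auto
        ultimately show ?case using j by simp
      qed
      show ?thesis
      proof (rule PiE_ext[OF \<beta> \<beta>'B])
        fix i assume "i \<in> {..<k}"
        then have i: "i < k" by simp
        have "(\<beta> i + f i) mod n = (\<beta>' i + f i) mod n"
          using step[OF i] \<beta>0[OF i] i by (simp add: \<tau>_def \<beta>'_def)
        then have "[\<beta> i + f i = \<beta>' i + f i] (mod n)" by (simp add: cong_def)
        then have "[\<beta> i = \<beta>' i] (mod n)" by (simp only: cong_add_rcancel_nat)
        moreover have "\<beta> i < n" "\<beta>' i < n" using PiE_mem[OF \<beta>, of i] PiE_mem[OF \<beta>'B, of i] i by (simp_all add: I_def)
        ultimately show "\<beta> i = \<beta>' i" by (simp add: cong_def)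
      qed
    qed
    have "(\<Sum>\<beta>\<in>?B. C \<beta> * (\<Sum>x\<in>UNIV-{0}. x ^ N \<beta> / x ^ M)) = (\<Sum>\<beta>\<in>?B. if \<beta> = \<beta>' then - C \<beta>' else 0)"
    proof (rule sum.cong[OF refl])
      fix \<beta> assume \<beta>: "\<beta> \<in> ?B"
      show "C \<beta> * (\<Sum>x\<in>UNIV-{0}. x ^ N \<beta> / x ^ M) = (if \<beta> = \<beta>' then - C \<beta>' else 0)"
      proof (cases "\<beta> = \<beta>'")
        case True
        then have "[N \<beta> = M] (mod (q ^ n - 1))" by (simp only: N' cong_refl)
        with True show ?thesis by (simp only: inner if_True mult_minus1_right refl)
      next
        case False
        with uniq[OF \<beta>] have "\<not> [N \<beta> = M] (mod (q ^ n - 1))" by auto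
        with False show ?thesis by (simp only: inner if_False mult_zero_right)
      qed
    qed
    also have "\<dots> = - C \<beta>'" using \<beta>'B fI by (simp add: finite_PiE)
    finally have "C \<beta>' = 0" using zero by simp
    moreover have "C \<beta>' \<noteq> 0"
    proof -
      have "c (\<beta>' i) \<noteq> 0" if "i < k" for i
        using PiE_mem[OF \<beta>'B, of i] that by (simp add: I_def)
      then show ?thesis by (simp add: C_def)
    qed
    ultimately show False by simp
  qed
  moreover have dn: "d dvd n" by (simp add: d_def)
  moreover have "d \<noteq> 0" using dn n_pos by auto
  ultimately have "d > 1" by linarith
  moreover have "d dvd b" if "b < n" "c b \<noteq> 0" for b
  proof (cases "b = 0")
    case False
    with that have "b \<in> insert n I" by (simp add: I_def)
    then show ?thesis unfolding d_def by (rule Gcd_dvd)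
  qed simp
  ultimately show ?thesis using that dn by blast
qed


section \<open>Enlarging the field of linearity\<close>

text \<open>Each \<open>h b\<close> is additive and semilinear, so on a line on which it is not identically zero it has at
  most one zero; and a line has \<open>Q\<close> points. By induction, starting from a point where all but one
  of the maps are nonzero, move in a direction in which the last one is.\<close>

lemma ex_common_nonzero:
  fixes h :: "nat \<Rightarrow> 'a ^ 'k \<Rightarrow> 'a"
  assumes "finite I" "card I < CARD('a)"
    and add: "\<And>b x y. b \<in> I \<Longrightarrow> h b (x + y) = h b x + h b y"
    and hom: "\<And>b t x. b \<in> I \<Longrightarrow> h b (t *s x) = t ^ (q ^ e b) * h b x"
    and nonzero: "\<And>b. b \<in> I \<Longrightarrow> \<exists>x. h b x \<noteq> 0"
  shows "\<exists>x. \<forall>b\<in>I. h b x \<noteq> 0"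
  using assms
proof (induction I rule: finite_induct)
  case (insert b I)
  have "\<exists>x. \<forall>b\<in>I. h b x \<noteq> 0"
    by (rule insert.IH) (use insert.hyps insert.prems in auto)
  then obtain x where x: "\<And>b. b \<in> I \<Longrightarrow> h b x \<noteq> 0" by auto
  obtain y where y: "h b y \<noteq> 0" using insert.prems(4) by blast
  show ?case
  proof (cases "h b x = 0")
    case False
    with x show ?thesis by auto
  next
    case True
    define bad where "bad c = {t. h c (x + t *s y) = 0}" for c
    have bad1: "card (bad c) \<le> 1" if c: "c \<in> I" for c
    proof -
      have "t = t'" if t: "t \<in> bad c" "t' \<in> bad c" for t t'
      proof -
        have "h c x + t ^ (q ^ e c) * h c y = 0" "h c x + t' ^ (q ^ e c) * h c y = 0"
          using t c by (simp_all add: bad_def insert.prems)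
        moreover from this(1) have "h c y \<noteq> 0" using x[OF c] by auto
        ultimately have "t ^ (q ^ e c) = t' ^ (q ^ e c)" by (metis add_left_cancel mult_right_cancel)
        then have "(t - t') ^ (q ^ e c) = 0" by (simp add: frob_diff)
        then show ?thesis by simp
      qed
      moreover have "finite (bad c)" by simp
      ultimately show ?thesis unfolding One_nat_def by (subst card_le_Suc0_iff_eq) blast+
    qed
    have "card (\<Union>c\<in>I. bad c) \<le> (\<Sum>c\<in>I. card (bad c))" using insert.hyps(1) by (rule card_UN_le)
    also have "\<dots> \<le> card I" using sum_mono[of I "\<lambda>c. card (bad c)" "\<lambda>_. 1"] bad1 by simp
    finally have "card (insert 0 (\<Union>c\<in>I. bad c)) \<le> Suc (card I)"
      using card_insert_le_m1[of "Suc (card I)" "\<Union>c\<in>I. bad c" 0] by simp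
    also have "Suc (card I) < CARD('a)" using insert.prems(1) insert.hyps by simp
    finally have "insert 0 (\<Union>c\<in>I. bad c) \<noteq> UNIV" by (metis less_irrefl)
    then obtain t where t: "t \<noteq> 0" "\<And>c. c \<in> I \<Longrightarrow> t \<notin> bad c" by blast
    have "h b (x + t *s y) \<noteq> 0" using t True y insert.prems(2,3) by simp
    with t show ?thesis by (intro exI[of _ "x + t *s y"]) (auto simp: bad_def)
  qed
qed simp

lemma card_vec_subspace:
  fixes W :: "('a ^ 'k::finite) set"
  assumes "vec.subspace W"
  obtains e where "card W = (q ^ n) ^ e"
proof -
  have "subspace_over UNIV W"
    using assms by (auto simp: subspace_over_def vec.subspace_def)
  then obtain e where "card W = CARD('a) ^ e"
    using card_subspace_over[OF is_subfield_UNIV] by metis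
  with Q that show ?thesis by simp
qed

text \<open>Take \<open>W\<close> maximal with \<open>W \<inter> U = {0}\<close>. By maximality each \<open>v \<notin> W\<close> has a nonzero multiple in
  \<open>u + W\<close> for some nonzero \<open>u \<in> U\<close>, so there are at most \<open>(1 + (Q - 1) * (Q ^ s - 1)) * card W\<close> vectors.
  If \<open>U + W\<close> were not everything, then, as all cardinalities are powers of \<open>Q\<close>, there would be at
  least \<open>Q * Q ^ s * card W\<close> of them.\<close>

lemma ex_complement:
  fixes U :: "('a ^ 'k::finite) set"
  assumes U: "subspace_over F U" and card_U: "card U = (q ^ n) ^ s"
  obtains W where "vec.subspace W" "W \<inter> U = {0}" "\<And>v. \<exists>u\<in>U. v - u \<in> W"
proof -
  let ?Q = "q ^ n"
  define N where "N = CARD('a ^ 'k)"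
  have N_ge: "card X \<le> N" for X :: "('a ^ 'k) set"
    unfolding N_def by (rule card_mono) auto
  have Q2: "?Q \<ge> 2" using card_subfield_ge_2[OF is_subfield_UNIV, where 'a='a] Q by simp
  let ?P = "\<lambda>W. vec.subspace W \<and> W \<inter> U = {0}"
  have "\<exists>W. ?P W \<and> (\<forall>C. ?P C \<longrightarrow> card C \<le> card W)"
  proof (rule Lattices_Big.ex_has_greatest_nat[where b="Suc N"])
    show "?P {0}" using subspace_overD(1)[OF U] by auto
    show "\<forall>C. ?P C \<longrightarrow> card C < Suc N"
      by (intro allI impI le_imp_less_Suc N_ge)
  qed
  then obtain W where PW: "?P W \<and> (\<forall>C. ?P C \<longrightarrow> card C \<le> card W)" by (rule exE)
  then have W: "vec.subspace W" and WU: "W \<inter> U = {0}" by simp_all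
  have max: "card C \<le> card W" if "vec.subspace C" "C \<inter> U = {0}" for C
    using conjunct2[OF PW] that by simp
  obtain e where e: "card W = ?Q ^ e" by (rule card_vec_subspace[OF W])
  obtain k where k: "N = ?Q ^ k" unfolding N_def by (rule card_vec_subspace[OF vec.subspace_UNIV])
  have inj: "inj_on (\<lambda>(u, w). u + w) (U \<times> W)"
  proof (rule inj_onI, clarify)
    fix u w u' w' assume *: "u \<in> U" "w \<in> W" "u' \<in> U" "w' \<in> W" "u + w = u' + w'"
    then have "u - u' = w' - w" by (simp add: algebra_simps)
    moreover have "u - u' \<in> U" using * by (intro subspace_over_diff[OF F U])
    moreover have "w' - w \<in> W" using * by (intro vec.subspace_diff[OF W])
    ultimately have "u - u' \<in> W \<inter> U" by simp
    then have "u = u'" using WU by auto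
    with * show "u = u' \<and> w = w'" by simp
  qed
  have surj: "(\<lambda>(u, w). u + w) ` (U \<times> W) = UNIV"
  proof (rule ccontr)
    assume "(\<lambda>(u, w). u + w) ` (U \<times> W) \<noteq> UNIV"
    then have "card ((\<lambda>(u, w). u + w) ` (U \<times> W)) < N"
      unfolding N_def by (intro psubset_card_mono) auto
    then have "?Q ^ (s + e) < ?Q ^ k"
      using card_image[OF inj] by (simp add: card_cartesian_product card_U e k power_add)
    then have "s + e < k" using Q2 by (simp add: power_strict_increasing_iff)
    then have "?Q ^ (s + e + 1) \<le> ?Q ^ k" using Q2 by (intro power_increasing) auto
    then have lower: "?Q * ?Q ^ s * card W \<le> N" by (simp add: e k power_add)
    let ?D = "(\<lambda>(c, u, w). c *s u + w) ` ((UNIV - {0}) \<times> (U - {0}) \<times> W)"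
    have "UNIV \<subseteq> W \<union> ?D"
    proof
      fix v
      show "v \<in> W \<union> ?D"
      proof (cases "v \<in> W")
        case False
        define C where "C = vec.span (insert v W)"
        have "W \<subset> C" using False vec.span_superset[of "insert v W"] by (auto simp: C_def)
        then have "card W < card C" by (intro psubset_card_mono) auto
        moreover have "vec.subspace C" by (simp add: C_def)
        ultimately have "C \<inter> U \<noteq> {0}" using max[of C] by auto
        moreover have "0 \<in> C \<inter> U" using subspace_overD(1)[OF U] by (simp add: C_def vec.span_zero)
        ultimately obtain u where u: "u \<in> C" "u \<in> U" "u \<noteq> 0" by auto
        then obtain c where "u - c *s v \<in> vec.span W" by (auto simp: C_def vec.span_insert)
        then have c: "u - c *s v \<in> W" using W by (simp add: vec.span_eq_iff[THEN iffD2])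
        have c0: "c \<noteq> 0"
        proof
          assume "c = 0"
          with c u(2) have "u \<in> W \<inter> U" by simp
          with WU u(3) show False by simp
        qed
        let ?w = "inverse c *s (c *s v - u)"
        have "v = inverse c *s u + ?w"
          using c0 by (simp add: vec.scale_right_diff_distrib)
        moreover have "?w \<in> W"
          using vec.subspace_scale[OF W vec.subspace_neg[OF W c], of "inverse c"] by simp
        ultimately have "v \<in> ?D" using u c0
          by (intro image_eqI[of _ _ "(inverse c, u, ?w)"]) simp_all
        then show ?thesis by (rule UnI2)
      qed simp
    qed
    then have "N \<le> card (W \<union> ?D)" unfolding N_def by (intro card_mono) auto
    also have "\<dots> \<le> card W + card ?D" by (rule card_Un_le)
    also have "card ?D \<le> card ((UNIV - {0::'a}) \<times> (U - {0}) \<times> W)" by (rule card_image_le) simp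
    also have "\<dots> = (?Q - 1) * ((?Q ^ s - 1) * card W)"
      using subspace_overD(1)[OF U] by (simp add: card_cartesian_product Q card_U)
    finally have "?Q * ?Q ^ s * card W \<le> (1 + (?Q - 1) * (?Q ^ s - 1)) * card W"
      using lower by (simp add: algebra_simps)
    moreover have "card W > 0" using vec.subspace_0[OF W] by (auto simp: card_gt_0_iff)
    ultimately have le: "?Q * ?Q ^ s \<le> 1 + (?Q - 1) * (?Q ^ s - 1)" by (rule mult_right_le_imp_le)
    have arith: "\<not> X * Y \<le> 1 + (X - 1) * (Y - 1)" if X: "2 \<le> X" and Y: "1 \<le> Y" for X Y :: nat
    proof -
      obtain a where "X = 2 + a" using le_Suc_ex[OF X] by blast
      moreover obtain b where "Y = 1 + b" using le_Suc_ex[OF Y] by blast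
      ultimately show ?thesis by (simp add: algebra_simps)
    qed
    have "1 \<le> ?Q ^ s" using Q2 by simp
    from arith[OF Q2 this] le show False by (rule notE)
  qed
  have "\<exists>u\<in>U. v - u \<in> W" for v
  proof -
    from surj have "v \<in> (\<lambda>(u, w). u + w) ` (U \<times> W)" by simp
    then obtain u w where "u \<in> U" "w \<in> W" "v = u + w" by auto
    then show ?thesis by (intro bexI[of _ u]) auto
  qed
  with W WU that show ?thesis by blast
qed

text \<open>The projection \<open>\<rho>\<close> to \<open>U\<close> along a complement \<open>W\<close> inherits the hypothesis on \<open>U\<close>: for each \<open>v\<close> there
  is \<open>c \<notin> F\<close> with \<open>\<rho> (c v) = c \<rho> v\<close>. The coefficients \<open>C y l b\<close> of the \<open>q\<close>-polynomials
  \<open>t \<mapsto> \<rho> (t y) $ l\<close> are semilinear in \<open>y\<close>, so there are one functional \<open>a\<close> and one vector \<open>y\<close>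
  for which all exponents that occur anywhere occur in the single \<open>q\<close>-polynomial \<open>a \<cdot> \<rho> (t y)\<close>.
  Its exponents have a common divisor with \<open>n\<close>.\<close>

theorem subspace_over_larger_subfield:
  fixes U :: "('a ^ 'k::finite) set"
  assumes U: "subspace_over F U" and card_U: "card U = (q ^ n) ^ s" and "U \<noteq> {0}"
    and weight: "\<And>u. u \<in> U \<Longrightarrow> u \<noteq> 0 \<Longrightarrow> \<exists>c. c \<notin> F \<and> c *s u \<in> U"
  obtains L where "is_subfield L" "F \<subset> L" "subspace_over L U"
proof -
  obtain W where W: "vec.subspace W" and WU: "W \<inter> U = {0}" and decomp: "\<And>v. \<exists>u\<in>U. v - u \<in> W"
    by (rule ex_complement[OF U card_U]) blast
  obtain \<rho> where \<rho>: "\<And>v. \<rho> v \<in> U" "\<And>v. v - \<rho> v \<in> W" using decomp by metis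
  have \<rho>_eq: "\<rho> v = u" if "u \<in> U" "v - u \<in> W" for u v
  proof -
    have "(v - u) - (v - \<rho> v) \<in> W" using that(2) \<rho>(2) by (rule vec.subspace_diff[OF W])
    then have "\<rho> v - u \<in> W" by simp
    moreover have "\<rho> v - u \<in> U" by (rule subspace_over_diff[OF F U \<rho>(1) that(1)])
    ultimately have "\<rho> v - u \<in> W \<inter> U" by simp
    then show ?thesis using WU by simp
  qed
  have \<rho>_add: "\<rho> (v + v') = \<rho> v + \<rho> v'" for v v'
  proof (rule \<rho>_eq)
    show "\<rho> v + \<rho> v' \<in> U" by (intro subspace_overD(2)[OF U] \<rho>)
    have "(v - \<rho> v) + (v' - \<rho> v') \<in> W" by (intro vec.subspace_add[OF W] \<rho>)
    then show "v + v' - (\<rho> v + \<rho> v') \<in> W" by (simp add: algebra_simps)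
  qed
  have \<rho>_scale: "\<rho> (c *s v) = c *s \<rho> v" if "c *s \<rho> v \<in> U" for c v
  proof (rule \<rho>_eq[OF that])
    have "c *s (v - \<rho> v) \<in> W" by (intro vec.subspace_scale[OF W] \<rho>)
    then show "c *s v - c *s \<rho> v \<in> W" by (simp add: vec.scale_right_diff_distrib)
  qed
  have \<rho>_F: "\<rho> (c *s v) = c *s \<rho> v" if "c \<in> F" for c v
    by (intro \<rho>_scale subspace_overD(3)[OF U that] \<rho>)
  have \<rho>_weight: "\<exists>c. c \<notin> F \<and> \<rho> (c *s v) = c *s \<rho> v" for v
  proof (cases "\<rho> v = 0")
    case True
    obtain u where "u \<in> U" "u \<noteq> 0" using \<open>U \<noteq> {0}\<close> subspace_overD(1)[OF U] by auto
    then obtain c where "c \<notin> F" using weight by blast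
    moreover have "\<rho> (c *s v) = c *s \<rho> v" by (rule \<rho>_scale) (simp add: True subspace_overD(1)[OF U])
    ultimately show ?thesis by blast
  next
    case False
    then show ?thesis using weight[OF \<rho>(1)] \<rho>_scale by blast
  qed
  have "\<exists>c. \<forall>t. \<rho> (t *s y) $ l = (\<Sum>b<n. c b * t ^ (q ^ b))" for y l
  proof -
    obtain c where "\<And>t. \<rho> (t *s y) $ l = (\<Sum>b<n. c b * t ^ (q ^ b))"
    proof (rule ex_q_poly[of "\<lambda>t. \<rho> (t *s y) $ l"])
      show "\<rho> ((t + t') *s y) $ l = \<rho> (t *s y) $ l + \<rho> (t' *s y) $ l" for t t'
        by (simp only: vec.scale_left_distrib \<rho>_add vector_add_component)
      show "\<rho> ((a * t) *s y) $ l = a * \<rho> (t *s y) $ l" if "a \<in> F" for a t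
        using \<rho>_F[OF that, of "t *s y"] by simp
    qed blast
    then show ?thesis by blast
  qed
  then obtain C where C: "\<And>y l t. \<rho> (t *s y) $ l = (\<Sum>b<n. C y l b * t ^ (q ^ b))" by metis
  have C_add: "C (y + y') l b = C y l b + C y' l b" if "b < n" for y y' l b
  proof -
    have "C (y + y') l b - C y l b - C y' l b = 0"
    proof (rule q_poly_eq_0[OF _ that])
      fix t
      show "(\<Sum>b<n. (C (y + y') l b - C y l b - C y' l b) * t ^ (q ^ b)) = 0"
        unfolding left_diff_distrib sum_subtractf C[symmetric]
        by (simp add: vec.scale_right_distrib \<rho>_add)
    qed
    then show ?thesis by (simp add: diff_diff_eq)
  qed
  have C_hom: "C (\<mu> *s y) l b = \<mu> ^ (q ^ b) * C y l b" if "b < n" for \<mu> y l b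
  proof -
    have "C (\<mu> *s y) l b - \<mu> ^ (q ^ b) * C y l b = 0"
    proof (rule q_poly_eq_0[OF _ that])
      fix t
      have "(\<Sum>b<n. \<mu> ^ (q ^ b) * C y l b * t ^ (q ^ b)) = \<rho> ((t * \<mu>) *s y) $ l"
        unfolding C by (rule sum.cong) (simp_all add: power_mult_distrib)
      then show "(\<Sum>b<n. (C (\<mu> *s y) l b - \<mu> ^ (q ^ b) * C y l b) * t ^ (q ^ b)) = 0"
        unfolding left_diff_distrib sum_subtractf C[symmetric] by simp
    qed
    then show ?thesis by simp
  qed
  define I where "I = {b. b < n \<and> (\<exists>y l. C y l b \<noteq> 0)}"
  have fI: "finite I" and cardI: "card I < CARD('a)"
  proof -
    have "I \<subseteq> {..<n}" by (auto simp: I_def)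
    then show "finite I" by (rule finite_subset) simp
    have "card I \<le> card {..<n}" using \<open>I \<subseteq> {..<n}\<close> by (intro card_mono) auto
    also have "\<dots> < 2 ^ n" by simp
    also have "\<dots> \<le> q ^ n" using q_ge_2 by (intro power_mono) auto
    finally show "card I < CARD('a)" by (simp add: Q)
  qed
  have "\<forall>b\<in>I. \<exists>y l. C y l b \<noteq> 0" by (auto simp: I_def)
  then obtain Y where Y: "\<And>b. b \<in> I \<Longrightarrow> \<exists>l. C (Y b) l b \<noteq> 0" by metis
  define H where "H a b y = (\<Sum>l\<in>UNIV. a $ l * C y l b)" for a :: "'a ^ 'k" and b y
  \<comment> \<open>first fix the functional, for vectors that may depend on the exponent; then a common vector\<close>
  have "\<exists>a. \<forall>b\<in>I. H a b (Y b) \<noteq> 0"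
  proof (rule ex_common_nonzero[where h="\<lambda>b a. H a b (Y b)" and e="\<lambda>_. 0", OF fI cardI])
    fix b assume "b \<in> I"
    then obtain l where l: "C (Y b) l b \<noteq> 0" using Y by auto
    have "H (axis l 1) b (Y b) = (\<Sum>i\<in>UNIV. if i = l then C (Y b) i b else 0)"
      unfolding H_def by (rule sum.cong) (auto simp: axis_def)
    with l show "\<exists>a. H a b (Y b) \<noteq> 0" by (intro exI[of _ "axis l 1"]) simp
  qed (simp_all add: H_def algebra_simps sum.distrib sum_distrib_left)
  then obtain a where a: "\<And>b. b \<in> I \<Longrightarrow> H a b (Y b) \<noteq> 0" by blast
  have "\<exists>y. \<forall>b\<in>I. H a b y \<noteq> 0"
  proof (rule ex_common_nonzero[where e="\<lambda>b. b", OF fI cardI])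
    fix b assume "b \<in> I"
    then have "b < n" by (simp add: I_def)
    show "H a b (x + y) = H a b x + H a b y" for x y
      by (simp add: H_def C_add[OF \<open>b < n\<close>] algebra_simps sum.distrib)
    show "H a b (t *s x) = t ^ (q ^ b) * H a b x" for t x
      by (simp add: H_def C_hom[OF \<open>b < n\<close>] algebra_simps sum_distrib_left)
    show "\<exists>y. H a b y \<noteq> 0" using a[OF \<open>b \<in> I\<close>] by blast
  qed
  then obtain y where y: "\<And>b. b \<in> I \<Longrightarrow> H a b y \<noteq> 0" by blast
  define g where "g t = (\<Sum>l\<in>UNIV. a $ l * \<rho> (t *s y) $ l)" for t
  have g_eq: "g t = (\<Sum>b<n. H a b y * t ^ (q ^ b))" for t
  proof -
    have "g t = (\<Sum>l\<in>UNIV. \<Sum>b<n. a $ l * C y l b * t ^ (q ^ b))"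
      by (simp add: g_def C sum_distrib_left algebra_simps)
    also have "\<dots> = (\<Sum>b<n. H a b y * t ^ (q ^ b))"
      by (subst sum.swap) (simp add: H_def sum_distrib_right)
    finally show ?thesis .
  qed
  have "\<exists>c. c \<notin> F \<and> g (c * t) = c * g t" for t
  proof -
    obtain c where c: "c \<notin> F" "\<rho> (c *s (t *s y)) = c *s \<rho> (t *s y)" using \<rho>_weight by blast
    then have "g (c * t) = c * g t" by (simp add: g_def sum_distrib_left algebra_simps)
    with c show ?thesis by blast
  qed
  then obtain d where d: "d > 1" "d dvd n" "\<And>b. b < n \<Longrightarrow> H a b y \<noteq> 0 \<Longrightarrow> d dvd b"
    using q_poly_exponents_common_divisor[OF g_eq] by metis
  define L where "L = {x::'a. x ^ (q ^ d) = x}"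
  have L_frob: "c ^ (q ^ b) = c" if "c \<in> L" "d dvd b" for c b
    by (rule frob_fixed_multiple[of c d]) (use that in \<open>simp_all add: L_def\<close>)
  have \<rho>_L: "\<rho> (c *s v) = c *s \<rho> v" if c: "c \<in> L" for c v
  proof -
    have "\<rho> (c *s v) $ l = c * \<rho> (1 *s v) $ l" for l
    proof -
      have "C v l b * c ^ (q ^ b) = c * (C v l b * 1 ^ (q ^ b))" if b: "b < n" for b
      proof (cases "C v l b = 0")
        case False
        with b have "b \<in> I" by (auto simp: I_def)
        then have "d dvd b" using d(3) y b by blast
        then show ?thesis using L_frob[OF c] by simp
      qed simp
      then show ?thesis unfolding C sum_distrib_left by (intro sum.cong) auto
    qed
    then show ?thesis by (simp add: vec_eq_iff)
  qed
  have \<rho>_U: "\<rho> u = u" if "u \<in> U" for u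
    by (rule \<rho>_eq[OF that]) (simp add: vec.subspace_0[OF W])
  show ?thesis
  proof (rule that[of L])
    show "is_subfield L" "F \<subset> L" unfolding L_def using fixed_field[OF d(2,1)] by auto
    show "subspace_over L U" unfolding subspace_over_def
    proof (intro conjI ballI)
      fix c u assume "c \<in> L" "u \<in> U"
      then have "\<rho> (c *s u) = c *s u" by (simp add: \<rho>_L \<rho>_U)
      then show "c *s u \<in> U" using \<rho>(1)[of "c *s u"] by simp
    qed (auto intro: subspace_overD[OF U])
  qed
qed

end

section \<open>Perturbing a linearly independent family\<close>

lemma ex_nontrivial_solution:
  fixes M :: "'i \<Rightarrow> 'j \<Rightarrow> 'c::field"
  assumes "finite S" "finite T" "card S < card T"
  shows "\<exists>z. (\<exists>t\<in>T. z t \<noteq> 0) \<and> (\<forall>i\<in>S. (\<Sum>t\<in>T. z t * M i t) = 0)"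
  using assms
proof (induction S arbitrary: T M rule: finite_induct)
  case empty
  then have "T \<noteq> {}" by auto
  then show ?case by (intro exI[of _ "\<lambda>_. 1"]) auto
next
  case (insert s S)
  show ?case
  proof (cases "\<forall>t\<in>T. M s t = 0")
    case True
    have "card S < card T" using insert.prems(2) insert.hyps by simp
    from insert.IH[OF insert.prems(1) this, of M] obtain z
      where "\<exists>t\<in>T. z t \<noteq> 0" "\<forall>i\<in>S. (\<Sum>t\<in>T. z t * M i t) = 0" by blast
    with True show ?thesis by (intro exI[of _ z]) simp
  next
    case False
    then obtain t0 where t0: "t0 \<in> T" "M s t0 \<noteq> 0" by auto
    define M' where "M' i t = M i t - M i t0 * M s t / M s t0" for i t
    have "card S < card (T - {t0})" using insert.prems insert.hyps t0 by simp
    moreover have "finite (T - {t0})" using insert.prems by simp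
    ultimately obtain z where z: "\<exists>t\<in>T-{t0}. z t \<noteq> 0" "\<forall>i\<in>S. (\<Sum>t\<in>T-{t0}. z t * M' i t) = 0"
      using insert.IH[of "T - {t0}" M'] by blast
    define z' where "z' = z(t0 := - (\<Sum>t\<in>T-{t0}. z t * M s t) / M s t0)"
    have split: "(\<Sum>t\<in>T. z' t * M i t) = z' t0 * M i t0 + (\<Sum>t\<in>T-{t0}. z t * M i t)" for i
    proof -
      have "(\<Sum>t\<in>T. z' t * M i t) = z' t0 * M i t0 + (\<Sum>t\<in>T-{t0}. z' t * M i t)"
        using insert.prems(1) t0(1) by (rule sum.remove)
      also have "(\<Sum>t\<in>T-{t0}. z' t * M i t) = (\<Sum>t\<in>T-{t0}. z t * M i t)"
        by (rule sum.cong) (auto simp: z'_def)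
      finally show ?thesis .
    qed
    have "(\<Sum>t\<in>T. z' t * M s t) = 0" unfolding split using t0 by (simp add: z'_def)
    moreover have "(\<Sum>t\<in>T. z' t * M i t) = 0" if "i \<in> S" for i
    proof -
      have "(\<Sum>t\<in>T-{t0}. z t * M' i t)
          = (\<Sum>t\<in>T-{t0}. z t * M i t) - (\<Sum>t\<in>T-{t0}. z t * M s t) * (M i t0 / M s t0)"
        unfolding sum_distrib_right sum_subtractf[symmetric]
        by (rule sum.cong) (simp_all add: M'_def algebra_simps)
      then show ?thesis unfolding split using z(2) that by (simp add: z'_def)
    qed
    moreover have "\<exists>t\<in>T. z' t \<noteq> 0" using z(1) by (auto simp: z'_def)
    ultimately show ?thesis by (intro exI[of _ z']) simp
  qed
qed

text \<open>Modulo \<open>U\<close>, a relation \<open>c\<close> among the vectors \<open>f i + t g i\<close> is an eigenvector, with eigenvalue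
  \<open>- 1 / t\<close>, of the map that expresses the \<open>g i\<close>, projected to the span of the \<open>f i\<close>, in terms of the
  \<open>f i\<close>. The proof is the usual one for the independence of eigenvectors to distinct eigenvalues, and the number of independent
  vectors \<open>c\<close> is at most \<open>card S\<close>.\<close>

lemma (in vector_space) dependent_perturbation:
  fixes f g :: "'i \<Rightarrow> 'b"
  assumes U: "subspace U" and S: "finite S"
    and indep: "\<And>c. (\<Sum>i\<in>S. c i *s f i) \<in> U \<Longrightarrow> \<forall>i\<in>S. c i = 0"
  defines "bad \<equiv> {t. \<exists>c. (\<exists>i\<in>S. c i \<noteq> 0) \<and> (\<Sum>i\<in>S. c i *s (f i + t *s g i)) \<in> U}"
  shows "finite bad" "card bad \<le> card S"
proof -
  have "\<exists>c. (\<exists>i\<in>S. c i \<noteq> 0) \<and> (\<Sum>i\<in>S. c i *s (f i + t *s g i)) \<in> U" if "t \<in> bad" for t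
    using that by (simp add: bad_def)
  then obtain c where c: "\<And>t. t \<in> bad \<Longrightarrow> \<exists>i\<in>S. c t i \<noteq> 0"
    "\<And>t. t \<in> bad \<Longrightarrow> (\<Sum>i\<in>S. c t i *s (f i + t *s g i)) \<in> U" by metis
  have nz: "t \<noteq> 0" if "t \<in> bad" for t
  proof
    assume "t = 0"
    with c(2)[OF that] have "\<forall>i\<in>S. c t i = 0" by (intro indep) simp
    with c(1)[OF that] show False by simp
  qed
  have eigen: "\<forall>i\<in>S. (\<Sum>t\<in>T. z t / t * c t i) = 0"
    if T: "T \<subseteq> bad" and z: "\<forall>i\<in>S. (\<Sum>t\<in>T. z t * c t i) = 0" for T z
  proof (rule indep)
    have "(\<Sum>t\<in>T. (z t / t) *s (\<Sum>i\<in>S. c t i *s (f i + t *s g i))) \<in> U"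
      using T by (intro subspace_sum[OF U] subspace_scale[OF U] c) auto
    also have "(\<Sum>t\<in>T. (z t / t) *s (\<Sum>i\<in>S. c t i *s (f i + t *s g i)))
        = (\<Sum>t\<in>T. (\<Sum>i\<in>S. (z t / t * c t i) *s f i) + (\<Sum>i\<in>S. (z t * c t i) *s g i))"
    proof (rule sum.cong[OF refl])
      fix t assume "t \<in> T"
      then have "t \<noteq> 0" using T nz by auto
      then show "(z t / t) *s (\<Sum>i\<in>S. c t i *s (f i + t *s g i))
          = (\<Sum>i\<in>S. (z t / t * c t i) *s f i) + (\<Sum>i\<in>S. (z t * c t i) *s g i)"
        by (simp add: scale_sum_right scale_right_distrib sum.distrib)
    qed
    also have "\<dots> = (\<Sum>i\<in>S. (\<Sum>t\<in>T. z t / t * c t i) *s f i) + (\<Sum>i\<in>S. (\<Sum>t\<in>T. z t * c t i) *s g i)"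
      unfolding sum.distrib scale_sum_left by (intro arg_cong2[where f="(+)"] sum.swap)
    also have "(\<Sum>i\<in>S. (\<Sum>t\<in>T. z t * c t i) *s g i) = 0" using z by simp
    finally show "(\<Sum>i\<in>S. (\<Sum>t\<in>T. z t / t * c t i) *s f i) \<in> U" by simp
  qed
  have ind: "\<forall>t\<in>T. z t = 0"
    if "finite T" "T \<subseteq> bad" "\<forall>i\<in>S. (\<Sum>t\<in>T. z t * c t i) = 0" for T z
    using that
  proof (induction T arbitrary: z rule: finite_induct)
    case (insert t0 T)
    have t0: "t0 \<in> bad" "t0 \<noteq> 0" using insert.prems(1) nz by auto
    have "\<forall>t\<in>T. z t * (1 - t0 / t) = 0"
    proof (rule insert.IH)
      show "T \<subseteq> bad" using insert.prems by simp
      show "\<forall>i\<in>S. (\<Sum>t\<in>T. z t * (1 - t0 / t) * c t i) = 0"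
      proof
        fix i assume i: "i \<in> S"
        have 1: "z t0 * c t0 i + (\<Sum>t\<in>T. z t * c t i) = 0"
          using insert.prems(2) insert.hyps i by simp
        have "(\<Sum>t\<in>insert t0 T. z t / t * c t i) = 0"
          using eigen[OF insert.prems] i by blast
        then have 2: "z t0 / t0 * c t0 i + (\<Sum>t\<in>T. z t / t * c t i) = 0"
          using insert.hyps by simp
        have "(\<Sum>t\<in>T. z t * (1 - t0 / t) * c t i)
            = (\<Sum>t\<in>T. z t * c t i) - t0 * (\<Sum>t\<in>T. z t / t * c t i)"
          unfolding sum_distrib_left sum_subtractf[symmetric]
          by (rule sum.cong) (simp_all add: algebra_simps)
        also have "(\<Sum>t\<in>T. z t * c t i) = - (z t0 * c t0 i)" using 1 by (simp add: add_eq_0_iff)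
        also have "(\<Sum>t\<in>T. z t / t * c t i) = - (z t0 / t0 * c t0 i)" using 2 by (simp add: add_eq_0_iff)
        finally show "(\<Sum>t\<in>T. z t * (1 - t0 / t) * c t i) = 0" using t0(2) by simp
      qed
    qed
    moreover have "t \<noteq> 0" "t \<noteq> t0" if "t \<in> T" for t
      using that insert.prems(1) insert.hyps nz by auto
    ultimately have T0: "\<forall>t\<in>T. z t = 0" by fastforce
    obtain i where i: "i \<in> S" "c t0 i \<noteq> 0" using c(1)[OF t0(1)] by blast
    have "z t0 * c t0 i + (\<Sum>t\<in>T. z t * c t i) = 0"
      using insert.prems(2) insert.hyps i(1) by simp
    then have "z t0 = 0" using T0 i(2) by simp
    with T0 show ?case by simp
  qed simp
  have "card T \<le> card S" if "T \<subseteq> bad" "finite T" for T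
  proof (rule ccontr)
    assume "\<not> card T \<le> card S"
    with ex_nontrivial_solution[OF S \<open>finite T\<close>, of "\<lambda>i t. c t i"] obtain z
      where "\<exists>t\<in>T. z t \<noteq> 0" "\<forall>i\<in>S. (\<Sum>t\<in>T. z t * c t i) = 0" by auto
    with ind[OF that(2,1)] show False by blast
  qed
  then show "finite bad" "card bad \<le> card S"
    using finite_if_finite_subsets_card_bdd[of bad "card S"] by auto
qed

section \<open>Rescaling the entries of tuples\<close>

definition tuple_scale :: "'c::field \<Rightarrow> (nat \<Rightarrow> 'c ^ 'k) \<Rightarrow> nat \<Rightarrow> 'c ^ 'k"
  where "tuple_scale c v = (\<lambda>i. c *s v i)"

lemma tuple_scale_apply [simp]: "tuple_scale c v i = c *s v i"
  by (simp add: tuple_scale_def)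

interpretation tuple: vector_space tuple_scale
  by unfold_locales (simp_all add: fun_eq_iff vec.scale_right_distrib vec.scale_left_distrib)

definition twist :: "(nat \<Rightarrow> 'c::field) \<Rightarrow> (nat \<Rightarrow> 'c ^ 'k) \<Rightarrow> nat \<Rightarrow> 'c ^ 'k"
  where "twist l v = (\<lambda>i. l i *s v i)"

lemma twist_twist: "twist l (twist m v) = twist (\<lambda>i. l i * m i) v"
  by (simp add: twist_def fun_eq_iff)

text \<open>In a space \<open>U\<close> of tuples, a tuple \<open>a\<close> is degenerate for a set \<open>S\<close> of entries if its entries in
  \<open>S\<close>, each viewed as a tuple with a single nonzero entry, are linearly dependent modulo \<open>U\<close>.\<close>

definition degenerate :: "(nat \<Rightarrow> 'c::field ^ 'k) set \<Rightarrow> nat set \<Rightarrow> (nat \<Rightarrow> 'c ^ 'k) \<Rightarrow> bool"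
  where "degenerate U S a \<longleftrightarrow> (\<exists>l. (\<forall>i. i \<notin> S \<longrightarrow> l i = 0) \<and> (\<exists>i. l i \<noteq> 0) \<and> twist l a \<in> U)"

definition everywhere_degenerate :: "(nat \<Rightarrow> 'c::field ^ 'k) set \<Rightarrow> nat set \<Rightarrow> bool"
  where "everywhere_degenerate U S \<longleftrightarrow> (\<forall>a\<in>U. degenerate U S a)"

text \<open>If \<open>U\<close> is everywhere degenerate for \<open>S\<close>, then for an irredundant \<open>a\<close> the rescalings of \<open>a\<close> in
  \<open>U\<close> supported on \<open>S\<close> form a line, spanned by one that vanishes nowhere on \<open>S\<close>.\<close>

definition irredundant :: "(nat \<Rightarrow> 'c::field ^ 'k) set \<Rightarrow> nat set \<Rightarrow> (nat \<Rightarrow> 'c ^ 'k) \<Rightarrow> bool"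
  where "irredundant U S a \<longleftrightarrow> (\<forall>i\<in>S. \<not> degenerate U (S - {i}) a)"

lemma degenerate_untwist:
  assumes "degenerate U S (twist m a)" "\<And>i. m i \<noteq> 0"
  shows "degenerate U S a"
proof -
  obtain l where l: "\<forall>i. i \<notin> S \<longrightarrow> l i = 0" "\<exists>i. l i \<noteq> 0" "twist (\<lambda>i. l i * m i) a \<in> U"
    using assms(1) by (auto simp: degenerate_def twist_twist)
  then show ?thesis unfolding degenerate_def
    by (intro exI[of _ "\<lambda>i. l i * m i"]) (simp add: assms(2))
qed

lemma degenerate_line_swap:
  fixes a b :: "nat \<Rightarrow> 'c::field ^ 'k"
  assumes "degenerate U S (a + tuple_scale t b)" "t \<noteq> 0"
  shows "degenerate U S (b + tuple_scale (inverse t) a)"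
proof (rule degenerate_untwist[where m="\<lambda>_. t"])
  have "twist (\<lambda>_. t) (b + tuple_scale (inverse t) a) = a + tuple_scale t b"
    using assms(2) by (simp add: twist_def fun_eq_iff vec.scale_right_distrib add.commute)
  with assms(1) show "degenerate U S (twist (\<lambda>_. t) (b + tuple_scale (inverse t) a))" by simp
qed (rule assms(2))

lemma sum_fun_apply: "(\<Sum>i\<in>A. f i) x = (\<Sum>i\<in>A. f i x :: 'b::comm_monoid_add)"
  by (induction A rule: infinite_finite_induct) simp_all

lemma sum_unit_tuples:
  assumes "finite S"
  shows "(\<Sum>i\<in>S. tuple_scale (c i) (\<lambda>j. if j = i then a j else 0)) = twist (\<lambda>i. if i \<in> S then c i else 0) a"
proof
  fix j
  have "(\<Sum>i\<in>S. tuple_scale (c i) (\<lambda>j. if j = i then a j else 0)) j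
      = (\<Sum>i\<in>S. if j = i then c j *s a j else 0)"
    unfolding sum_fun_apply by (rule sum.cong) auto
  also have "\<dots> = twist (\<lambda>i. if i \<in> S then c i else 0) a j"
    using assms by (simp add: twist_def)
  finally show "(\<Sum>i\<in>S. tuple_scale (c i) (\<lambda>j. if j = i then a j else 0)) j
      = twist (\<lambda>i. if i \<in> S then c i else 0) a j" .
qed

locale tuple_space =
  fixes U :: "(nat \<Rightarrow> 'c::field ^ 'k) set"
  assumes U: "tuple.subspace U"
begin

lemma degenerate_iff_sum:
  assumes "finite S"
  shows "degenerate U S a \<longleftrightarrow>
    (\<exists>c. (\<exists>i\<in>S. c i \<noteq> 0) \<and> (\<Sum>i\<in>S. tuple_scale (c i) (\<lambda>j. if j = i then a j else 0)) \<in> U)"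
    (is "_ \<longleftrightarrow> ?R")
proof
  assume "degenerate U S a"
  then obtain l where l: "\<forall>i. i \<notin> S \<longrightarrow> l i = 0" "\<exists>i. l i \<noteq> 0" "twist l a \<in> U"
    by (auto simp: degenerate_def)
  have "(\<lambda>i. if i \<in> S then l i else 0) = l" using l(1) by auto
  with l show ?R unfolding sum_unit_tuples[OF assms] by (intro exI[of _ l]) auto
next
  assume ?R
  then obtain c where c: "\<exists>i\<in>S. c i \<noteq> 0" "twist (\<lambda>i. if i \<in> S then c i else 0) a \<in> U"
    unfolding sum_unit_tuples[OF assms] by blast
  then show "degenerate U S a" unfolding degenerate_def
    by (intro exI[of _ "\<lambda>i. if i \<in> S then c i else 0"]) auto
qed

text \<open>Being degenerate is a closed condition: along a line through a tuple that is not degenerate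
  it holds for at most \<open>card S\<close> parameters.\<close>

lemma degenerate_perturbation:
  assumes S: "finite S" and a: "\<not> degenerate U S a"
  shows "finite {t. degenerate U S (a + tuple_scale t b)}"
    and "card {t. degenerate U S (a + tuple_scale t b)} \<le> card S"
proof -
  let ?u = "\<lambda>a i j. if j = i then a j else (0 :: 'c ^ 'k)"
  have unit: "?u (a + tuple_scale t b) i = ?u a i + tuple_scale t (?u b i)" for t i
    by (simp add: fun_eq_iff)
  have indep: "\<forall>i\<in>S. c i = 0" if "(\<Sum>i\<in>S. tuple_scale (c i) (?u a i)) \<in> U" for c
    using a that unfolding degenerate_iff_sum[OF S] by blast
  have eq: "{t. degenerate U S (a + tuple_scale t b)} = {t. \<exists>c. (\<exists>i\<in>S. c i \<noteq> 0) \<and>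
      (\<Sum>i\<in>S. tuple_scale (c i) (?u a i + tuple_scale t (?u b i))) \<in> U}"
    unfolding degenerate_iff_sum[OF S] unit ..
  show "finite {t. degenerate U S (a + tuple_scale t b)}"
    "card {t. degenerate U S (a + tuple_scale t b)} \<le> card S"
    unfolding eq by (rule tuple.dependent_perturbation[where f="?u a", OF U S indep], assumption)+
qed

text \<open>Each single requirement of irredundancy can be met by minimality of \<open>S\<close>, and each is an open
  condition; over an infinite field finitely many nonempty open conditions can be met together.\<close>

lemma ex_irredundant:
  assumes inf: "infinite (UNIV :: 'c set)" and S: "finite S"
    and min: "\<And>T. T \<subset> S \<Longrightarrow> \<not> everywhere_degenerate U T"
  obtains a where "a \<in> U" "irredundant U S a"
proof -
  have "\<exists>a\<in>U. \<forall>i\<in>J. \<not> degenerate U (S - {i}) a" if "finite J" "J \<subseteq> S" for J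
    using that
  proof (induction J rule: finite_induct)
    case empty
    show ?case using tuple.subspace_0[OF U] by blast
  next
    case (insert i J)
    then obtain a where a: "a \<in> U" "\<forall>j\<in>J. \<not> degenerate U (S - {j}) a" by auto
    have "S - {i} \<subset> S" using insert.prems by auto
    then obtain b where b: "b \<in> U" "\<not> degenerate U (S - {i}) b"
      using min unfolding everywhere_degenerate_def by blast
    define bad where "bad = insert 0 ((\<Union>j\<in>J. {t. degenerate U (S - {j}) (a + tuple_scale t b)})
      \<union> inverse ` {t. degenerate U (S - {i}) (b + tuple_scale t a)})"
    have "finite bad"
      using insert.hyps S a(2) b(2) by (auto simp: bad_def intro!: degenerate_perturbation(1))
    then obtain t where t: "t \<notin> bad" using inf ex_new_if_finite by blast
    have "a + tuple_scale t b \<in> U"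
      by (intro tuple.subspace_add[OF U] tuple.subspace_scale[OF U] a b)
    moreover have "\<not> degenerate U (S - {j}) (a + tuple_scale t b)" if "j \<in> insert i J" for j
    proof
      assume deg: "degenerate U (S - {j}) (a + tuple_scale t b)"
      with t that have "j = i" by (auto simp: bad_def)
      moreover have "t \<noteq> 0" using t by (auto simp: bad_def)
      ultimately have "degenerate U (S - {i}) (b + tuple_scale (inverse t) a)"
        using deg degenerate_line_swap by blast
      then have "inverse (inverse t) \<in> bad" unfolding bad_def by blast
      with t show False by simp
    qed
    ultimately show ?case by blast
  qed
  from this[OF S subset_refl] that show ?thesis by (auto simp: irredundant_def)
qed

text \<open>Let \<open>v\<close> be the rescaling of \<open>a\<close> that lies in \<open>U\<close> and is supported on \<open>S\<close>, and let \<open>bS\<close> be the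
  part of \<open>b\<close> on \<open>S\<close>. It suffices to find a rescaling \<open>l1\<close> with \<open>bS + twist l1 v \<in> U\<close>, since subtracting
  this from \<open>b\<close> leaves \<open>b\<close> off \<open>S\<close> and a rescaling of \<open>a\<close> on \<open>S\<close>. If there were none, then \<open>bS\<close> and all
  entries of \<open>v\<close> in \<open>S\<close> except one would be independent modulo \<open>U\<close>. This persists when \<open>v\<close> is replaced
  by \<open>v + t b\<close> for almost all \<open>t\<close>. But \<open>v + t b\<close> is degenerate for \<open>S\<close>, and as the part of \<open>v + t b\<close>
  on \<open>S\<close> is \<open>t bS\<close> modulo \<open>U\<close>, this is a dependence among just these tuples. So \<open>l1\<close> is the derivative at
  \<open>t = 0\<close> of a rescaling that moves \<open>v + t b\<close> into \<open>U\<close>.\<close>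

lemma merge_irredundant:
  assumes inf: "infinite (UNIV :: 'c set)" and S: "finite S" and dom: "everywhere_degenerate U S"
    and a: "a \<in> U" "irredundant U S a" and b: "b \<in> U"
  obtains m where "\<And>i. m i \<noteq> 0" "twist m (\<lambda>i. if i \<in> S then a i else b i) \<in> U"
proof -
  have "degenerate U S a" using dom a(1) by (simp add: everywhere_degenerate_def)
  then obtain l0 where l0: "\<forall>i. i \<notin> S \<longrightarrow> l0 i = 0" "\<exists>i. l0 i \<noteq> 0" "twist l0 a \<in> U"
    unfolding degenerate_def by blast
  have l0_nz: "l0 i \<noteq> 0" if "i \<in> S" for i
  proof
    assume "l0 i = 0"
    with l0 have "degenerate U (S - {i}) a" unfolding degenerate_def by (intro exI[of _ l0]) auto
    with a(2) that show False by (auto simp: irredundant_def)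
  qed
  obtain i0 where i0: "i0 \<in> S" using l0 by blast
  define v where "v = twist l0 a"
  have v: "v \<in> U" "v i = 0" if "i \<notin> S" for i using l0 that by (simp_all add: v_def twist_def)
  have vU: "v \<in> U" using l0 by (simp add: v_def)
  define bS where "bS = (\<lambda>i. if i \<in> S then b i else 0)"
  have "\<exists>l1. bS + twist l1 v \<in> U"
  proof (rule ccontr)
    assume no: "\<nexists>l1. bS + twist l1 v \<in> U"
    let ?u = "\<lambda>a i j. if j = i then a j else (0 :: 'c ^ 'k)"
    define f where "f i = (if i = i0 then bS else ?u v i)" for i
    define g where "g i = (if i = i0 then 0 else ?u b i)" for i
    have sum_f: "(\<Sum>i\<in>S. tuple_scale (c i) (f i + tuple_scale t (g i)))
        = tuple_scale (c i0) bS + twist (\<lambda>i. if i \<in> S - {i0} then c i else 0) (v + tuple_scale t b)" for c t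
    proof -
      have "(\<Sum>i\<in>S. tuple_scale (c i) (f i + tuple_scale t (g i)))
          = tuple_scale (c i0) bS + (\<Sum>i\<in>S-{i0}. tuple_scale (c i) (f i + tuple_scale t (g i)))"
        using sum.remove[OF S i0, of "\<lambda>i. tuple_scale (c i) (f i + tuple_scale t (g i))"]
        by (simp add: f_def g_def)
      also have "(\<Sum>i\<in>S-{i0}. tuple_scale (c i) (f i + tuple_scale t (g i)))
          = (\<Sum>i\<in>S-{i0}. tuple_scale (c i) (?u (v + tuple_scale t b) i))"
        by (rule sum.cong) (auto simp: f_def g_def fun_eq_iff)
      also have "\<dots> = twist (\<lambda>i. if i \<in> S - {i0} then c i else 0) (v + tuple_scale t b)"
        by (rule sum_unit_tuples) (use S in simp)
      finally show ?thesis .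
    qed
    have indep: "\<forall>i\<in>S. c i = 0" if cU: "(\<Sum>i\<in>S. tuple_scale (c i) (f i)) \<in> U" for c
    proof -
      have sum0: "tuple_scale (c i0) bS + twist (\<lambda>i. if i \<in> S - {i0} then c i else 0) v \<in> U"
        using cU sum_f[of c 0] by simp
      have c0: "c i0 = 0"
      proof (rule ccontr)
        assume "c i0 \<noteq> 0"
        have "tuple_scale (inverse (c i0)) (tuple_scale (c i0) bS
            + twist (\<lambda>i. if i \<in> S - {i0} then c i else 0) v) \<in> U"
          by (rule tuple.subspace_scale[OF U sum0])
        also have "tuple_scale (inverse (c i0)) (tuple_scale (c i0) bS
            + twist (\<lambda>i. if i \<in> S - {i0} then c i else 0) v)
          = bS + twist (\<lambda>i. inverse (c i0) * (if i \<in> S - {i0} then c i else 0)) v"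
          using \<open>c i0 \<noteq> 0\<close> by (simp add: twist_def fun_eq_iff vec.scale_right_distrib)
        finally show False using no by blast
      qed
      have "tuple_scale (c i0) bS + twist (\<lambda>i. if i \<in> S - {i0} then c i else 0) v
          = twist (\<lambda>i. if i \<in> S - {i0} then c i * l0 i else 0) a"
        by (simp add: c0 v_def twist_def fun_eq_iff)
      with sum0 have in_U: "twist (\<lambda>i. if i \<in> S - {i0} then c i * l0 i else 0) a \<in> U" by simp
      have "c i = 0" if "i \<in> S - {i0}" for i
      proof (rule ccontr)
        assume "c i \<noteq> 0"
        with in_U that l0_nz have "degenerate U (S - {i0}) a" unfolding degenerate_def
          by (intro exI[of _ "\<lambda>i. if i \<in> S - {i0} then c i * l0 i else 0"]) auto
        with a(2) i0 show False by (simp add: irredundant_def)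
      qed
      with c0 show ?thesis by blast
    qed
    define bad where "bad = {t. \<exists>c. (\<exists>i\<in>S. c i \<noteq> 0) \<and>
      (\<Sum>i\<in>S. tuple_scale (c i) (f i + tuple_scale t (g i))) \<in> U}"
    have "finite (insert 0 bad)"
      unfolding bad_def using tuple.dependent_perturbation(1)[where f=f and g=g, OF U S indep] by simp
    then obtain t where "t \<notin> insert 0 bad" using inf ex_new_if_finite by blast
    then have t: "t \<noteq> 0" "t \<notin> bad" by auto
    have "v + tuple_scale t b \<in> U"
      by (intro tuple.subspace_add[OF U] tuple.subspace_scale[OF U] vU b)
    then have "degenerate U S (v + tuple_scale t b)" using dom by (simp add: everywhere_degenerate_def)
    then obtain l where l: "\<forall>i. i \<notin> S \<longrightarrow> l i = 0" "\<exists>i. l i \<noteq> 0" "twist l (v + tuple_scale t b) \<in> U"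
      unfolding degenerate_def by blast
    \<comment> \<open>subtract \<open>l i0\<close> times the part of \<open>v + t b\<close> on \<open>S\<close>, which is \<open>t bS\<close> modulo \<open>U\<close>, to eliminate the entry \<open>i0\<close>\<close>
    define c where "c i = (if i = i0 then l i0 * t else l i - l i0)" for i
    have "twist l (v + tuple_scale t b) - tuple_scale (l i0) v \<in> U"
      by (intro tuple.subspace_diff[OF U] tuple.subspace_scale[OF U] l vU)
    also have "twist l (v + tuple_scale t b) - tuple_scale (l i0) v
        = tuple_scale (c i0) bS + twist (\<lambda>i. if i \<in> S - {i0} then c i else 0) (v + tuple_scale t b)"
    proof
      fix i
      show "(twist l (v + tuple_scale t b) - tuple_scale (l i0) v) i
        = (tuple_scale (c i0) bS + twist (\<lambda>i. if i \<in> S - {i0} then c i else 0) (v + tuple_scale t b)) i"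
      proof (cases "i \<in> S")
        case True
        then show ?thesis
          by (cases "i = i0")
            (simp_all add: twist_def c_def bS_def vec_eq_iff algebra_simps)
      next
        case False
        then have "i \<noteq> i0" using i0 by auto
        with False show ?thesis using l(1) v(2)[OF False] by (simp add: twist_def bS_def)
      qed
    qed
    finally have in_U: "(\<Sum>i\<in>S. tuple_scale (c i) (f i + tuple_scale t (g i))) \<in> U"
      unfolding sum_f .
    have "\<exists>i\<in>S. c i \<noteq> 0"
    proof (rule ccontr)
      assume "\<not> (\<exists>i\<in>S. c i \<noteq> 0)"
      then have c0: "c i = 0" if "i \<in> S" for i using that by blast
      have "l i0 = 0" using c0[OF i0] t by (simp add: c_def)
      then have "l i = 0" for i using c0[of i] l(1) by (cases "i \<in> S"; cases "i = i0") (auto simp: c_def)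
      with l(2) show False by simp
    qed
    with in_U have "t \<in> bad" unfolding bad_def by blast
    with t show False by simp
  qed
  then obtain l1 where l1: "bS + twist l1 v \<in> U" by blast
  \<comment> \<open>adding a multiple of \<open>v\<close> makes the rescaling of \<open>a\<close> nonzero everywhere on \<open>S\<close>\<close>
  have "finite (l1 ` S)" using S by simp
  then obtain s where s: "s \<notin> l1 ` S" using inf ex_new_if_finite by blast
  define m where "m i = (if i \<in> S then (s - l1 i) * l0 i else 1)" for i
  show ?thesis
  proof (rule that)
    show "m i \<noteq> 0" for i using s l0_nz by (auto simp: m_def)
    have "b - (bS + twist l1 v) + tuple_scale s v \<in> U"
      by (intro tuple.subspace_add[OF U] tuple.subspace_diff[OF U] tuple.subspace_scale[OF U] l1 vU b)
    also have "b - (bS + twist l1 v) + tuple_scale s v = twist m (\<lambda>i. if i \<in> S then a i else b i)"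
    proof
      fix i
      show "(b - (bS + twist l1 v) + tuple_scale s v) i = twist m (\<lambda>i. if i \<in> S then a i else b i) i"
      proof (cases "i \<in> S")
        case True
        then show ?thesis
          by (simp add: twist_def bS_def m_def v_def vec_eq_iff algebra_simps)
      next
        case False
        then show ?thesis using v(2)[OF False] by (simp add: twist_def bS_def m_def)
      qed
    qed
    finally show "twist m (\<lambda>i. if i \<in> S then a i else b i) \<in> U" .
  qed
qed

text \<open>Adding to a generic multiple of the given tuple the irredundant \<open>b\<close> on \<open>S\<close> makes all pieces on \<open>S\<close>
  irredundant. Then the two pieces in each fibre of \<open>\<kappa>\<close> can be merged, and the result is glued from
  elements of \<open>U\<close> along \<open>\<kappa>\<close> alone, so that it is degenerate by assumption. As degeneracy is closed,
  the perturbation can be undone.\<close>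

lemma degenerate_refine:
  fixes \<kappa> :: "nat \<Rightarrow> 'x"
  assumes inf: "infinite (UNIV :: 'c set)" and N: "finite N" and \<kappa>: "finite (range \<kappa>)"
    and coarse: "\<And>u. (\<And>X. u X \<in> U) \<Longrightarrow> degenerate U N (\<lambda>i. u (\<kappa> i) i)"
    and S: "finite S" "everywhere_degenerate U S" and b: "b \<in> U" "irredundant U S b"
    and u: "\<And>X. u1 X \<in> U" "\<And>X. u2 X \<in> U"
  shows "degenerate U N (\<lambda>i. if i \<in> S then u1 (\<kappa> i) i else u2 (\<kappa> i) i)" (is "degenerate U N ?a")
proof (rule ccontr)
  assume nd: "\<not> degenerate U N ?a"
  define bS where "bS = (\<lambda>i. if i \<in> S then b i else 0)"
  define bad where "bad = insert 0 (inverse ` {t. degenerate U N (?a + tuple_scale t bS)}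
    \<union> (\<Union>X\<in>range \<kappa>. \<Union>i\<in>S. {s. degenerate U (S - {i}) (b + tuple_scale s (u1 X))}))"
  have "finite {s. degenerate U (S - {i}) (b + tuple_scale s (u1 X))}" if "i \<in> S" for i X
    by (rule degenerate_perturbation(1)) (use S(1) b(2) that in \<open>auto simp: irredundant_def\<close>)
  then have "finite (\<Union>X\<in>range \<kappa>. \<Union>i\<in>S. {s. degenerate U (S - {i}) (b + tuple_scale s (u1 X))})"
    using S(1) \<kappa> by (intro finite_UN_I) auto
  moreover have "finite {t. degenerate U N (?a + tuple_scale t bS)}"
    by (rule degenerate_perturbation(1)[OF N nd])
  ultimately have "finite bad" unfolding bad_def by simp
  then obtain s where s: "s \<notin> bad" using inf ex_new_if_finite by blast
  then have s0: "s \<noteq> 0" by (auto simp: bad_def)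
  have irredundant: "irredundant U S (b + tuple_scale s (u1 (\<kappa> j)))" for j
    using s unfolding bad_def irredundant_def by blast
  have mem: "b + tuple_scale s (u1 X) \<in> U" "tuple_scale s (u2 X) \<in> U" for X
    by (intro tuple.subspace_add[OF U] tuple.subspace_scale[OF U] b u)+
  define w where "w X = (\<lambda>i. if i \<in> S then (b + tuple_scale s (u1 X)) i else tuple_scale s (u2 X) i)" for X
  have "\<exists>m. (\<forall>i. m i \<noteq> 0) \<and> twist m (w X) \<in> U" if X: "X \<in> range \<kappa>" for X
  proof -
    obtain j where "X = \<kappa> j" using X by auto
    then have "irredundant U S (b + tuple_scale s (u1 X))" using irredundant by simp
    from merge_irredundant[OF inf S mem(1) this mem(2)] show ?thesis unfolding w_def by metis
  qed
  then obtain m where m: "\<And>X i. X \<in> range \<kappa> \<Longrightarrow> m X i \<noteq> 0" "\<And>X. X \<in> range \<kappa> \<Longrightarrow> twist (m X) (w X) \<in> U"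
    by metis
  define u' where "u' X = (if X \<in> range \<kappa> then twist (m X) (w X) else 0)" for X
  have "u' X \<in> U" for X
    using m(2)[of X] tuple.subspace_0[OF U] by (cases "X \<in> range \<kappa>") (simp_all add: u'_def)
  then have "degenerate U N (\<lambda>i. u' (\<kappa> i) i)" by (rule coarse)
  also have "(\<lambda>i. u' (\<kappa> i) i) = twist (\<lambda>i. m (\<kappa> i) i) (bS + tuple_scale s ?a)"
    by (auto simp: u'_def twist_def w_def bS_def fun_eq_iff)
  finally have "degenerate U N (bS + tuple_scale s ?a)"
    by (rule degenerate_untwist) (use m in auto)
  then have "degenerate U N (?a + tuple_scale (inverse s) bS)" using s0 by (rule degenerate_line_swap)
  then have "inverse (inverse s) \<in> bad" unfolding bad_def by blast
  with s show False by simp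
qed

text \<open>Start from the trivial partition, where a glued tuple is an element of \<open>U\<close> and no rescaling is
  needed, and refine it by one \<open>S j\<close> after the other. A block is labelled by the set of all \<open>j\<close> for
  which it lies in \<open>S j\<close>.\<close>

lemma degenerate_common_refinement:
  assumes inf: "infinite (UNIV :: 'c set)" and N: "finite N" "N \<noteq> {}"
    and supp: "\<And>u i. u \<in> U \<Longrightarrow> i \<notin> N \<Longrightarrow> u i = 0"
    and J: "finite J" and S: "\<And>j. j \<in> J \<Longrightarrow> finite (S j)" "\<And>j. j \<in> J \<Longrightarrow> everywhere_degenerate U (S j)"
    and irredundant: "\<And>j. j \<in> J \<Longrightarrow> \<exists>b\<in>U. irredundant U (S j) b"
    and u: "\<And>X. u X \<in> U"
  shows "degenerate U N (\<lambda>i. u {j\<in>J. i \<in> S j} i)"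
  using J S irredundant u
proof (induction J arbitrary: u rule: finite_induct)
  case empty
  have "twist (\<lambda>i. if i \<in> N then 1 else 0) (u {}) = u {}"
    using supp[OF empty.prems(4)] by (auto simp: twist_def fun_eq_iff)
  then show ?case unfolding degenerate_def
    using N(2) empty.prems(4)[of "{}"] by (intro exI[of _ "\<lambda>i. if i \<in> N then 1 else 0"]) auto
next
  case (insert j J)
  obtain b where b: "b \<in> U" "irredundant U (S j) b" using insert.prems(3) by blast
  have fin: "finite (range (\<lambda>i. {j\<in>J. i \<in> S j}))"
    by (rule finite_subset[of _ "Pow J"]) (use insert.hyps in auto)
  have "degenerate U N (\<lambda>i. if i \<in> S j then u (insert j {j\<in>J. i \<in> S j}) i else u {j\<in>J. i \<in> S j} i)"
  proof (rule degenerate_refine[OF inf N(1) fin _ _ _ b])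
    show "degenerate U N (\<lambda>i. u' {j\<in>J. i \<in> S j} i)" if "\<And>X. u' X \<in> U" for u'
      by (rule insert.IH) (use insert.prems that in auto)
  qed (use insert.prems in auto)
  also have "(\<lambda>i. if i \<in> S j then u (insert j {j\<in>J. i \<in> S j}) i else u {j\<in>J. i \<in> S j} i)
      = (\<lambda>i. u {j'\<in>insert j J. i \<in> S j'} i)"
  proof
    fix i
    have "{j'\<in>insert j J. i \<in> S j'} = (if i \<in> S j then insert j {j\<in>J. i \<in> S j} else {j\<in>J. i \<in> S j})"
      by auto
    then show "(if i \<in> S j then u (insert j {j\<in>J. i \<in> S j}) i else u {j\<in>J. i \<in> S j} i)
        = u {j'\<in>insert j J. i \<in> S j'} i" by simp
  qed
  finally show ?case .
qed

end

section \<open>Tuples of conjugates\<close>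

lemma infinite_UNIV_fls: "infinite (UNIV :: 'a::field fls set)"
proof
  assume fin: "finite (UNIV :: 'a fls set)"
  have "inj (\<lambda>m::nat. fls_X_intpow (int m) :: 'a fls)"
  proof (rule injI)
    fix m m' :: nat assume "(fls_X_intpow (int m) :: 'a fls) = fls_X_intpow (int m')"
    then have "fls_nth (fls_X_intpow (int m) :: 'a fls) (int m) = fls_nth (fls_X_intpow (int m')) (int m)" by simp
    then show "m = m'" by (simp split: if_splits)
  qed
  then have "finite (UNIV :: nat set)" using fin finite_imageD finite_subset subset_UNIV by metis
  then show False by simp
qed

context finite_field_extension
begin

lemma of_nat_q_fls: "of_nat q = (0 :: 'a fls)"
  by (simp add: fls_of_nat of_nat_q)

lemmas frob_add_fls = frobenius_power_add[OF q(2) of_nat_q_fls]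
text \<open>Laurent series provide an infinite field that contains \<open>'a\<close>. The multiplication of \<open>u\<close>
  by \<open>c\<close> acts on the tuple of conjugates by the rescaling \<open>i \<mapsto> c ^ (q ^ i)\<close>.\<close>

definition conjugates :: "'a ^ 'k \<Rightarrow> nat \<Rightarrow> 'a fls ^ 'k"
  where "conjugates u = (\<lambda>i. if i < n then (\<chi> l. fls_const ((u $ l) ^ (q ^ i))) else 0)"

lemma conjugates_add: "conjugates (u + v) = conjugates u + conjugates v"
  by (auto simp: conjugates_def fun_eq_iff vec_eq_iff frob_add fls_plus_const)

lemma conjugates_0: "conjugates 0 = 0"
  using q_ge_2 by (auto simp: conjugates_def fun_eq_iff vec_eq_iff)

lemma conjugates_scale: "conjugates (c *s u) = twist (\<lambda>i. fls_const (c ^ (q ^ i))) (conjugates u)"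
  by (auto simp: conjugates_def twist_def fun_eq_iff vec_eq_iff power_mult_distrib)

lemma conjugates_scale_F: "c \<in> F \<Longrightarrow> conjugates (c *s u) = tuple_scale (fls_const c) (conjugates u)"
  by (simp add: conjugates_scale F_frob twist_def fun_eq_iff)

lemma conjugates_sum: "conjugates (\<Sum>x\<in>A. f x) = (\<Sum>x\<in>A. conjugates (f x))"
  by (induction A rule: infinite_finite_induct) (simp_all add: conjugates_add conjugates_0)

lemma conjugates_eq_0: "conjugates u = 0 \<longleftrightarrow> u = 0"
proof
  assume "conjugates u = 0"
  then have "conjugates u 0 = 0" by simp
  then show "u = 0" using n_pos by (simp add: conjugates_def vec_eq_iff)
qed (simp add: conjugates_0)

definition conjugate_span :: "('a ^ 'k) set \<Rightarrow> (nat \<Rightarrow> 'a fls ^ 'k) set"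
  where "conjugate_span U = tuple.span (conjugates ` U)"

lemma subspace_conjugate_span: "tuple.subspace (conjugate_span U)"
  unfolding conjugate_span_def by (rule tuple.subspace_span)

lemma conjugates_in_span: "u \<in> U \<Longrightarrow> conjugates u \<in> conjugate_span U"
  unfolding conjugate_span_def by (rule tuple.span_base) simp

lemma tuple_space_conjugate_span: "tuple_space (conjugate_span U)"
  by unfold_locales (rule subspace_conjugate_span)

lemma conjugate_span_outside:
  assumes "v \<in> conjugate_span U" "i \<notin> {..<n}"
  shows "v i = 0"
proof -
  have "conjugate_span U \<subseteq> {v. v i = 0}" unfolding conjugate_span_def
    by (rule tuple.span_minimal) (use assms(2) in \<open>auto simp: conjugates_def tuple.subspace_def\<close>)
  with assms(1) show ?thesis by auto
qed

text \<open>For \<open>j + e\<close> divisible by \<open>n\<close> this semilinear map fixes the conjugates of every vector; so it preserves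
  spaces spanned by such tuples, and it moves supports by \<open>j\<close>.\<close>

definition frob_shift :: "nat \<Rightarrow> nat \<Rightarrow> (nat \<Rightarrow> 'a fls ^ 'k) \<Rightarrow> nat \<Rightarrow> 'a fls ^ 'k"
  where "frob_shift j e v = (\<lambda>i. if i < n then (\<chi> l. (v ((i + j) mod n) $ l) ^ (q ^ e)) else 0)"

lemma frob_shift_conjugates:
  assumes "n dvd j + e"
  shows "frob_shift j e (conjugates u) = conjugates u"
proof
  fix i
  have "((u $ l) ^ (q ^ ((i + j) mod n))) ^ (q ^ e) = (u $ l) ^ (q ^ i)" if "i < n" for l
  proof -
    have "((i + j) mod n + e) mod n = (i + (j + e)) mod n" by (simp add: mod_add_left_eq add.assoc)
    also have "\<dots> = i mod n" using assms by (metis add_0_right dvd_imp_mod_0 mod_add_right_eq)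
    finally have "((i + j) mod n + e) mod n = i" using that by simp
    then show ?thesis by (metis power_q_power frob_mod)
  qed
  then show "frob_shift j e (conjugates u) i = conjugates u i"
    using n_pos by (simp add: frob_shift_def conjugates_def vec_eq_iff flip: fls_const_power)
qed

lemma frob_shift_add: "frob_shift j e (v + w) = frob_shift j e v + frob_shift j e w"
  by (auto simp: frob_shift_def fun_eq_iff vec_eq_iff frob_add_fls)

lemma frob_shift_0: "frob_shift j e 0 = 0"
  using q_ge_2 by (auto simp: frob_shift_def fun_eq_iff vec_eq_iff)

lemma frob_shift_scale: "frob_shift j e (tuple_scale c v) = tuple_scale (c ^ (q ^ e)) (frob_shift j e v)"
  by (auto simp: frob_shift_def fun_eq_iff vec_eq_iff power_mult_distrib)

lemma frob_shift_sum: "frob_shift j e (\<Sum>x\<in>A. f x) = (\<Sum>x\<in>A. frob_shift j e (f x))"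
proof (induction A rule: infinite_finite_induct)
  case (infinite A)
  then show ?case by (simp only: sum.infinite frob_shift_0 not_False_eq_True)
next
  case empty
  show ?case by (simp only: sum.empty frob_shift_0)
next
  case (insert x A)
  then show ?case by (simp only: sum.insert frob_shift_add not_False_eq_True)
qed

lemma frob_shift_conjugate_span:
  assumes je: "n dvd j + e" and v: "v \<in> conjugate_span U"
  shows "frob_shift j e v \<in> conjugate_span U"
proof -
  have "conjugate_span U \<subseteq> {v. frob_shift j e v \<in> conjugate_span U}"
    unfolding conjugate_span_def
  proof (rule tuple.span_minimal)
    show "conjugates ` U \<subseteq> {v. frob_shift j e v \<in> tuple.span (conjugates ` U)}"
      by (auto simp: frob_shift_conjugates[OF je] intro: tuple.span_base)
    show "tuple.subspace {v. frob_shift j e v \<in> tuple.span (conjugates ` U)}"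
      by (auto simp: tuple.subspace_def frob_shift_add frob_shift_0 frob_shift_scale
          intro: tuple.span_zero tuple.span_add tuple.span_scale)
  qed
  with v show ?thesis by auto
qed

lemma degenerate_rotate:
  assumes deg: "degenerate (conjugate_span U) S (conjugates u)" and S: "S \<subseteq> {..<n}"
  shows "degenerate (conjugate_span U) {i. i < n \<and> (i + j) mod n \<in> S} (conjugates u)"
proof -
  define e where "e = (n - 1) * j"
  have "j + e = n * j" using n_pos by (cases n) (simp_all add: e_def)
  then have je: "n dvd j + e" by simp
  obtain l where l: "\<forall>i. i \<notin> S \<longrightarrow> l i = 0" "\<exists>i. l i \<noteq> 0" "twist l (conjugates u) \<in> conjugate_span U"
    using deg unfolding degenerate_def by blast
  define l' where "l' i = (if i < n then l ((i + j) mod n) ^ (q ^ e) else 0)" for i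
  have "twist l' (conjugates u) = twist l' (frob_shift j e (conjugates u))"
    by (simp add: frob_shift_conjugates[OF je])
  also have "\<dots> = frob_shift j e (twist l (conjugates u))"
    by (auto simp: twist_def frob_shift_def l'_def fun_eq_iff vec_eq_iff power_mult_distrib)
  finally have "twist l' (conjugates u) \<in> conjugate_span U"
    using frob_shift_conjugate_span[OF je l(3)] by simp
  moreover have "l' i = 0" if "i \<notin> {i. i < n \<and> (i + j) mod n \<in> S}" for i
    using that l(1) q_ge_2 by (auto simp: l'_def)
  moreover have "\<exists>i. l' i \<noteq> 0"
  proof -
    obtain i0 where i0: "l i0 \<noteq> 0" using l(2) by blast
    then have "i0 < n" using l(1) S by auto
    have "((i0 + e) mod n + j) mod n = (i0 + n * j) mod n"
      by (metis \<open>j + e = n * j\<close> add.assoc add.commute mod_add_left_eq)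
    also have "\<dots> = i0" using \<open>i0 < n\<close> by simp
    finally have "l' ((i0 + e) mod n) = l i0 ^ (q ^ e)" using n_pos by (simp add: l'_def)
    with i0 show ?thesis by (intro exI[of _ "(i0 + e) mod n"]) simp
  qed
  ultimately show ?thesis unfolding degenerate_def by blast
qed

text \<open>By perturbation the coefficients of an element of the span can be changed, one after the other,
  to elements of \<open>F\<close>: each of these changes has \<open>q > card S\<close> candidates.\<close>

lemma everywhere_degenerate_if_rational:
  assumes FU: "subspace_over F U" and S: "finite S" "card S < q"
    and rational: "\<And>u. u \<in> U \<Longrightarrow> degenerate (conjugate_span U) S (conjugates u)"
  shows "everywhere_degenerate (conjugate_span U) S"
proof -
  interpret tuple_space "conjugate_span U" by (rule tuple_space_conjugate_span)
  have main: "degenerate (conjugate_span U) S (conjugates v + (\<Sum>a\<in>J. tuple_scale (r a) a))"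
    if "finite J" "J \<subseteq> conjugates ` U" "v \<in> U" for J v r
    using that
  proof (induction J arbitrary: v rule: finite_induct)
    case empty
    then show ?case using rational by simp
  next
    case (insert a J)
    obtain u where u: "u \<in> U" "a = conjugates u" using insert.prems by auto
    let ?x = "conjugates v + (\<Sum>a\<in>insert a J. tuple_scale (r a) a)"
    show ?case
    proof (rule ccontr)
      assume nd: "\<not> degenerate (conjugate_span U) S ?x"
      let ?bad = "{t. degenerate (conjugate_span U) S (?x + tuple_scale t a)}"
      have "(\<lambda>c. fls_const c - r a) ` F \<subseteq> ?bad"
      proof clarify
        fix c assume c: "c \<in> F"
        have eq: "?x + tuple_scale (fls_const c - r a) a
            = conjugates (v + c *s u) + (\<Sum>a\<in>J. tuple_scale (r a) a)"
          using insert.hyps c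
          by (simp add: conjugates_add conjugates_scale_F u(2) tuple.scale_left_diff_distrib algebra_simps)
        show "degenerate (conjugate_span U) S (?x + tuple_scale (fls_const c - r a) a)"
          unfolding eq
        proof (rule insert.IH)
          show "v + c *s u \<in> U" using insert.prems(2) u(1) c by (intro subspace_overD[OF FU])
        qed (use insert.prems in simp)
      qed
      then have "card ((\<lambda>c. fls_const c - r a) ` F) \<le> card ?bad"
        by (intro card_mono degenerate_perturbation(1)[OF S(1) nd])
      also have "card ?bad \<le> card S" by (rule degenerate_perturbation(2)[OF S(1) nd])
      also have "card ((\<lambda>c. fls_const c - r a) ` F) = q"
        by (subst card_image) (auto simp: inj_on_def fls_eq_iff q(1) dest!: spec[of _ 0])
      finally show False using S(2) by simp
    qed
  qed
  show ?thesis unfolding everywhere_degenerate_def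
  proof
    fix a assume "a \<in> conjugate_span U"
    then obtain t r where "finite t" "t \<subseteq> conjugates ` U" "a = (\<Sum>x\<in>t. tuple_scale (r x) x)"
      unfolding conjugate_span_def tuple.span_explicit by auto
    with main[of t 0 r] subspace_overD(1)[OF FU] show "degenerate (conjugate_span U) S a"
      by (simp add: conjugates_0)
  qed
qed

text \<open>The polynomial \<open>X ^ q - X\<close> has \<open>q\<close> roots in \<open>F\<close> already.\<close>

lemma frob_fixed_fls:
  fixes z :: "'a fls"
  assumes "z ^ q = z"
  shows "z \<in> fls_const ` F"
proof -
  define p :: "'a fls poly" where "p = monom 1 q - monom 1 1"
  have "coeff p q = 1" using q_ge_2 by (simp add: p_def)
  then have p0: "p \<noteq> 0" by auto
  have "degree p \<le> q" unfolding p_def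
    by (rule degree_diff_le) (use q_ge_2 in \<open>auto intro: order.trans[OF degree_monom_le]\<close>)
  with card_poly_roots_bound[OF p0] have le: "card {x. poly p x = 0} \<le> q" by simp
  have sub: "fls_const ` F \<subseteq> {x. poly p x = 0}"
    by (auto simp: p_def poly_monom mem_F_iff simp flip: fls_const_power)
  have "card (fls_const ` F) = q"
    by (subst card_image) (auto simp: inj_on_def fls_eq_iff q(1) dest!: spec[of _ 0])
  with sub le have "fls_const ` F = {x. poly p x = 0}"
    using poly_roots_finite[OF p0] by (intro card_seteq) auto
  then show ?thesis using assms by (auto simp: p_def poly_monom)
qed

text \<open>In a shortest relation, normalised to have a coefficient \<open>1\<close>, apply the Frobenius shift and
  subtract: the result is shorter, so all coefficients are fixed and belong to \<open>F\<close>. Then it is a relation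
  between the vectors themselves.\<close>

lemma conjugates_independent:
  assumes B: "independent_over F B" and T: "finite T" "T \<subseteq> B"
    and rel: "(\<Sum>x\<in>T. tuple_scale (y x) (conjugates x)) = 0"
  shows "\<forall>x\<in>T. y x = 0"
  using T rel
proof (induction T arbitrary: y rule: finite_induct)
  case (insert x0 T)
  have TB: "T \<subseteq> B" using insert.prems(1) by simp
  have y0: "y x0 = 0"
  proof (rule ccontr)
    assume y0: "y x0 \<noteq> 0"
    define z where "z x = y x / y x0" for x
    have z0: "z x0 = 1" using y0 by (simp add: z_def)
    have "(\<Sum>x\<in>insert x0 T. tuple_scale (z x) (conjugates x))
        = tuple_scale (inverse (y x0)) (\<Sum>x\<in>insert x0 T. tuple_scale (y x) (conjugates x))"
      unfolding tuple.scale_sum_right by (rule sum.cong) (simp_all add: z_def field_simps)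
    then have z: "(\<Sum>x\<in>insert x0 T. tuple_scale (z x) (conjugates x)) = 0"
      unfolding insert.prems(2) by simp
    have "n dvd (n - 1) + 1" using n_pos by simp
    note shift = frob_shift_conjugates[OF this]
    have "frob_shift (n - 1) 1 (\<Sum>x\<in>insert x0 T. tuple_scale (z x) (conjugates x)) = 0"
      unfolding z by (rule frob_shift_0)
    then have zq: "(\<Sum>x\<in>insert x0 T. tuple_scale (z x ^ q) (conjugates x)) = 0"
      unfolding frob_shift_sum frob_shift_scale shift by simp
    have "(\<Sum>x\<in>T. tuple_scale (z x ^ q - z x) (conjugates x)) = 0"
      using z zq insert.hyps z0
      by (simp add: tuple.scale_left_diff_distrib sum_subtractf add_eq_0_iff)
    with TB have "\<forall>x\<in>T. z x ^ q - z x = 0" by (rule insert.IH)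
    then have "z x ^ q = z x" if "x \<in> insert x0 T" for x using that z0 by auto
    then have "\<forall>x\<in>insert x0 T. \<exists>c\<in>F. z x = fls_const c" using frob_fixed_fls by blast
    then obtain c where c: "\<And>x. x \<in> insert x0 T \<Longrightarrow> c x \<in> F" "\<And>x. x \<in> insert x0 T \<Longrightarrow> z x = fls_const (c x)"
      by metis
    have "conjugates (\<Sum>x\<in>insert x0 T. c x *s x) = (\<Sum>x\<in>insert x0 T. tuple_scale (z x) (conjugates x))"
      unfolding conjugates_sum by (rule sum.cong) (use c in \<open>simp_all add: conjugates_scale_F\<close>)
    then have "(\<Sum>x\<in>insert x0 T. c x *s x) = 0" unfolding z conjugates_eq_0 .
    moreover have "finite (insert x0 T)" "insert x0 T \<subseteq> B" "\<forall>x\<in>insert x0 T. c x \<in> F"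
      using insert.hyps insert.prems c by auto
    ultimately have "c x0 = 0"
      using B[unfolded independent_over_def, THEN spec, THEN spec, of "insert x0 T" c] by blast
    with c(2)[of x0] z0 show False by simp
  qed
  moreover have "\<forall>x\<in>T. y x = 0"
  proof (rule insert.IH[OF TB])
    show "(\<Sum>x\<in>T. tuple_scale (y x) (conjugates x)) = 0"
      using insert.prems(2) unfolding sum.insert[OF insert.hyps] y0 tuple.scale_zero_left add_0_left .
  qed
  ultimately show ?case by simp
qed simp

end

context finite_field_extension
begin

section \<open>Enlarging the field without new directions\<close>

lemma conjugate_span_basis:
  assumes B: "finite B" "span_over F B = U" and v: "v \<in> conjugate_span U"
  obtains y where "v = (\<Sum>b\<in>B. tuple_scale (y b) (conjugates b))"
proof -
  define G where "G y = (\<Sum>b\<in>B. tuple_scale (y b) (conjugates b))" for y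
  have "conjugate_span U \<subseteq> range G" unfolding conjugate_span_def
  proof (rule tuple.span_minimal)
    show "conjugates ` U \<subseteq> range G"
    proof
      fix w assume "w \<in> conjugates ` U"
      then obtain u where u: "u \<in> U" "w = conjugates u" by blast
      then obtain c where c: "u = (\<Sum>b\<in>B. c b *s b)" "\<forall>b\<in>B. c b \<in> F"
        using B span_over_finite[OF F B(1)] by auto
      have "w = G (\<lambda>b. fls_const (c b))"
        unfolding u(2) c(1) conjugates_sum G_def
        by (rule sum.cong) (use c(2) in \<open>simp_all add: conjugates_scale_F\<close>)
      then show "w \<in> range G" by (metis rangeI)
    qed
    show "tuple.subspace (range G)"
    proof (rule tuple.subspaceI)
      have "0 = G (\<lambda>_. 0)" by (simp only: G_def tuple.scale_zero_left sum.neutral_const)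
      then show "0 \<in> range G" by (metis rangeI)
    next
      fix v w assume "v \<in> range G" "w \<in> range G"
      then obtain y z where "v = G y" "w = G z" by blast
      then have "v + w = G (\<lambda>b. y b + z b)"
        by (simp only: G_def tuple.scale_left_distrib sum.distrib)
      then show "v + w \<in> range G" by (metis rangeI)
    next
      fix c v assume "v \<in> range G"
      then obtain y where "v = G y" by blast
      then have "tuple_scale c v = G (\<lambda>b. c * y b)"
        by (simp only: G_def tuple.scale_sum_right tuple.scale_scale)
      then show "tuple_scale c v \<in> range G" by (metis rangeI)
    qed
  qed
  with v obtain y where "v = G y" by blast
  then show ?thesis unfolding G_def by (rule that)
qed

text \<open>If no nonzero multiple of \<open>a\<close> is in \<open>U\<close>, then the multiples \<open>\<beta> a\<close>, for \<open>\<beta>\<close> in an \<open>F\<close>-basis of the field,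
  together with an \<open>F\<close>-basis of \<open>U\<close> are independent over \<open>F\<close>, and so are their tuples of conjugates. But
  each rescaling of the conjugates of \<open>a\<close> is a combination of the conjugates of the \<open>\<beta> a\<close>, by counting
  dimensions.\<close>

lemma rational_multiple_if_degenerate:
  fixes U :: "('a ^ 'k::finite) set"
  assumes U: "subspace_over F U" and deg: "degenerate (conjugate_span U) {..<n} (conjugates a)"
  shows "\<exists>c. c \<noteq> 0 \<and> c *s a \<in> U"
proof (rule ccontr)
  assume "\<nexists>c. c \<noteq> 0 \<and> c *s a \<in> U"
  then have no: "c = 0" if "c *s a \<in> U" for c using that by blast
  have a0: "a \<noteq> 0" using no[of 1] subspace_overD(1)[OF U] by auto
  obtain BU where BU: "BU \<subseteq> U" "independent_over F BU" "span_over F BU = U"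
    by (rule ex_basis_over[OF F U])
  obtain Ba :: "('a ^ 1) set" where Ba: "independent_over F Ba" "span_over F Ba = UNIV"
    using ex_basis_over[OF F, of "UNIV :: ('a ^ 1) set"] by (auto simp: subspace_over_def)
  have "q ^ n = q ^ card Ba" using card_span_over[OF F _ Ba(1)] Ba(2) Q q by simp
  then have card_Ba: "card Ba = n" using q_ge_2 by simp
  define g where "g \<beta> = (\<beta> $ 1) *s a" for \<beta> :: "'a ^ 1"
  have inj: "inj_on g Ba"
  proof (rule inj_onI)
    fix \<beta> \<beta>' assume "g \<beta> = g \<beta>'"
    with a0 have "\<beta> $ 1 = \<beta>' $ 1" by (simp add: g_def)
    then show "\<beta> = \<beta>'" by (simp add: vec_eq_iff forall_1)
  qed
  define A where "A = g ` Ba"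
  have disj: "A \<inter> BU = {}"
  proof (rule ccontr)
    assume "A \<inter> BU \<noteq> {}"
    then obtain \<beta> where \<beta>: "\<beta> \<in> Ba" "g \<beta> \<in> BU" by (auto simp: A_def)
    then have "\<beta> $ 1 = 0" using no[of "\<beta> $ 1"] BU(1) by (auto simp: g_def)
    then have "\<beta> = 0" by (simp add: vec_eq_iff forall_1)
    with \<beta> zero_notin_independent_over[OF F Ba(1)] show False by simp
  qed
  have indep: "independent_over F (A \<union> BU)"
  proof (rule independent_overI[OF F])
    fix c assume c: "\<forall>b\<in>A \<union> BU. c b \<in> F" and sum0: "(\<Sum>b\<in>A \<union> BU. c b *s b) = 0"
    define \<mu> where "\<mu> = (\<Sum>\<beta>\<in>Ba. c (g \<beta>) * \<beta> $ 1)"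
    have "(\<Sum>b\<in>A. c b *s b) = \<mu> *s a"
      unfolding A_def \<mu>_def sum.reindex[OF inj] by (simp add: g_def vec.scale_sum_left)
    with sum0 have sum0': "\<mu> *s a + (\<Sum>b\<in>BU. c b *s b) = 0"
      by (simp add: sum.union_disjoint[OF _ _ disj])
    have "(\<Sum>b\<in>BU. - c b *s b) \<in> U"
      using c BU(1) by (intro subspace_over_sum[OF U] subspace_overD(3)[OF U]) (auto intro: subfield_closed(5)[OF F])
    also have "(\<Sum>b\<in>BU. - c b *s b) = \<mu> *s a"
      using sum0' by (simp add: sum_negf eq_neg_iff_add_eq_0 neg_eq_iff_add_eq_0 add.commute)
    finally have "\<mu> = 0" by (rule no)
    then have "(\<Sum>\<beta>\<in>Ba. c (g \<beta>) *s \<beta>) = 0" by (simp add: vec_eq_iff forall_1 \<mu>_def)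
    then have "c (g \<beta>) = 0" if "\<beta> \<in> Ba" for \<beta>
      using independent_overD[OF Ba(1), of "\<lambda>\<beta>. c (g \<beta>)"] c that by (auto simp: A_def)
    moreover have "c b = 0" if "b \<in> BU" for b
      using independent_overD[OF BU(2), of c b] sum0' \<open>\<mu> = 0\<close> c that by auto
    ultimately show "\<forall>b\<in>A \<union> BU. c b = 0" by (auto simp: A_def)
  qed simp
  obtain l where l: "\<forall>i. i \<notin> {..<n} \<longrightarrow> l i = 0" "\<exists>i. l i \<noteq> 0" "twist l (conjugates a) \<in> conjugate_span U"
    using deg unfolding degenerate_def by blast
  define M where "M i t = (case t of None \<Rightarrow> l i | Some \<beta> \<Rightarrow> fls_const ((\<beta> $ 1) ^ (q ^ i)))" for i and t :: "('a ^ 1) option"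
  have "card {..<n} < card (insert None (Some ` Ba))"
    using card_Ba by (simp add: card_image)
  then obtain z where z: "\<exists>t\<in>insert None (Some ` Ba). z t \<noteq> 0"
    "\<forall>i\<in>{..<n}. (\<Sum>t\<in>insert None (Some ` Ba). z t * M i t) = 0"
    using ex_nontrivial_solution[of "{..<n}" "insert None (Some ` Ba)" M] by auto
  have row: "z None * l i + (\<Sum>\<beta>\<in>Ba. z (Some \<beta>) * fls_const ((\<beta> $ 1) ^ (q ^ i))) = 0" if "i < n" for i
    using z(2) that by (simp add: sum.reindex M_def)
  have comb: "(\<Sum>\<beta>\<in>Ba. tuple_scale (z (Some \<beta>)) (conjugates (g \<beta>))) = tuple_scale (- z None) (twist l (conjugates a))"
  proof
    fix i
    have "(\<Sum>\<beta>\<in>Ba. tuple_scale (z (Some \<beta>)) (conjugates (g \<beta>))) i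
        = (\<Sum>\<beta>\<in>Ba. z (Some \<beta>) * fls_const ((\<beta> $ 1) ^ (q ^ i))) *s conjugates a i"
      unfolding sum_fun_apply vec.scale_sum_left
      by (rule sum.cong) (simp_all add: g_def conjugates_scale twist_def)
    also have "\<dots> = (- z None * l i) *s conjugates a i"
    proof (cases "i < n")
      case True
      then have "(\<Sum>\<beta>\<in>Ba. z (Some \<beta>) * fls_const ((\<beta> $ 1) ^ (q ^ i))) = - z None * l i"
        using row[OF True] by (simp add: eq_neg_iff_add_eq_0 add.commute)
      then show ?thesis by simp
    qed (simp add: conjugates_def)
    finally show "(\<Sum>\<beta>\<in>Ba. tuple_scale (z (Some \<beta>)) (conjugates (g \<beta>))) i
        = tuple_scale (- z None) (twist l (conjugates a)) i" by (simp add: twist_def)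
  qed
  have "tuple_scale (- z None) (twist l (conjugates a)) \<in> conjugate_span U"
    by (rule tuple.subspace_scale[OF subspace_conjugate_span l(3)])
  then obtain y where y: "tuple_scale (- z None) (twist l (conjugates a)) = (\<Sum>b\<in>BU. tuple_scale (y b) (conjugates b))"
    by (rule conjugate_span_basis[OF finite BU(3)])
  define w where "w x = (if x \<in> A then z (Some (inv_into Ba g x)) else - y x)" for x
  have wA: "w (g \<beta>) = z (Some \<beta>)" if "\<beta> \<in> Ba" for \<beta>
    using that by (simp add: w_def A_def inv_into_f_f[OF inj])
  have wB: "w b = - y b" if "b \<in> BU" for b using that disj by (auto simp: w_def)
  have "(\<Sum>x\<in>A \<union> BU. tuple_scale (w x) (conjugates x))
      = (\<Sum>x\<in>A. tuple_scale (w x) (conjugates x)) + (\<Sum>x\<in>BU. tuple_scale (w x) (conjugates x))"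
    by (rule sum.union_disjoint[OF _ _ disj]) simp_all
  also have "(\<Sum>x\<in>A. tuple_scale (w x) (conjugates x)) = (\<Sum>\<beta>\<in>Ba. tuple_scale (z (Some \<beta>)) (conjugates (g \<beta>)))"
    unfolding A_def sum.reindex[OF inj] o_def by (rule sum.cong) (simp_all only: wA refl)
  also have "(\<Sum>x\<in>BU. tuple_scale (w x) (conjugates x)) = - (\<Sum>b\<in>BU. tuple_scale (y b) (conjugates b))"
    unfolding sum_negf[symmetric] by (rule sum.cong) (simp_all only: wB refl tuple.scale_minus_left)
  finally have "(\<Sum>x\<in>A \<union> BU. tuple_scale (w x) (conjugates x)) = 0"
    unfolding comb y by (simp only: add.right_inverse)
  from conjugates_independent[OF indep finite subset_refl this]
  have w0: "w x = 0" if "x \<in> A \<union> BU" for x using that by blast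
  have z0: "z (Some \<beta>) = 0" if "\<beta> \<in> Ba" for \<beta>
    using w0[of "g \<beta>"] wA[OF that] that by (simp add: A_def)
  with z(1) have "z None \<noteq> 0" by auto
  moreover have "z None * l i = 0" if "i < n" for i using row[OF that] z0 by simp
  ultimately have "l i = 0" for i using l(1) by (cases "i < n") auto
  with l(2) show False by blast
qed

text \<open>If \<open>c \<notin> F\<close> and \<open>c u \<in> U\<close>, then the conjugates of \<open>c u\<close> minus \<open>c\<close> times the conjugates of \<open>u\<close> are the
  rescaling of the latter by \<open>c ^ (q ^ i) - c\<close>, which vanishes for \<open>i = 0\<close> and does not for \<open>i = 1\<close>.
  The bound \<open>n \<le> q\<close> is what extends this from \<open>U\<close> to the span.\<close>

lemma everywhere_degenerate_initial:
  fixes U :: "('a ^ 'k::finite) set"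
  assumes U: "subspace_over F U" and n: "n \<ge> 2" "n \<le> q"
    and weight: "\<And>u. u \<in> U \<Longrightarrow> u \<noteq> 0 \<Longrightarrow> \<exists>c. c \<notin> F \<and> c *s u \<in> U"
  shows "everywhere_degenerate (conjugate_span U) {1..<n}"
proof (rule everywhere_degenerate_if_rational[OF U])
  fix u assume u: "u \<in> U"
  show "degenerate (conjugate_span U) {1..<n} (conjugates u)"
  proof (cases "u = 0")
    case True
    have "twist (\<lambda>i. if i = 1 then 1 else 0) (conjugates u) = 0"
      by (simp add: True conjugates_0 twist_def fun_eq_iff)
    then have "twist (\<lambda>i. if i = 1 then 1 else 0) (conjugates u) \<in> conjugate_span U"
      using tuple.subspace_0[OF subspace_conjugate_span] by simp
    then show ?thesis unfolding degenerate_def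
      using n by (intro exI[of _ "\<lambda>i. if i = 1 then 1 else 0"]) auto
  next
    case False
    then obtain c where c: "c \<notin> F" "c *s u \<in> U" using weight u by blast
    define l where "l i = (if i < n then fls_const (c ^ (q ^ i)) - fls_const c else 0)" for i
    have "conjugates (c *s u) - tuple_scale (fls_const c) (conjugates u) \<in> conjugate_span U"
      using c u by (intro tuple.subspace_diff[OF subspace_conjugate_span]
          tuple.subspace_scale[OF subspace_conjugate_span] conjugates_in_span)
    also have "conjugates (c *s u) - tuple_scale (fls_const c) (conjugates u) = twist l (conjugates u)"
      unfolding conjugates_scale
      by (auto simp: twist_def l_def fun_eq_iff vec.scale_left_diff_distrib conjugates_def)
    finally have "twist l (conjugates u) \<in> conjugate_span U" .
    moreover have "l i = 0" if "i \<notin> {1..<n}" for i using that by (cases i) (auto simp: l_def)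
    moreover have "l 1 \<noteq> 0" using c(1) n by (simp add: l_def mem_F_iff fls_eq_iff)
    ultimately show ?thesis unfolding degenerate_def by blast
  qed
qed (use n in auto)

text \<open>Let \<open>S\<close> be a smallest set of entries for which the span \<open>?V\<close> of the conjugates is everywhere
  degenerate. It is a proper nonempty subset of the integers modulo \<open>n\<close>, so its least period \<open>d\<close> is
  greater than \<open>1\<close>. Two entries not separated by any cyclic shift \<open>Sh j\<close> of \<open>S\<close> are congruent modulo \<open>d\<close>.
  Hence, for \<open>c ^ (q ^ d) = c\<close>, the conjugates of \<open>c u\<close> agree on each block of the partition generated by
  the shifts with a constant multiple of the conjugates of \<open>u\<close>, and so the tuple of a vector of
  \<open>span_over K U\<close> is glued from elements of \<open>?V\<close> along this partition.\<close>

theorem span_over_larger_subfield: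
  fixes U :: "('a ^ 'k::finite) set"
  assumes U: "subspace_over F U" and "U \<noteq> {0}" and nq: "n \<le> q"
    and weight: "\<And>u. u \<in> U \<Longrightarrow> u \<noteq> 0 \<Longrightarrow> \<exists>c. c \<notin> F \<and> c *s u \<in> U"
  obtains L where "is_subfield L" "F \<subset> L" "\<And>a. a \<in> span_over L U \<Longrightarrow> \<exists>c. c \<noteq> 0 \<and> c *s a \<in> U"
proof -
  let ?V = "conjugate_span U"
  interpret V: tuple_space ?V by (rule tuple_space_conjugate_span)
  have n2: "n \<ge> 2"
  proof (rule ccontr)
    assume "\<not> n \<ge> 2"
    with n_pos have "n = 1" by simp
    with Q q have "F = UNIV" by (intro card_subset_eq) auto
    moreover obtain u where "u \<in> U" "u \<noteq> 0" using \<open>U \<noteq> {0}\<close> subspace_overD(1)[OF U] by auto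
    ultimately show False using weight by blast
  qed
  let ?P = "\<lambda>S. S \<subseteq> {..<n} \<and> everywhere_degenerate ?V S"
  have P_init: "?P {1..<n}" using everywhere_degenerate_initial[OF U n2 nq weight] by auto
  define S where "S = arg_min card ?P"
  have PS: "?P S" and S_min: "\<And>T. ?P T \<Longrightarrow> card S \<le> card T"
    using arg_min_nat_lemma[of ?P "{1..<n}" card] P_init unfolding S_def by blast+
  have cardS: "card S < n" using S_min[OF P_init] n2 by simp
  have fS: "finite S" using PS finite_subset by blast
  have S_nonempty: "S \<noteq> {}"
  proof
    assume "S = {}"
    moreover have "degenerate ?V S 0"
      using PS tuple.subspace_0[OF subspace_conjugate_span[of U]] unfolding everywhere_degenerate_def by blast
    ultimately show False by (auto simp: degenerate_def)
  qed
  define Sh where "Sh j = {i. i < n \<and> (i + j) mod n \<in> S}" for j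
  have Sh_sub: "Sh j \<subseteq> {..<n}" and Sh_fin: "finite (Sh j)" for j by (auto simp: Sh_def)
  have Sh_card: "card (Sh j) \<le> card S" for j
  proof (rule card_inj_on_le[of "\<lambda>i. (i + j) mod n"])
    show "inj_on (\<lambda>i. (i + j) mod n) (Sh j)"
    proof (rule inj_onI)
      fix a b assume ab: "a \<in> Sh j" "b \<in> Sh j" "(a + j) mod n = (b + j) mod n"
      then have "[a + j = b + j] (mod n)" by (simp add: cong_def)
      then have "[a = b] (mod n)" by (simp only: cong_add_rcancel_nat)
      with ab show "a = b" by (simp add: cong_def Sh_def)
    qed
  qed (use fS in \<open>auto simp: Sh_def\<close>)
  have Sh_dom: "everywhere_degenerate ?V (Sh j)" for j
  proof (rule everywhere_degenerate_if_rational[OF U Sh_fin])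
    show "card (Sh j) < q" using Sh_card[of j] cardS nq by simp
    show "degenerate ?V (Sh j) (conjugates u)" if u: "u \<in> U" for u
    proof -
      have "degenerate ?V S (conjugates u)"
        using PS conjugates_in_span[OF u] unfolding everywhere_degenerate_def by blast
      then show ?thesis unfolding Sh_def by (rule degenerate_rotate) (use PS in blast)
    qed
  qed
  have Sh_nice: "\<exists>b\<in>?V. irredundant ?V (Sh j) b" for j
  proof -
    have "\<not> everywhere_degenerate ?V T" if T: "T \<subset> Sh j" for T
    proof
      assume "everywhere_degenerate ?V T"
      then have "?P T" using T Sh_sub by blast
      then have "card S \<le> card T" by (rule S_min)
      moreover have "card T < card (Sh j)" using T Sh_fin by (rule psubset_card_mono[rotated])
      ultimately show False using Sh_card[of j] by simp
    qed
    from V.ex_irredundant[OF infinite_UNIV_fls Sh_fin this] show ?thesis by blast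
  qed
  define R where "R = {h. \<forall>i. (i + h) mod n \<in> S \<longleftrightarrow> i mod n \<in> S}"
  have nR: "n \<in> R" by (simp add: R_def)
  have R_add: "a + b \<in> R" if "a \<in> R" "b \<in> R" for a b
    using that by (simp add: R_def add.assoc[symmetric])
  have R_sub: "a \<in> R" if ab: "a + b \<in> R" and b: "b \<in> R" for a b
  proof -
    have "(i + a) mod n \<in> S \<longleftrightarrow> i mod n \<in> S" for i
    proof -
      have "(i + a) mod n \<in> S \<longleftrightarrow> (i + a + b) mod n \<in> S" using b by (simp add: R_def)
      also have "\<dots> \<longleftrightarrow> i mod n \<in> S" using ab by (simp add: R_def add.assoc)
      finally show ?thesis .
    qed
    then show ?thesis by (simp add: R_def)
  qed
  obtain d where d: "d \<in> R" "d > 0" and R_dvd: "\<And>r. r \<in> R \<Longrightarrow> d dvd r"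
    by (rule nat_subgroup_generator[OF nR n_pos R_add R_sub]) blast+
  have dn: "d dvd n" by (rule R_dvd[OF nR])
  have "d \<noteq> 1"
  proof
    assume "d = 1"
    with d have step: "(i + 1) mod n \<in> S \<longleftrightarrow> i mod n \<in> S" for i by (simp add: R_def)
    have all: "i mod n \<in> S \<longleftrightarrow> 0 mod n \<in> S" for i
      by (induction i) (use step in simp_all)
    obtain s where "s \<in> S" using S_nonempty by blast
    moreover from this PS have "s < n" by blast
    ultimately have "0 mod n \<in> S" using all[of s] by simp
    then have "i \<in> S" if "i < n" for i using all[of i] that by simp
    then have "{..<n} \<subseteq> S" by blast
    with fS have "card {..<n} \<le> card S" by (rule card_mono)
    with cardS show False by simp
  qed
  with d have d1: "d > 1" by simp
  define K where "K = {x::'a. x ^ (q ^ d) = x}"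
  have K: "is_subfield K" "F \<subset> K" unfolding K_def using fixed_field[OF dn d1] by auto
  define lab where "lab i = {j\<in>{..<n}. i \<in> Sh j}" for i
  have lab_dvd: "d dvd i' - i" if "i \<le> i'" "i' < n" "lab i = lab i'" for i i'
  proof (rule R_dvd)
    have "(x + (i' - i)) mod n \<in> S \<longleftrightarrow> x mod n \<in> S" for x
    proof -
      define j where "j = (x + (n - i)) mod n"
      have j: "j < n" using n_pos by (simp add: j_def)
      then have "(i + j) mod n \<in> S \<longleftrightarrow> (i' + j) mod n \<in> S"
        using \<open>lab i = lab i'\<close> that unfolding lab_def Sh_def by auto
      moreover have "(i + j) mod n = x mod n"
      proof -
        have "(i + j) mod n = (i + (x + (n - i))) mod n" unfolding j_def by (simp add: mod_add_right_eq)
        also have "i + (x + (n - i)) = x + n" using that by simp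
        finally show ?thesis by simp
      qed
      moreover have "(i' + j) mod n = (x + (i' - i)) mod n"
      proof -
        have "(i' + j) mod n = (i' + (x + (n - i))) mod n" unfolding j_def by (simp add: mod_add_right_eq)
        also have "i' + (x + (n - i)) = x + (i' - i) + n" using that by simp
        finally show ?thesis by simp
      qed
      ultimately show ?thesis by simp
    qed
    then show "i' - i \<in> R" by (simp add: R_def)
  qed
  have K_frob: "c ^ (q ^ i) = c ^ (q ^ i')" if c: "c \<in> K" and i: "i < n" "i' < n" "lab i = lab i'" for c i i'
  proof -
    have K_dvd: "c ^ (q ^ b) = c" if "d dvd b" for b
      by (rule frob_fixed_multiple[of c d]) (use c that in \<open>simp_all add: K_def\<close>)
    have le: "c ^ (q ^ i) = c ^ (q ^ i')" if "i \<le> i'" "i' < n" "lab i = lab i'" for i i'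
    proof -
      have "c ^ (q ^ i') = (c ^ (q ^ (i' - i))) ^ (q ^ i)" using that by (simp add: power_q_power)
      then show ?thesis using K_dvd[OF lab_dvd[OF that]] by simp
    qed
    show ?thesis
    proof (cases "i \<le> i'")
      case True
      then show ?thesis by (rule le[OF _ i(2,3)])
    next
      case False
      then have "i' \<le> i" by simp
      then show ?thesis by (rule le[OF _ i(1) i(3)[symmetric], symmetric])
    qed
  qed
  show ?thesis
  proof (rule that[OF K])
    fix a assume "a \<in> span_over K U"
    then obtain c where c: "a = (\<Sum>x\<in>U. c x *s x)" "\<forall>x\<in>U. c x \<in> K"
      unfolding span_over_finite[OF K(1) finite] by blast
    define rep where "rep X = (SOME i. i < n \<and> lab i = X)" for X
    define v where "v X = (\<Sum>x\<in>U. tuple_scale (fls_const (c x ^ (q ^ rep X))) (conjugates x))" for X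
    have vV: "v X \<in> ?V" for X unfolding v_def
      by (intro tuple.subspace_sum[OF subspace_conjugate_span] tuple.subspace_scale[OF subspace_conjugate_span] conjugates_in_span)
    have "degenerate ?V {..<n} (\<lambda>i. v {j\<in>{..<n}. i \<in> Sh j} i)"
    proof (rule V.degenerate_common_refinement[OF infinite_UNIV_fls])
      show "{..<n} \<noteq> {}" using n_pos by auto
      show "w i = 0" if "w \<in> ?V" "i \<notin> {..<n}" for w i using that by (rule conjugate_span_outside)
    qed (use Sh_fin Sh_dom Sh_nice vV in simp_all)
    also have "(\<lambda>i. v {j\<in>{..<n}. i \<in> Sh j} i) = conjugates a"
    proof
      fix i
      show "v {j\<in>{..<n}. i \<in> Sh j} i = conjugates a i"
      proof (cases "i < n")
        case False
        then show ?thesis using conjugate_span_outside[OF vV] by (simp add: conjugates_def)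
      next
        case True
        have rep: "rep (lab i) < n \<and> lab (rep (lab i)) = lab i"
          unfolding rep_def by (rule someI[of _ i]) (simp add: True)
        have "v (lab i) i = (\<Sum>x\<in>U. fls_const (c x ^ (q ^ i)) *s conjugates x i)"
          unfolding v_def sum_fun_apply
        proof (rule sum.cong[OF refl])
          fix x assume "x \<in> U"
          then have "c x ^ (q ^ rep (lab i)) = c x ^ (q ^ i)" using c(2) rep True by (intro K_frob) auto
          then show "tuple_scale (fls_const (c x ^ (q ^ rep (lab i)))) (conjugates x) i
              = fls_const (c x ^ (q ^ i)) *s conjugates x i" by simp
        qed
        also have "\<dots> = conjugates a i"
          unfolding c(1) conjugates_sum sum_fun_apply by (simp add: conjugates_scale twist_def)
        finally show ?thesis by (simp add: lab_def)
      qed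
    qed
    finally have "degenerate ?V {..<n} (conjugates a)" .
    then show "\<exists>c. c \<noteq> 0 \<and> c *s a \<in> U" by (rule rational_multiple_if_degenerate[OF U])
  qed
qed

end

section \<open>The two parts of the theorem\<close>

lemma (in finite_field_extension) intermediate_extension:
  fixes K :: "'a set"
  assumes K: "is_subfield K" "F \<subseteq> K"
  obtains d where "d > 0" "d dvd n" "card K = q ^ d" "finite_field_extension K (q ^ d) (n div d)"
proof -
  define V where "V = {v :: 'a ^ 1. v $ 1 \<in> K}"
  have "subspace_over F V"
    using K by (auto simp: V_def subspace_over_def intro: subfield_closed[OF K(1)])
  then obtain d where d: "card V = q ^ d" using card_subspace_over[OF F] q by metis
  have "V = vec ` K"
  proof (intro equalityI subsetI)
    fix v assume "v \<in> V"
    then show "v \<in> vec ` K" by (intro image_eqI[of _ _ "v $ 1"]) (simp_all add: V_def vec_eq_iff forall_1)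
  qed (auto simp: V_def)
  moreover have "inj_on (vec :: 'a \<Rightarrow> 'a ^ 1) K" by (auto simp: inj_on_def vec_eq_iff)
  ultimately have cK: "card K = q ^ d" using d by (simp add: card_image)
  have "d > 0" using cK card_subfield_ge_2[OF K(1)] by (cases d) auto
  have "subspace_over K (UNIV :: ('a ^ 1) set)" by (simp add: subspace_over_def)
  then obtain e where "CARD('a ^ 1) = card K ^ e" using card_subspace_over[OF K(1)] by metis
  then have "q ^ n = q ^ (d * e)" using Q cK by (simp add: power_mult)
  then have n: "n = d * e" using q_ge_2 by simp
  have "finite_field_extension K (q ^ d) (n div d)"
  proof
    obtain p i where "prime p" "i > 0" "q = p ^ i" using q(2) by (auto simp: primepow_def)
    then show "primepow (q ^ d)"
      using \<open>d > 0\<close> unfolding primepow_def by (intro exI[of _ p] exI[of _ "i * d"]) (simp add: power_mult)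
    show "CARD('a) = (q ^ d) ^ (n div d)" using Q n \<open>d > 0\<close> by (simp add: power_mult)
  qed (use K cK in auto)
  with that[of d] \<open>d > 0\<close> n cK show ?thesis by simp
qed

text \<open>Otherwise all elements of \<open>U\<close> on the line would be multiples \<open>c u\<close> with \<open>c \<in> K\<close>.\<close>

lemma ex_multiplier_notin:
  fixes U :: "('a::{field,finite} ^ 'k::finite) set"
  assumes "card K < card (U \<inter> vec.span {u})"
  shows "\<exists>c. c \<notin> K \<and> c *s u \<in> U"
proof (rule ccontr)
  assume no: "\<nexists>c. c \<notin> K \<and> c *s u \<in> U"
  have "U \<inter> vec.span {u} \<subseteq> (\<lambda>c. c *s u) ` K"
  proof
    fix x assume x: "x \<in> U \<inter> vec.span {u}"
    then obtain c where c: "x = c *s u" by (auto simp: vec.span_singleton)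
    with no x have "c \<in> K" by blast
    with c show "x \<in> (\<lambda>c. c *s u) ` K" by blast
  qed
  then have "card (U \<inter> vec.span {u}) \<le> card ((\<lambda>c. c *s u) ` K)" by (intro card_mono) auto
  also have "\<dots> \<le> card K" by (rule card_image_le) simp
  finally show False using assms by simp
qed

lemma is_subfield_stabilizer:
  fixes U :: "('a::{field,finite} ^ 'k::finite) set"
  assumes F: "is_subfield F" and U: "subspace_over F U"
  shows "is_subfield {c. \<forall>u\<in>U. c *s u \<in> U}" (is "is_subfield ?K")
  unfolding is_subfield_def
proof (intro conjI ballI)
  show "0 \<in> ?K" "1 \<in> ?K" using subspace_overD(1)[OF U] by simp_all
next
  fix x y assume "x \<in> ?K" "y \<in> ?K"
  then show "x + y \<in> ?K" using subspace_overD(2)[OF U] by (simp add: vec.scale_left_distrib)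
next
  fix x y assume xy: "x \<in> ?K" "y \<in> ?K"
  have "(x * y) *s u \<in> U" if "u \<in> U" for u
  proof -
    have "y *s u \<in> U" using xy that by blast
    then have "x *s (y *s u) \<in> U" using xy by blast
    then show ?thesis by (simp only: vec.scale_scale)
  qed
  then show "x * y \<in> ?K" by simp
next
  fix x assume x: "x \<in> ?K"
  have "(- x) *s u \<in> U" if "u \<in> U" for u
    using subspace_over_diff[OF F U subspace_overD(1)[OF U], of "x *s u"] x that by simp
  then show "- x \<in> ?K" by simp
next
  fix x assume x: "x \<in> ?K"
  show "inverse x \<in> ?K"
  proof (cases "x = 0")
    case True
    then show ?thesis using subspace_overD(1)[OF U] by simp
  next
    case False
    have "inj_on (\<lambda>u. x *s u) U" using False by (auto simp: inj_on_def)
    moreover have "(\<lambda>u. x *s u) ` U \<subseteq> U" using x by auto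
    ultimately have surj: "(\<lambda>u. x *s u) ` U = U" by (intro endo_inj_surj) auto
    have "inverse x *s u \<in> U" if u: "u \<in> U" for u
    proof -
      have "u \<in> (\<lambda>u. x *s u) ` U" using u by (simp only: surj)
      then obtain v where "v \<in> U" "u = x *s v" by blast
      with False show ?thesis by simp
    qed
    then show ?thesis by simp
  qed
qed

lemma dir_eq_spans:
  "dir S = {vec.span {homogeneous 0 (Q - P)} | P Q. P \<in> S \<and> Q \<in> S \<and> P \<noteq> Q}"
  unfolding dir_def projective_line_Int_infinity ..

lemma span_homogeneous_scale:
  fixes a :: "'a::field ^ 'k::finite"
  assumes "c \<noteq> 0"
  shows "vec.span {homogeneous 0 (c *s a)} = vec.span {homogeneous 0 a}"
proof -
  have eq: "homogeneous 0 (c *s a) = c *s homogeneous 0 a"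
    by (auto simp: homogeneous_def vec_eq_iff split: option.split)
  have "homogeneous 0 a = inverse c *s homogeneous 0 (c *s a)" using assms by (simp add: eq)
  then have "homogeneous 0 a \<in> vec.span {homogeneous 0 (c *s a)}"
    by (metis vec.span_base vec.span_scale singletonI)
  moreover have "homogeneous 0 (c *s a) \<in> vec.span {homogeneous 0 a}"
    unfolding eq by (intro vec.span_scale vec.span_base) simp
  ultimately show ?thesis
    by (intro equalityI vec.span_minimal vec.subspace_span) auto
qed

text \<open>A direction determined by \<open>V\<close> is that of a vector of \<open>V\<close>; the multiple of this vector in \<open>U\<close> determines
  the same direction together with the origin.\<close>

lemma dir_eq_if_multiples:
  fixes U V :: "('a::field ^ 'k::finite) set"
  assumes UV: "U \<subseteq> V" and "0 \<in> U" and diff: "\<And>P Q. P \<in> V \<Longrightarrow> Q \<in> V \<Longrightarrow> Q - P \<in> V"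
    and mult: "\<And>a. a \<in> V \<Longrightarrow> \<exists>c. c \<noteq> 0 \<and> c *s a \<in> U"
  shows "dir U = dir V"
proof
  show "dir U \<subseteq> dir V" using UV unfolding dir_eq_spans by blast
  show "dir V \<subseteq> dir U"
  proof
    fix p assume "p \<in> dir V"
    then obtain P Q where PQ: "P \<in> V" "Q \<in> V" "P \<noteq> Q" "p = vec.span {homogeneous 0 (Q - P)}"
      unfolding dir_eq_spans by blast
    obtain c where c: "c \<noteq> 0" "c *s (Q - P) \<in> U" using mult[OF diff[OF PQ(1,2)]] by blast
    have "p = vec.span {homogeneous 0 (c *s (Q - P) - 0)}"
      unfolding PQ(4) using span_homogeneous_scale[OF c(1), of "Q - P"] by simp
    moreover have "0 \<noteq> c *s (Q - P)" using c(1) PQ(3) by simp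
    ultimately show "p \<in> dir U" unfolding dir_eq_spans using c(2) \<open>0 \<in> U\<close> by blast
  qed
qed

theorem theorem3:
  fixes U :: "('a::{field,finite} ^ 'k::finite) set"
    and F :: "'a set"
    and q n r m w :: nat
  assumes "primepow q" and "n \<ge> 1" and "r \<ge> 2"
    and "CARD('a) = q ^ n" and "CARD('k) = r - 1"
    and "is_subfield F" and "card F = q"
    and "subspace_over F U" and "has_dim_over F U m" and "U \<noteq> {0}"
    and "\<forall>l\<in>origin_lines. U \<inter> l = {0} \<or> card (U \<inter> l) \<ge> q ^ w"
    and "\<forall>v. (\<forall>l\<in>origin_lines. U \<inter> l = {0} \<or> card (U \<inter> l) \<ge> q ^ v) \<longrightarrow> v \<le> w"
  shows "(n dvd m \<longrightarrow> w dvd n \<and>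
            (\<exists>K. is_subfield K \<and> card K = q ^ w \<and> subspace_over K U \<and>
                 (\<forall>L. is_subfield L \<and> subspace_over L U \<longrightarrow> L \<subseteq> K))) \<and>
         (\<not> n dvd m \<and> q \<ge> n \<longrightarrow>
            (\<exists>d K. d \<ge> w \<and> d dvd n \<and> is_subfield K \<and> card K = q ^ d \<and>
                   dir U = dir (span_over K U)))"
proof -
  interpret E: finite_field_extension F q n
    by unfold_locales (fact assms)+
  note F = assms(6) and U = assms(8)
  have U0: "0 \<in> U" by (rule subspace_overD(1)[OF U])
  have line: "card (U \<inter> vec.span {u}) \<ge> q ^ w" if "u \<in> U" "u \<noteq> 0" for u
  proof -
    have "vec.span {u} \<in> origin_lines" using that(2) by (auto simp: origin_lines_def)
    moreover have "u \<in> U \<inter> vec.span {u}" using that(1) by (simp add: vec.span_base)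
    then have "U \<inter> vec.span {u} \<noteq> {0}" using that(2) by auto
    ultimately show ?thesis using assms(11) by blast
  qed
  have part_a: "w dvd n \<and> (\<exists>K. is_subfield K \<and> card K = q ^ w \<and> subspace_over K U \<and>
      (\<forall>L. is_subfield L \<and> subspace_over L U \<longrightarrow> L \<subseteq> K))" if "n dvd m"
  proof -
    define K where "K = {c. \<forall>u\<in>U. c *s u \<in> U}"
    have K: "is_subfield K" unfolding K_def by (rule is_subfield_stabilizer[OF F U])
    have KU: "subspace_over K U" using U by (auto simp: K_def subspace_over_def)
    have max: "L \<subseteq> K" if "subspace_over L U" for L
      using that by (auto simp: K_def subspace_over_def)
    obtain d where d: "d > 0" "d dvd n" "card K = q ^ d" "finite_field_extension K (q ^ d) (n div d)"
      by (rule E.intermediate_extension[OF K max[OF U]])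
    have "d \<le> w"
    proof (rule assms(12)[rule_format])
      fix l :: "('a ^ 'k) set" assume "l \<in> origin_lines"
      then obtain v where l: "l = vec.span {v}" by (auto simp: origin_lines_def)
      show "U \<inter> l = {0} \<or> q ^ d \<le> card (U \<inter> l)"
      proof (cases "U \<inter> l = {0}")
        case False
        moreover have "0 \<in> U \<inter> l" using U0 by (simp add: l vec.span_zero)
        ultimately obtain u where u: "u \<in> U" "u \<in> l" "u \<noteq> 0" by auto
        have "(\<lambda>c. c *s u) ` K \<subseteq> U \<inter> l"
          using subspace_overD(3)[OF KU] u by (auto simp: l intro: vec.span_scale)
        then have "card ((\<lambda>c. c *s u) ` K) \<le> card (U \<inter> l)" by (intro card_mono) auto
        moreover have "card ((\<lambda>c. c *s u) ` K) = card K"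
          using u(3) by (intro card_image) (auto simp: inj_on_def)
        ultimately show ?thesis using d(3) by simp
      qed simp
    qed
    moreover have "\<not> d < w"
    proof
      assume "d < w"
      then have less: "card K < q ^ w" using E.q_ge_2 d(3) by simp
      interpret K: finite_field_extension K "q ^ d" "n div d" by (rule d(4))
      obtain s where s: "m = n * s" using \<open>n dvd m\<close> by auto
      have "card U = ((q ^ d) ^ (n div d)) ^ s"
        using has_dim_over_card[OF F assms(9)] assms(7) d(2) s by (simp flip: power_mult)
      moreover have "\<exists>c. c \<notin> K \<and> c *s u \<in> U" if "u \<in> U" "u \<noteq> 0" for u
        by (rule ex_multiplier_notin) (use line[OF that] less in simp)
      ultimately obtain L where "K \<subset> L" "subspace_over L U"
        using K.subspace_over_larger_subfield[OF KU _ assms(10), of s] by metis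
      with max[of L] show False by blast
    qed
    ultimately have "w = d" by simp
    with d K KU max show ?thesis by blast
  qed
  have part_b: "\<exists>d K. d \<ge> w \<and> d dvd n \<and> is_subfield K \<and> card K = q ^ d \<and> dir U = dir (span_over K U)"
    if "q \<ge> n"
  proof -
    let ?P = "\<lambda>K. is_subfield K \<and> F \<subseteq> K \<and> (\<forall>a\<in>span_over K U. \<exists>c. c \<noteq> 0 \<and> c *s a \<in> U)"
    have "span_over F U \<subseteq> U" by (rule span_over_minimal[OF subset_refl U])
    then have PF: "?P F" using F by (auto intro!: exI[of _ 1])
    have "\<exists>K. ?P K \<and> (\<forall>L. ?P L \<longrightarrow> card L \<le> card K)"
    proof (rule Lattices_Big.ex_has_greatest_nat[where b="Suc CARD('a)"])
      show "?P F" by (rule PF)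
      show "\<forall>L. ?P L \<longrightarrow> card L < Suc CARD('a)"
        by (intro allI impI le_imp_less_Suc card_mono subset_UNIV finite)
    qed
    then obtain K where PK: "?P K \<and> (\<forall>L. ?P L \<longrightarrow> card L \<le> card K)" by (rule exE)
    then have K: "is_subfield K" and FK: "F \<subseteq> K"
      and mult: "\<And>a. a \<in> span_over K U \<Longrightarrow> \<exists>c. c \<noteq> 0 \<and> c *s a \<in> U" by blast+
    have max: "card L \<le> card K" if "?P L" for L by (rule conjunct2[OF PK, rule_format, OF that])
    obtain d where d: "d > 0" "d dvd n" "card K = q ^ d" "finite_field_extension K (q ^ d) (n div d)"
      by (rule E.intermediate_extension[OF K FK])
    define V where "V = span_over K U"
    have V: "subspace_over K V" unfolding V_def by (rule subspace_span_over)
    have UV: "U \<subseteq> V" unfolding V_def by (rule span_over_base)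
    have "dir U = dir V"
    proof (rule dir_eq_if_multiples[OF UV U0])
      show "Q - P \<in> V" if "P \<in> V" "Q \<in> V" for P Q by (rule subspace_over_diff[OF K V that(2,1)])
    qed (use mult in \<open>simp add: V_def\<close>)
    moreover have "\<not> d < w"
    proof
      assume "d < w"
      then have less: "card K < q ^ w" using E.q_ge_2 d(3) by simp
      interpret K: finite_field_extension K "q ^ d" "n div d" by (rule d(4))
      have "V \<noteq> {0}" using UV U0 assms(10) by auto
      have "n div d \<le> n" by simp
      also have "n \<le> q ^ 1" using \<open>q \<ge> n\<close> by simp
      also have "q ^ 1 \<le> q ^ d" using d(1) E.q_ge_2 by (intro power_increasing) auto
      finally have "n div d \<le> q ^ d" .
      moreover have "\<exists>c. c \<notin> K \<and> c *s a \<in> V" if a: "a \<in> V" "a \<noteq> 0" for a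
      proof (rule ex_multiplier_notin)
        obtain c where c: "c \<noteq> 0" "c *s a \<in> U" using mult a(1) unfolding V_def by blast
        have "U \<inter> vec.span {c *s a} \<subseteq> V \<inter> vec.span {a}"
          using UV vec.span_minimal[of "{c *s a}" "vec.span {a}"] by (auto simp: vec.span_scale vec.span_base)
        then have "card (U \<inter> vec.span {c *s a}) \<le> card (V \<inter> vec.span {a})" by (intro card_mono) auto
        with line[OF c(2)] c(1) a(2) less show "card K < card (V \<inter> vec.span {a})" by simp
      qed
      ultimately obtain L where L: "is_subfield L" "K \<subset> L"
        and L_mult: "\<And>a. a \<in> span_over L V \<Longrightarrow> \<exists>c. c \<noteq> 0 \<and> c *s a \<in> V"
        using K.span_over_larger_subfield[OF V \<open>V \<noteq> {0}\<close>] by metis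
      have "span_over L U \<subseteq> span_over L V"
        by (rule span_over_minimal[OF order.trans[OF UV span_over_base] subspace_span_over])
      have "\<exists>c. c \<noteq> 0 \<and> c *s a \<in> U" if a: "a \<in> span_over L U" for a
      proof -
        obtain c where c: "c \<noteq> 0" "c *s a \<in> V" using L_mult \<open>span_over L U \<subseteq> span_over L V\<close> a by blast
        obtain c' where c': "c' \<noteq> 0" "c' *s (c *s a) \<in> U" using mult c(2) unfolding V_def by blast
        with c(1) show ?thesis by (intro exI[of _ "c' * c"]) simp
      qed
      then have "card L \<le> card K" using L FK by (intro max) auto
      moreover have "card K < card L" using L(2) by (intro psubset_card_mono) auto
      ultimately show False by simp
    qed
    ultimately show ?thesis using d K by (intro exI[of _ d] exI[of _ K]) (auto simp: V_def)
  qed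
  from part_a part_b show ?thesis by blast
qed

end
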